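(* Let $h$ be sufficiently small. Suppose that the solutions $(\eta,u)$ of the initial-boundary-value problems (CB) and (SCB) (stated in the context) are such that $\eta\in C(0,T;W_\infty^2)$ and $u\in C(0,T;W_\infty^2\cap H_0^1)$. Then the semidiscrete problems (CB$_h$) and (SCB$_h$) (stated in the context), i.e. the standard Galerkin semidiscretizations with continuous piecewise linear functions on a quasiuniform mesh with initial values $\eta_h(0)=P\eta_0$, $u_h(0)=R_hu_0$, have unique solutions $(\eta_h,u_h)$ for $0\le t\le T$, and there is a constant $C$ independent of $h$ such that, in each case, \[ \max_{0\le t\le T}\|\eta(t)-\eta_h(t)\|\le Ch,\qquad \max_{0\le t\le T}\|u(t)-u_h(t)\|_1\le Ch. \]
   Context: Function spaces on $(0,1)$: $H^1$, $H_0^1$ (elements of $H^1$ vanishing at $0$ and $1$) and $W^k_\infty$ are the usual Sobolev spaces; $(\cdot,\cdot)$ and $\|\cdot\|$ are the inner product and norm of $L^2(0,1)$; $\|v\|_1=(\|v\|^2+\tfrac13\|v'\|^2)^{1/2}$. $C(0,T;X)$ is the space of functions $\phi=\phi(t)$ with values in the Banach space $X$ for each $t\in[0,T]$ and such that $t\mapsto\|\phi(t)\|_X$ is continuous on $[0,T]$. $0<T<\infty$ is such that the problems below have solutions on $[0,T]$; solutions are assumed to be sufficiently smooth (in $x$ and $t$) for the equations to hold in the classical sense. Problem (CB): $\eta_t+u_x+(\eta u)_x=0$, $u_t+\eta_x+uu_x-\tfrac13u_{xxt}=0$ for $(x,t)\in[0,1]\times[0,T]$; $\eta(x,0)=\eta_0(x)$,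 $u(x,0)=u_0(x)$ for $x\in[0,1]$; $u(0,t)=u(1,t)=0$ for $t\in[0,T]$. Problem (SCB): $\eta_t+u_x+\tfrac12(\eta u)_x=0$, $u_t+\eta_x+\tfrac32uu_x+\tfrac12\eta\eta_x-\tfrac13u_{xxt}=0$ for $(x,t)\in[0,1]\times[0,T]$, with the same initial and boundary conditions. Mesh and spaces: $0=x_1<x_2<\dots<x_{N+1}=1$ is a partition from a quasiuniform family (the ratio $\max_i(x_{i+1}-x_i)/\min_i(x_{i+1}-x_i)$ is bounded by a constant independent of the partition), $h=\max_i(x_{i+1}-x_i)$; $S_h^2=\{\phi\in C^0[0,1]:\phi|_{[x_j,x_{j+1}]}\in\mathbb P_1,\ 1\le j\le N\}$ ($\mathbb P_r$: polynomials of degree $\le r$), $S_{h,0}^2=\{\phi\in S_h^2:\phi(0)=\phi(1)=0\}$. $P:L^2\to S_h^2$ is the $L^2$-projection onto $S_h^2$. $a(\psi,\chi)=(\psi,\chi)+\tfrac13(\psi',\chi')$, and $R_h:H^1\to S_{h,0}^2$ is defined by $a(R_hw,\chi)=a(w,\chi)$ for all $\chi\in S_{h,0}^2$. Semidiscrete problem (CB$_h$): find $\eta_h:[0,T]\to S_h^2$, $u_h:[0,T]\to S_{h,0}^2$ such that for $t\in[0,T]$ $(\eta_{ht},\phi)+(u_{hx},\phi)+((\eta_hu_h)_x,\phi)=0$ for all $\phi\in S_h^2$, and $a(u_{ht},\chi)+(\eta_{hx},\chi)+(u_hu_{hx},\chi)=0$ for all $\chi\in S_{h,0}^2$, with $\eta_h(0)=P\eta_0$,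 $u_h(0)=R_hu_0$. Semidiscrete problem (SCB$_h$): the same with the equations replaced by $(\eta_{ht},\phi)+(u_{hx},\phi)+\tfrac12((\eta_hu_h)_x,\phi)=0$ for all $\phi\in S_h^2$, and $a(u_{ht},\chi)+(\eta_{hx},\chi)+\tfrac32(u_hu_{hx},\chi)+\tfrac12(\eta_h\eta_{hx},\chi)=0$ for all $\chi\in S_{h,0}^2$. *)

theory Defs
  imports
    "HOL-Analysis.Analysis"
    "HOL-Probability.Essential_Supremum"
    "HOL-Computational_Algebra.Polynomial"
begin

section \<open>Function spaces on the unit interval\<close>

text \<open>
  Elements of the function spaces are represented by functions on the whole real line, of which
  only the values on \<open>[0,1]\<close> (for spaces of measurable functions: on \<open>(0,1)\<close>, almost everywhere)
  are ever used.
\<close>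

abbreviation unit_measure :: "real measure" where
  "unit_measure \<equiv> lebesgue_on {0<..<1}"

definition L2_space :: "(real \<Rightarrow> real) set" where
  "L2_space = {v \<in> borel_measurable unit_measure. integrable unit_measure (\<lambda>x. (v x)\<^sup>2)}"

definition L2_inner :: "(real \<Rightarrow> real) \<Rightarrow> (real \<Rightarrow> real) \<Rightarrow> real" where
  "L2_inner v w = (LINT x|unit_measure. v x * w x)"

definition L2_norm :: "(real \<Rightarrow> real) \<Rightarrow> real" where
  "L2_norm v = sqrt (L2_inner v v)"

definition Linf_space :: "(real \<Rightarrow> real) set" where
  "Linf_space =
    {v \<in> borel_measurable unit_measure. esssup unit_measure (\<lambda>x. ereal \<bar>v x\<bar>) < \<infinity>}"

definition Linf_norm :: "(real \<Rightarrow> real) \<Rightarrow> real" where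
  "Linf_norm v = real_of_ereal (esssup unit_measure (\<lambda>x. ereal \<bar>v x\<bar>))"

text \<open>The test functions \<open>C\<^sub>c\<^sup>\<infinity>(0,1)\<close>.\<close>

definition test_function :: "(real \<Rightarrow> real) \<Rightarrow> bool" where
  "test_function \<phi> \<longleftrightarrow>
    (\<forall>n x. (deriv ^^ n) \<phi> field_differentiable at x) \<and>
    (\<exists>K. compact K \<and> K \<subseteq> {0<..<1} \<and> (\<forall>x. x \<notin> K \<longrightarrow> \<phi> x = 0))"

definition locally_integrable :: "(real \<Rightarrow> real) \<Rightarrow> bool" where
  "locally_integrable v \<longleftrightarrow> (\<forall>K. compact K \<and> K \<subseteq> {0<..<1} \<longrightarrow> set_integrable lebesgue K v)"

definition has_weak_deriv :: "nat \<Rightarrow> (real \<Rightarrow> real) \<Rightarrow> (real \<Rightarrow> real) \<Rightarrow> bool" where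
  "has_weak_deriv k v w \<longleftrightarrow>
    locally_integrable v \<and> locally_integrable w \<and>
    (\<forall>\<phi>. test_function \<phi> \<longrightarrow>
      (LINT x|unit_measure. v x * (deriv ^^ k) \<phi> x) =
      (-1) ^ k * (LINT x|unit_measure. w x * \<phi> x))"

text \<open>
  Weak derivatives are determined only almost everywhere, hence the choice of a representative;
  all expressions below depend only on its equivalence class.
\<close>

definition weak_deriv :: "nat \<Rightarrow> (real \<Rightarrow> real) \<Rightarrow> real \<Rightarrow> real" where
  "weak_deriv k v = (SOME w. has_weak_deriv k v w)"

abbreviation Dx :: "(real \<Rightarrow> real) \<Rightarrow> real \<Rightarrow> real" where
  "Dx v \<equiv> weak_deriv 1 v"

definition Winf :: "nat \<Rightarrow> (real \<Rightarrow> real) set" where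
  "Winf k = {v. \<forall>j\<le>k. \<exists>w\<in>Linf_space. has_weak_deriv j v w}"

definition Winf_norm :: "nat \<Rightarrow> (real \<Rightarrow> real) \<Rightarrow> real" where
  "Winf_norm k v = (MAX j\<in>{..k}. Linf_norm (weak_deriv j v))"

definition H1 :: "(real \<Rightarrow> real) set" where
  "H1 = {v \<in> L2_space. \<exists>w\<in>L2_space. has_weak_deriv 1 v w}"

text \<open>Boundary values are those of the continuous representative.\<close>

definition H1_0 :: "(real \<Rightarrow> real) set" where
  "H1_0 = {v \<in> H1. continuous_on {0..1} v \<and> v 0 = 0 \<and> v 1 = 0}"

definition a_form :: "(real \<Rightarrow> real) \<Rightarrow> (real \<Rightarrow> real) \<Rightarrow> real" where
  "a_form v w = L2_inner v w + 1/3 * L2_inner (Dx v) (Dx w)"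

definition norm_1 :: "(real \<Rightarrow> real) \<Rightarrow> real" where
  "norm_1 v = sqrt ((L2_norm v)\<^sup>2 + 1/3 * (L2_norm (Dx v))\<^sup>2)"

text \<open>
  Only the norm is required to be continuous in time, which is weaker than continuity
  with respect to the norm.
\<close>

definition C_time ::
  "real \<Rightarrow> (real \<Rightarrow> real) set \<Rightarrow> ((real \<Rightarrow> real) \<Rightarrow> real) \<Rightarrow> (real \<Rightarrow> real \<Rightarrow> real) set" where
  "C_time T X nrm =
    {\<phi>. (\<forall>t\<in>{0..T}. \<phi> t \<in> X) \<and> continuous_on {0..T} (\<lambda>t. nrm (\<phi> t))}"


section \<open>Classical solutions of the two Boussinesq systems\<close>

text \<open>
  Functions of \<open>(x,t)\<close> are curried with time first, so that \<open>v t\<close> is the function \<open>v(\<cdot>,t)\<close>.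
  At the boundary of \<open>[0,1] \<times> [0,T]\<close> derivatives are one-sided.
\<close>

definition dx :: "(real \<Rightarrow> real \<Rightarrow> real) \<Rightarrow> real \<Rightarrow> real \<Rightarrow> real" where
  "dx v t x = vector_derivative (v t) (at x within {0..1})"

definition dt :: "real \<Rightarrow> (real \<Rightarrow> real \<Rightarrow> real) \<Rightarrow> real \<Rightarrow> real \<Rightarrow> real" where
  "dt T v t x = vector_derivative (\<lambda>s. v s x) (at t within {0..T})"

definition x_differentiable :: "real \<Rightarrow> (real \<Rightarrow> real \<Rightarrow> real) \<Rightarrow> bool" where
  "x_differentiable T v \<longleftrightarrow>
    (\<forall>t\<in>{0..T}. \<forall>x\<in>{0..1}. v t differentiable at x within {0..1})"

definition t_differentiable :: "real \<Rightarrow> (real \<Rightarrow> real \<Rightarrow> real) \<Rightarrow> bool" where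
  "t_differentiable T v \<longleftrightarrow>
    (\<forall>t\<in>{0..T}. \<forall>x\<in>{0..1}. (\<lambda>s. v s x) differentiable at t within {0..T})"

definition jointly_continuous :: "real \<Rightarrow> (real \<Rightarrow> real \<Rightarrow> real) \<Rightarrow> bool" where
  "jointly_continuous T v \<longleftrightarrow> continuous_on ({0..T} \<times> {0..1}) (\<lambda>(t, x). v t x)"

text \<open>
  All derivatives occurring in the equations exist and are continuous, and so are the
  derivatives of lower order through which \<open>u\<^sub>x\<^sub>x\<^sub>t\<close> is formed.
\<close>

definition classically_smooth ::
  "real \<Rightarrow> (real \<Rightarrow> real \<Rightarrow> real) \<Rightarrow> (real \<Rightarrow> real \<Rightarrow> real) \<Rightarrow> bool" where
  "classically_smooth T \<eta> u \<longleftrightarrow>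
    x_differentiable T \<eta> \<and> t_differentiable T \<eta> \<and>
    jointly_continuous T \<eta> \<and> jointly_continuous T (dx \<eta>) \<and> jointly_continuous T (dt T \<eta>) \<and>
    x_differentiable T u \<and> t_differentiable T u \<and>
    x_differentiable T (dx u) \<and> t_differentiable T (dx (dx u)) \<and>
    jointly_continuous T u \<and> jointly_continuous T (dx u) \<and> jointly_continuous T (dt T u) \<and>
    jointly_continuous T (dx (dx u)) \<and> jointly_continuous T (dt T (dx (dx u)))"

definition initial_boundary_conditions ::
  "real \<Rightarrow> (real \<Rightarrow> real) \<Rightarrow> (real \<Rightarrow> real) \<Rightarrow>
    (real \<Rightarrow> real \<Rightarrow> real) \<Rightarrow> (real \<Rightarrow> real \<Rightarrow> real) \<Rightarrow> bool" where
  "initial_boundary_conditions T \<eta>0 u0 \<eta> u \<longleftrightarrow>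
    (\<forall>x\<in>{0..1}. \<eta> 0 x = \<eta>0 x \<and> u 0 x = u0 x) \<and>
    (\<forall>t\<in>{0..T}. u t 0 = 0 \<and> u t 1 = 0)"

definition CB_solution ::
  "real \<Rightarrow> (real \<Rightarrow> real) \<Rightarrow> (real \<Rightarrow> real) \<Rightarrow>
    (real \<Rightarrow> real \<Rightarrow> real) \<Rightarrow> (real \<Rightarrow> real \<Rightarrow> real) \<Rightarrow> bool" where
  "CB_solution T \<eta>0 u0 \<eta> u \<longleftrightarrow>
    classically_smooth T \<eta> u \<and> initial_boundary_conditions T \<eta>0 u0 \<eta> u \<and>
    (\<forall>t\<in>{0..T}. \<forall>x\<in>{0..1}.
      dt T \<eta> t x + dx u t x + dx (\<lambda>s y. \<eta> s y * u s y) t x = 0 \<and>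
      dt T u t x + dx \<eta> t x + u t x * dx u t x - 1/3 * dt T (dx (dx u)) t x = 0)"

definition SCB_solution ::
  "real \<Rightarrow> (real \<Rightarrow> real) \<Rightarrow> (real \<Rightarrow> real) \<Rightarrow>
    (real \<Rightarrow> real \<Rightarrow> real) \<Rightarrow> (real \<Rightarrow> real \<Rightarrow> real) \<Rightarrow> bool" where
  "SCB_solution T \<eta>0 u0 \<eta> u \<longleftrightarrow>
    classically_smooth T \<eta> u \<and> initial_boundary_conditions T \<eta>0 u0 \<eta> u \<and>
    (\<forall>t\<in>{0..T}. \<forall>x\<in>{0..1}.
      dt T \<eta> t x + dx u t x + 1/2 * dx (\<lambda>s y. \<eta> s y * u s y) t x = 0 \<and>
      dt T u t x + dx \<eta> t x + 3/2 * (u t x * dx u t x) + 1/2 * (\<eta> t x * dx \<eta> t x)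
        - 1/3 * dt T (dx (dx u)) t x = 0)"


section \<open>Meshes and finite element spaces\<close>

text \<open>A mesh is a pair \<open>(N, X)\<close> with nodes \<open>X 1, \<dots>, X (N + 1)\<close>.\<close>

type_synonym mesh = "nat \<times> (nat \<Rightarrow> real)"

definition is_mesh :: "mesh \<Rightarrow> bool" where
  "is_mesh = (\<lambda>(N, X). N \<ge> 1 \<and> X 1 = 0 \<and> X (N + 1) = 1 \<and> (\<forall>i\<in>{1..N}. X i < X (i + 1)))"

definition mesh_size :: "mesh \<Rightarrow> real" where
  "mesh_size = (\<lambda>(N, X). MAX i\<in>{1..N}. X (i + 1) - X i)"

definition min_mesh_size :: "mesh \<Rightarrow> real" where
  "min_mesh_size = (\<lambda>(N, X). MIN i\<in>{1..N}. X (i + 1) - X i)"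

definition quasiuniform_family :: "mesh set \<Rightarrow> bool" where
  "quasiuniform_family F \<longleftrightarrow>
    (\<forall>m\<in>F. is_mesh m) \<and> (\<exists>\<sigma>. \<forall>m\<in>F. mesh_size m / min_mesh_size m \<le> \<sigma>)"

definition S_h :: "mesh \<Rightarrow> (real \<Rightarrow> real) set" where
  "S_h = (\<lambda>(N, X). {\<phi>. continuous_on {0..1} \<phi> \<and>
    (\<forall>j\<in>{1..N}. \<exists>p :: real poly. degree p \<le> 1 \<and> (\<forall>x\<in>{X j..X (j + 1)}. \<phi> x = poly p x))})"

definition S_h0 :: "mesh \<Rightarrow> (real \<Rightarrow> real) set" where
  "S_h0 m = {\<phi> \<in> S_h m. \<phi> 0 = 0 \<and> \<phi> 1 = 0}"

text \<open>
  The two projections are determined on \<open>[0,1]\<close> only, whence \<open>SOME\<close> rather than \<open>THE\<close>.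
\<close>

definition L2_proj :: "mesh \<Rightarrow> (real \<Rightarrow> real) \<Rightarrow> real \<Rightarrow> real" where
  "L2_proj m v = (SOME p. p \<in> S_h m \<and> (\<forall>\<phi>\<in>S_h m. L2_inner p \<phi> = L2_inner v \<phi>))"

definition R_h :: "mesh \<Rightarrow> (real \<Rightarrow> real) \<Rightarrow> real \<Rightarrow> real" where
  "R_h m w = (SOME r. r \<in> S_h0 m \<and> (\<forall>\<psi>\<in>S_h0 m. a_form r \<psi> = a_form w \<psi>))"


section \<open>The semidiscrete problems\<close>

text \<open>
  Since the finite element spaces are finite-dimensional, differentiability in time of a function
  with values in them is the same as pointwise differentiability, and the time derivative is
  the pointwise one.
\<close>

definition semidiscrete_functions ::
  "real \<Rightarrow> mesh \<Rightarrow> (real \<Rightarrow> real) \<Rightarrow> (real \<Rightarrow> real) \<Rightarrow>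
    (real \<Rightarrow> real \<Rightarrow> real) \<Rightarrow> (real \<Rightarrow> real \<Rightarrow> real) \<Rightarrow> bool" where
  "semidiscrete_functions T m \<eta>0 u0 \<eta>h uh \<longleftrightarrow>
    (\<forall>t\<in>{0..T}. \<eta>h t \<in> S_h m \<and> uh t \<in> S_h0 m) \<and>
    t_differentiable T \<eta>h \<and> t_differentiable T uh \<and>
    (\<forall>x\<in>{0..1}. \<eta>h 0 x = L2_proj m \<eta>0 x \<and> uh 0 x = R_h m u0 x)"

definition CB_h_solution ::
  "real \<Rightarrow> mesh \<Rightarrow> (real \<Rightarrow> real) \<Rightarrow> (real \<Rightarrow> real) \<Rightarrow>
    (real \<Rightarrow> real \<Rightarrow> real) \<Rightarrow> (real \<Rightarrow> real \<Rightarrow> real) \<Rightarrow> bool" where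
  "CB_h_solution T m \<eta>0 u0 \<eta>h uh \<longleftrightarrow>
    semidiscrete_functions T m \<eta>0 u0 \<eta>h uh \<and>
    (\<forall>t\<in>{0..T}.
      (\<forall>\<phi>\<in>S_h m.
        L2_inner (dt T \<eta>h t) \<phi> + L2_inner (Dx (uh t)) \<phi>
          + L2_inner (Dx (\<lambda>x. \<eta>h t x * uh t x)) \<phi> = 0) \<and>
      (\<forall>\<psi>\<in>S_h0 m.
        a_form (dt T uh t) \<psi> + L2_inner (Dx (\<eta>h t)) \<psi>
          + L2_inner (\<lambda>x. uh t x * Dx (uh t) x) \<psi> = 0))"

definition SCB_h_solution ::
  "real \<Rightarrow> mesh \<Rightarrow> (real \<Rightarrow> real) \<Rightarrow> (real \<Rightarrow> real) \<Rightarrow>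
    (real \<Rightarrow> real \<Rightarrow> real) \<Rightarrow> (real \<Rightarrow> real \<Rightarrow> real) \<Rightarrow> bool" where
  "SCB_h_solution T m \<eta>0 u0 \<eta>h uh \<longleftrightarrow>
    semidiscrete_functions T m \<eta>0 u0 \<eta>h uh \<and>
    (\<forall>t\<in>{0..T}.
      (\<forall>\<phi>\<in>S_h m.
        L2_inner (dt T \<eta>h t) \<phi> + L2_inner (Dx (uh t)) \<phi>
          + 1/2 * L2_inner (Dx (\<lambda>x. \<eta>h t x * uh t x)) \<phi> = 0) \<and>
      (\<forall>\<psi>\<in>S_h0 m.
        a_form (dt T uh t) \<psi> + L2_inner (Dx (\<eta>h t)) \<psi>
          + 3/2 * L2_inner (\<lambda>x. uh t x * Dx (uh t) x) \<psi>
          + 1/2 * L2_inner (\<lambda>x. \<eta>h t x * Dx (\<eta>h t) x) \<psi> = 0))"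

text \<open>Uniqueness refers to the values on \<open>[0,T] \<times> [0,1]\<close>.\<close>

definition unique_solution_on ::
  "real \<Rightarrow> ((real \<Rightarrow> real \<Rightarrow> real) \<Rightarrow> (real \<Rightarrow> real \<Rightarrow> real) \<Rightarrow> bool) \<Rightarrow>
    (real \<Rightarrow> real \<Rightarrow> real) \<Rightarrow> (real \<Rightarrow> real \<Rightarrow> real) \<Rightarrow> bool" where
  "unique_solution_on T Sol \<eta>h uh \<longleftrightarrow>
    Sol \<eta>h uh \<and>
    (\<forall>\<eta>h' uh'. Sol \<eta>h' uh' \<longrightarrow>
      (\<forall>t\<in>{0..T}. \<forall>x\<in>{0..1}. \<eta>h' t x = \<eta>h t x \<and> uh' t x = uh t x))"

end

theory Submission
  imports Defs
begin

text \<open>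
  Both systems belong to the family

    \<open>\<eta>\<^sub>t + (u + \<alpha> \<eta> u)\<^sub>x = 0\<close>,  \<open>u\<^sub>t - 1/3 u\<^sub>x\<^sub>x\<^sub>t + (\<eta> + \<beta>/2 u\<^sup>2 + \<gamma>/2 \<eta>\<^sup>2)\<^sub>x = 0\<close>:

  (CB) is \<open>(\<alpha>, \<beta>, \<gamma>) = (1, 1, 0)\<close> and (SCB) is \<open>(1/2, 3/2, 1/2)\<close>. The lemma \<open>error_estimate\<close> treats
  all parameters at once.

  The discrete solution is compared with the piecewise linear interpolants \<open>Z\<close> of \<open>\<eta>\<close> and \<open>U\<close> of \<open>u\<close>
  rather than with projections. Uniformly in time, \<open>\<eta>\<^sub>x\<close> is Lipschitz because of \<open>\<eta> \<in> W\<^sup>2\<^sub>\<infinity>\<close>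
  (\<open>C_time_Winf_imp_Lipschitz_deriv\<close>), \<open>u\<^sub>x\<close> because \<open>u\<^sub>x\<^sub>x\<close> is bounded, \<open>\<eta>\<^sub>t\<close> by the first equation,
  and \<open>u\<^sub>t\<close> because \<open>u\<^sub>x\<^sub>x\<^sub>t\<close> is bounded and \<open>u\<close> vanishes at both ends. Hence \<open>Z\<close>, \<open>U\<close> and their
  \<open>x\<close>-derivatives are \<open>O(h)\<close>-close to the exact ones pointwise, and \<open>(Z, U)\<close> solves the Galerkin
  equations up to residuals that are \<open>O(h)\<close> pointwise (\<open>interp_consistency\<close>). The third order term
  adds no error of its own: the derivative of an interpolation error is orthogonal to piecewise
  constants (\<open>interp_orthogonality\<close>).

  For stability put \<open>\<theta> = Z - \<eta>\<^sub>h\<close>, \<open>\<xi> = U - u\<^sub>h\<close> and \<open>E = \<parallel>\<theta>\<parallel>\<^sup>2 + \<parallel>\<xi>\<parallel>\<^sub>1\<^sup>2\<close>. When the error equations are tested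
  with \<open>(\<theta>, \<xi>)\<close>, every term that contains \<open>\<theta>\<^sub>x\<close> goes into the derivative of a function vanishing
  at \<open>0\<close> and \<open>1\<close>; what remains is at most a multiple of \<open>\<theta>\<^sup>2 + \<xi>\<^sup>2 + \<xi>\<^sub>x\<^sup>2\<close>, plus the squared residuals,
  provided that \<open>\<bar>\<xi>\<^sub>x\<bar> \<le> 1\<close> (\<open>energy_production_bound\<close>). An inverse inequality yields \<open>\<bar>\<xi>\<^sub>x\<bar> \<le> 1\<close> as long
  as \<open>E\<close> is at most a third of the smallest mesh width. Gronwall's inequality gives \<open>E = O(h\<^sup>2)\<close>, and
  on a quasiuniform family this is below that threshold for small \<open>h\<close>, so that the threshold is never
  reached (\<open>Gronwall_continuation\<close>, \<open>stability\<close>).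

  In orthonormal bases the semidiscrete problem is an ordinary differential equation with quadratic
  right-hand side. After truncation of the coefficients it is globally Lipschitz, hence solvable on
  all of \<open>[0,T]\<close>; the stability estimate then shows that the truncation is never active
  (\<open>galerkin_solution_exists\<close>). Uniqueness is the same stability estimate for two discrete solutions,
  with residual zero (\<open>galerkin_solution_unique\<close>).

  Weak derivatives are given only through an arbitrary choice of representative. By the lemma of
  du Bois-Reymond they agree almost everywhere with the piecewise classical derivatives, and this
  turns all integrals into ordinary calculus.
\<close>

section \<open>Weak derivatives\<close>

text \<open>
  The derivative of such a function is again one, with another polynomial and with \<open>k + 2\<close> in place
  of \<open>k\<close>; this closure is what makes the case \<open>p = 1\<close>, \<open>k = 0\<close> smooth.
\<close>

definition bump :: "real \<Rightarrow> real \<Rightarrow> real \<Rightarrow> real poly \<Rightarrow> nat \<Rightarrow> real \<Rightarrow> real" where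
  "bump c a b p k x =
    (if a < x \<and> x < b then poly p x / ((x - a) * (b - x)) ^ k * exp (- c / ((x - a) * (b - x)))
     else 0)"

lemma power_le_fact_exp:
  fixes y :: real assumes "0 \<le> y" shows "y ^ n \<le> fact n * exp y"
proof -
  have "(\<Sum>i\<in>{n}. y ^ i / fact i) \<le> (\<Sum>i. y ^ i / fact i)"
    using summable_exp[of y] assms by (intro sum_le_suminf) (auto simp: divide_inverse mult.commute)
  also have "(\<Sum>i. y ^ i / fact i) = exp y"
    by (simp add: exp_def divide_inverse mult.commute)
  finally show ?thesis by (simp add: divide_simps mult.commute)
qed

lemma has_field_derivative_zero_if_quadratic_bound:
  fixes f :: "real \<Rightarrow> real"
  assumes "f e = 0" "\<And>x. \<bar>f x\<bar> \<le> C * (x - e)\<^sup>2"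
  shows "(f has_field_derivative 0) (at e)"
proof -
  have "((\<lambda>x. (f x - f e) / (x - e)) \<longlongrightarrow> 0) (at e)"
  proof (rule Lim_null_comparison)
    show "\<forall>\<^sub>F x in at e. norm ((f x - f e) / (x - e)) \<le> C * \<bar>x - e\<bar>"
    proof (rule eventually_at_topological[THEN iffD2, OF exI[of _ UNIV]], safe)
      fix x assume "x \<noteq> e"
      then show "norm ((f x - f e) / (x - e)) \<le> C * \<bar>x - e\<bar>"
        using assms(2)[of x] assms(1)
        by (simp add: abs_divide divide_le_eq power2_eq_square abs_mult[symmetric] mult.assoc)
    qed simp_all
    show "((\<lambda>x. C * \<bar>x - e\<bar>) \<longlongrightarrow> 0) (at e)"
      by (auto intro!: tendsto_eq_intros)
  qed
  then show ?thesis by (simp add: has_field_derivative_iff)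
qed

text \<open>
  With \<open>q = (x - a) (b - x)\<close> the exponential beats the pole: \<open>(c/q)\<^bsup>k+2\<^esup> exp (- c/q) \<le> (k + 2)!\<close> leaves a
  factor \<open>q\<^sup>2\<close>, which is quadratically small at either end. This gives differentiability at \<open>a\<close> and \<open>b\<close>.
\<close>

lemma bump_quadratic_bound:
  assumes "0 < c" "a < b"
  shows "\<exists>C. \<forall>x. \<bar>bump c a b p k x\<bar> \<le> C * (x - a)\<^sup>2 \<and> \<bar>bump c a b p k x\<bar> \<le> C * (x - b)\<^sup>2"
proof -
  have "compact (poly p ` {a..b})"
    by (intro compact_continuous_image continuous_intros) auto
  from compact_imp_bounded[OF this] obtain P
    where P: "0 < P" "\<And>x. x \<in> {a..b} \<Longrightarrow> \<bar>poly p x\<bar> \<le> P"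
    unfolding bounded_pos by auto
  define D where "D = P * fact (k + 2) / c ^ (k + 2)"
  have D: "0 \<le> D" using P assms by (simp add: D_def)
  have main: "\<bar>bump c a b p k x\<bar> \<le> D * ((x - a) * (b - x))\<^sup>2" for x
  proof (cases "a < x \<and> x < b")
    case True
    define q where "q = (x - a) * (b - x)"
    have q: "0 < q" using True by (simp add: q_def)
    have "(c / q) ^ n * exp (- c / q) \<le> fact n" for n
      using power_le_fact_exp[of "c / q" n] q assms
      by (simp add: exp_minus pos_divide_le_eq flip: divide_inverse)
    from this[of "k + 2"]
    have "(c ^ (k + 2) * (exp (- c / q) / q ^ k)) / q\<^sup>2 \<le> fact (k + 2)"
      by (simp only: power_divide) (simp add: power_add power2_eq_square mult_ac)
    then have "c ^ (k + 2) * (exp (- c / q) / q ^ k) \<le> fact (k + 2) * q\<^sup>2"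
      using q by (subst (asm) pos_divide_le_eq) auto
    then have 1: "exp (- c / q) / q ^ k \<le> fact (k + 2) / c ^ (k + 2) * q\<^sup>2"
      using assms pos_le_divide_eq[of "c ^ (k + 2)" "exp (- c / q) / q ^ k" "fact (k + 2) * q\<^sup>2"]
      by (simp add: mult.commute)
    have "\<bar>bump c a b p k x\<bar> = \<bar>poly p x\<bar> * (exp (- c / q) / q ^ k)"
      using True q by (simp add: bump_def q_def abs_mult)
    also have "\<dots> \<le> P * (fact (k + 2) / c ^ (k + 2) * q\<^sup>2)"
      using P True 1 q by (intro mult_mono) auto
    finally show ?thesis by (simp add: D_def q_def)
  qed (use D in \<open>auto simp: bump_def\<close>)
  have main2: "\<bar>bump c a b p k x\<bar> \<le> D * (b - a)\<^sup>2 * (x - a)\<^sup>2 \<and>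
      \<bar>bump c a b p k x\<bar> \<le> D * (b - a)\<^sup>2 * (x - b)\<^sup>2" for x
  proof (cases "a < x \<and> x < b")
    case True
    have "D * ((x - a) * (b - x))\<^sup>2 \<le> D * ((x - a) * (b - a))\<^sup>2"
      using True D by (intro mult_left_mono[of _ _ D] power_mono mult_left_mono) auto
    moreover have "D * ((x - a) * (b - x))\<^sup>2 \<le> D * ((b - a) * (b - x))\<^sup>2"
      using True D by (intro mult_left_mono[of _ _ D] power_mono mult_right_mono) auto
    moreover have "D * ((x - a) * (b - a))\<^sup>2 = D * (b - a)\<^sup>2 * (x - a)\<^sup>2"
      "D * ((b - a) * (b - x))\<^sup>2 = D * (b - a)\<^sup>2 * (x - b)\<^sup>2"
      by (simp_all add: power_mult_distrib power2_commute[of x b])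
    ultimately show ?thesis using main[of x] by linarith
  qed (use D in \<open>auto simp: bump_def\<close>)
  then show ?thesis by blast
qed

lemma bump_derivative_algebra:
  fixes i q P P' Q' I e k c :: real
  assumes "i * q = 1"
  shows "(P' * I + P * - (k * Q' * I * i)) * e + P * I * (e * (c * Q' * i\<^sup>2)) =
    (P' * q\<^sup>2 - k * P * Q' * q + c * (P * Q')) * I * i\<^sup>2 * e"
  using assms by algebra

lemma bump_has_derivative:
  assumes "0 < c" "a < b"
  shows "\<exists>p'. \<forall>x. (bump c a b p k has_field_derivative bump c a b p' (k + 2) x) (at x)"
proof -
  \<comment> \<open>\<open>Q\<close> is the polynomial \<open>(x - a) (b - x)\<close>, and \<open>p'\<close> is the numerator over \<open>Q\<^bsup>k+2\<^esup>\<close> that the product rule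
    produces.\<close>
  define Q where "Q = [: - (a * b), a + b, - 1 :]"
  have Q: "poly Q x = (x - a) * (b - x)" for x by (simp add: Q_def algebra_simps)
  define p' where "p' = pderiv p * Q\<^sup>2 - of_nat k * p * pderiv Q * Q + smult c (p * pderiv Q)"
  have "(bump c a b p k has_field_derivative bump c a b p' (k + 2) x) (at x)" for x
  proof -
    consider "a < x \<and> x < b" | "x < a \<or> x > b" | "x = a \<or> x = b" by linarith
    then show ?thesis
    proof cases
      case 1
      note ab = 1
      then have q: "poly Q x > 0" by (simp add: Q)
      define f where "f x = poly p x * inverse (poly Q x) ^ k * exp (- c / poly Q x)" for x
      let ?q = "poly Q x" and ?q' = "poly (pderiv Q) x" and ?i = "inverse (poly Q x)"
      have "((\<lambda>x. inverse (poly Q x)) has_field_derivative - (?q' * ?i\<^sup>2)) (at x)"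
        using q by (auto intro!: derivative_eq_intros poly_DERIV simp: power2_eq_square)
      from DERIV_power[OF this, of k]
      have 1: "((\<lambda>x. inverse (poly Q x) ^ k) has_field_derivative - (real k * ?q' * ?i ^ k * ?i)) (at x)"
        by (cases k) (simp_all add: power2_eq_square mult_ac)
      have 2: "((\<lambda>x. exp (- c / poly Q x)) has_field_derivative exp (- c / ?q) * (c * ?q' * ?i\<^sup>2)) (at x)"
        using q by (auto intro!: derivative_eq_intros poly_DERIV simp: field_simps power2_eq_square)
      have "(f has_field_derivative
          (poly (pderiv p) x * ?i ^ k + poly p x * - (real k * ?q' * ?i ^ k * ?i)) * exp (- c / ?q)
          + poly p x * ?i ^ k * (exp (- c / ?q) * (c * ?q' * ?i\<^sup>2))) (at x)"
        unfolding f_def using DERIV_mult[OF DERIV_mult[OF poly_DERIV[of p x] 1] 2]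
        by (simp add: algebra_simps)
      moreover have "(poly (pderiv p) x * ?i ^ k + poly p x * - (real k * ?q' * ?i ^ k * ?i)) * exp (- c / ?q)
          + poly p x * ?i ^ k * (exp (- c / ?q) * (c * ?q' * ?i\<^sup>2)) = bump c a b p' (k + 2) x"
      proof -
        have i: "?i * ?q = 1" using q by simp
        have "bump c a b p' (k + 2) x = poly p' x * ?i ^ k * ?i\<^sup>2 * exp (- c / ?q)"
          using \<open>a < x \<and> x < b\<close>
          unfolding bump_def Q[symmetric]
          by (simp add: power_add power_inverse inverse_mult_distrib divide_inverse power2_eq_square)
        also have "poly p' x = poly (pderiv p) x * ?q\<^sup>2 - real k * poly p x * ?q' * ?q + c * (poly p x * ?q')"
          by (simp add: p'_def)
        finally show ?thesis using bump_derivative_algebra[OF i] by simp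
      qed
      ultimately have "(f has_field_derivative bump c a b p' (k + 2) x) (at x)" by simp
      moreover have "f y = bump c a b p k y" if "y \<in> {a<..<b}" for y
        using that by (simp add: f_def bump_def Q divide_inverse power_inverse del: inverse_mult_distrib)
      ultimately show ?thesis
        using ab by (auto intro!: has_field_derivative_transform_within_open[of f _ x "{a<..<b}"])
    next
      case 2
      then have "bump c a b p' (k + 2) x = 0" by (auto simp: bump_def)
      moreover have "(bump c a b p k has_field_derivative 0) (at x)"
        by (rule has_field_derivative_transform_within_open[of "\<lambda>_. 0" _ x "- {a..b}"])
          (use 2 in \<open>auto simp: bump_def open_Compl\<close>)
      ultimately show ?thesis by simp
    next
      case 3
      obtain C where C: "\<forall>x. \<bar>bump c a b p k x\<bar> \<le> C * (x - a)\<^sup>2 \<and> \<bar>bump c a b p k x\<bar> \<le> C * (x - b)\<^sup>2"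
        using bump_quadratic_bound[OF assms] by blast
      have "bump c a b p k x = 0" using 3 by (auto simp: bump_def)
      then have "(bump c a b p k has_field_derivative 0) (at x)"
        by (rule has_field_derivative_zero_if_quadratic_bound[where C = C]) (use 3 C in blast)
      then show ?thesis using 3 by (auto simp: bump_def)
    qed
  qed
  then show ?thesis by blast
qed

lemma bump_iterated_deriv:
  assumes "0 < c" "a < b"
  shows "\<exists>p k. (deriv ^^ n) (bump c a b 1 0) = bump c a b p k"
proof (induction n)
  case (Suc n)
  then obtain p k where pk: "(deriv ^^ n) (bump c a b 1 0) = bump c a b p k" by blast
  obtain p' where "\<forall>x. (bump c a b p k has_field_derivative bump c a b p' (k + 2) x) (at x)"
    using bump_has_derivative[OF assms] by blast
  then have "deriv (bump c a b p k) = bump c a b p' (k + 2)"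
    by (auto intro!: ext DERIV_imp_deriv)
  with pk show ?case by auto
qed auto

lemma bump_test_function:
  assumes "0 < c" "0 < a" "a < b" "b < 1"
  shows "test_function (bump c a b 1 0)"
  unfolding test_function_def
proof (intro conjI allI exI[of _ "{a..b}"])
  fix n x
  obtain p k where pk: "(deriv ^^ n) (bump c a b 1 0) = bump c a b p k"
    using bump_iterated_deriv[of c a b n] assms by blast
  then show "(deriv ^^ n) (bump c a b 1 0) field_differentiable at x"
    using bump_has_derivative[of c a b p k] assms unfolding field_differentiable_def by metis
qed (use assms in \<open>auto simp: bump_def\<close>)

lemma bump_range: "0 < c \<Longrightarrow> 0 \<le> bump c a b 1 0 x \<and> bump c a b 1 0 x \<le> 1"
  by (auto simp: bump_def)

text \<open>
  Letting the parameter \<open>c\<close> tend to \<open>0\<close> makes the bumps, all of them bounded by \<open>1\<close>, approximate the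
  indicator of an interval, so that dominated convergence applies.
\<close>

lemma bump_tendsto_indicator:
  "(\<lambda>n. bump (1 / real (Suc n)) a b 1 0 x) \<longlonglongrightarrow> indicator {a<..<b} x"
proof (cases "a < x \<and> x < b")
  case True
  have "(\<lambda>n. exp (- (1 / real (Suc n)) / ((x - a) * (b - x)))) \<longlonglongrightarrow> exp (- 0 / ((x - a) * (b - x)))"
    using True by (intro tendsto_intros LIMSEQ_Suc[OF lim_1_over_n]) auto
  then show ?thesis using True by (simp add: bump_def)
qed (auto simp: bump_def)

lemma test_function_continuous: "test_function \<phi> \<Longrightarrow> continuous_on A \<phi>"
  unfolding test_function_def
  by (metis continuous_at_imp_continuous_on field_differentiable_imp_continuous_at funpow_0)

lemma integral_unit_times_supported:
  fixes f g :: "real \<Rightarrow> real"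
  assumes "K \<subseteq> {0<..<1}" "\<And>x. x \<notin> K \<Longrightarrow> g x = 0"
  shows "(LINT x|unit_measure. f x * g x) = (LINT x|lebesgue. (indicator K x * f x) * g x)"
  and "integrable unit_measure (\<lambda>x. f x * g x) \<longleftrightarrow> integrable lebesgue (\<lambda>x. (indicator K x * f x) * g x)"
proof -
  have eq: "indicator {0<..<1} x *\<^sub>R (f x * g x) = (indicator K x * f x) * g x" for x
    using assms by (auto simp: indicator_def)
  show "(LINT x|unit_measure. f x * g x) = (LINT x|lebesgue. (indicator K x * f x) * g x)"
    by (subst integral_restrict_space) (auto simp: eq simp del: real_scaleR_def)
  show "integrable unit_measure (\<lambda>x. f x * g x) \<longleftrightarrow> integrable lebesgue (\<lambda>x. (indicator K x * f x) * g x)"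
    by (subst integrable_restrict_space) (auto simp: eq simp del: real_scaleR_def)
qed

lemma integrable_locally_integrable_times_test:
  assumes w: "locally_integrable w" and "continuous_on UNIV \<phi>"
    and K: "compact K" "K \<subseteq> {0<..<1}" "\<And>x. x \<notin> K \<Longrightarrow> \<phi> x = 0"
  shows "integrable unit_measure (\<lambda>x. w x * \<phi> x)"
proof -
  have "bounded (\<phi> ` K)"
    by (intro compact_imp_bounded compact_continuous_image continuous_on_subset[OF assms(2)] K) auto
  then obtain B where B: "B > 0" "\<forall>x\<in>K. \<bar>\<phi> x\<bar> \<le> B" by (auto simp: bounded_pos)
  then have B': "\<bar>\<phi> x\<bar> \<le> B" for x using K(3)[of x] by (cases "x \<in> K") auto
  have i: "integrable lebesgue (\<lambda>x. indicator K x * w x)"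
    using w K by (auto simp: locally_integrable_def set_integrable_def)
  have "\<phi> \<in> borel_measurable lebesgue"
    using borel_measurable_continuous_onI[OF assms(2)] by (simp add: measurable_completion)
  then have "integrable lebesgue (\<lambda>x. (indicator K x * w x) * \<phi> x)"
  proof (intro Bochner_Integration.integrable_bound[OF integrable_mult_right[OF i, of B]])
    show "AE x in lebesgue. norm (indicator K x * w x * \<phi> x) \<le> norm (B * (indicator K x * w x))"
      using B B' by (intro AE_I2) (auto simp: abs_mult mult.commute intro!: mult_right_mono)
  qed (use i in auto)
  then show ?thesis by (subst integral_unit_times_supported(2)[OF K(2,3)])
qed

text \<open>
  The positive and the negative part of \<open>g\<close> are densities of two finite measures that agree on all
  half-lines, hence on all Borel sets; and densities are unique.
\<close>

lemma AE_zero_if_tail_integrals_zero: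
  fixes g :: "real \<Rightarrow> real"
  assumes g: "integrable lebesgue g" and z: "\<And>x. (LINT y|lebesgue. indicator {x<..} y * g y) = 0"
  shows "AE x in lebesgue. g x = 0"
proof -
  have gm: "g \<in> borel_measurable (completion lborel)" using g by auto
  obtain f where f[measurable]: "f \<in> borel_measurable lborel" and fg: "AE x in lborel. g x = f x"
    using completion_ex_borel_measurable_real[OF gm] by blast
  have fg': "AE x in lebesgue. g x = f x" using fg by (rule AE_completion)
  have fi: "integrable lborel f"
  proof -
    have "integrable lebesgue f" using g fg' f
      by (subst integrable_cong_AE[where g = g]) (auto simp: measurable_completion gm)
    then show ?thesis by (subst (asm) integrable_completion) auto
  qed
  have z': "(LINT y|lborel. indicator {x<..} y * f y) = 0" for x
  proof -
    have "(LINT y|lborel. indicator {x<..} y * f y) = (LINT y|lebesgue. indicator {x<..} y * f y)"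
      by (rule integral_completion[symmetric]) measurable
    also have "\<dots> = (LINT y|lebesgue. indicator {x<..} y * g y)"
    proof (rule integral_cong_AE)
      show "(\<lambda>y. indicator {x<..} y * g y) \<in> borel_measurable lebesgue"
        using gm by (intro borel_measurable_times borel_measurable_indicator) auto
      show "(\<lambda>y. indicator {x<..} y * f y) \<in> borel_measurable lebesgue"
        using measurable_completion[OF f]
        by (intro borel_measurable_times borel_measurable_indicator) auto
    qed (use fg' in auto)
    finally show ?thesis using z by simp
  qed
  define M where "M = density lborel (\<lambda>x. ennreal (f x))"
  define N where "N = density lborel (\<lambda>x. ennreal (- f x))"
  have [simp]: "indicator A x * ennreal (h x) = ennreal (indicator A x * h x)" for A x and h :: "real \<Rightarrow> real"
    by (auto simp: indicator_def)
  have fin: "(\<integral>\<^sup>+y. ennreal (f y) \<partial>lborel) < \<infinity>" "(\<integral>\<^sup>+y. ennreal (- f y) \<partial>lborel) < \<infinity>"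
    using integrableD(2)[OF fi] integrableD(2)[OF integrable_minus[OF fi]] 
    by (auto simp: real_integrable_def fi top.not_eq_extremum dest: integrableD)
  have "M = N"
  proof (rule measure_eqI_lessThan)
    fix x
    have i: "integrable lborel (\<lambda>y. indicator {x<..} y * f y)"
      using integrable_mult_indicator[OF _ fi, of "{x<..}"] by simp
    have e: "emeasure M {x<..} = (\<integral>\<^sup>+y. ennreal (indicator {x<..} y * f y) \<partial>lborel)"
      "emeasure N {x<..} = (\<integral>\<^sup>+y. ennreal (- (indicator {x<..} y * f y)) \<partial>lborel)"
      unfolding M_def N_def
      by (subst emeasure_density; auto intro!: nn_integral_cong simp: indicator_def)+
    have n: "(\<integral>\<^sup>+y. ennreal (indicator {x<..} y * f y) \<partial>lborel) \<noteq> \<infinity>"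
      "(\<integral>\<^sup>+y. ennreal (- (indicator {x<..} y * f y)) \<partial>lborel) \<noteq> \<infinity>"
      using i by (auto simp: real_integrable_def)
    show "emeasure M {x<..} < \<infinity>" using e n by (simp add: top.not_eq_extremum)
    have re: "enn2real (emeasure M {x<..}) = enn2real (emeasure N {x<..})"
      using z'[of x] real_lebesgue_integral_def[OF i] unfolding e by simp
    have "emeasure M {x<..} = ennreal (enn2real (emeasure M {x<..}))"
      using n(1) unfolding e by (simp add: top.not_eq_extremum)
    also have "\<dots> = emeasure N {x<..}"
      using n(2) unfolding re unfolding e by (simp add: top.not_eq_extremum)
    finally show "emeasure M {x<..} = emeasure N {x<..}" .
  qed (auto simp: M_def N_def)
  then have "AE x in lborel. ennreal (f x) = ennreal (- f x)"
    using fin unfolding M_def N_def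
    by (intro finite_density_unique[THEN iffD1]) auto
  then have "AE x in lborel. f x = 0"
  proof eventually_elim
    case (elim x)
    then show ?case by (cases "0 \<le> f x") (auto simp: ennreal_neg ennreal_eq_0_iff)
  qed
  then have "AE x in lebesgue. f x = 0" by (rule AE_completion)
  with fg' show ?thesis by eventually_elim simp
qed

text \<open>
  Testing with bumps that converge to the indicator of an interval shows that the integral of \<open>w\<close> over
  every compact subinterval vanishes.
\<close>

lemma du_Bois_Reymond:
  assumes w: "locally_integrable w"
    and z: "\<And>\<phi>. test_function \<phi> \<Longrightarrow> (LINT x|unit_measure. w x * \<phi> x) = 0"
  shows "AE x in unit_measure. w x = 0"
proof -
  have loc: "AE x in lebesgue. indicator {a..b} x * w x = 0" if ab: "0 < a" "a < b" "b < 1" for a b :: real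
  proof (rule AE_zero_if_tail_integrals_zero)
    show i: "integrable lebesgue (\<lambda>x. indicator {a..b} x * w x)"
      using w ab unfolding locally_integrable_def set_integrable_def
      by (auto dest!: spec[of _ "{a..b}"])
    fix x
    define a' where "a' = max a x"
    show "(LINT y|lebesgue. indicator {x<..} y * (indicator {a..b} y * w y)) = 0"
    proof (cases "a' < b")
      case False
      then have "AE y in lebesgue. indicator {x<..} y * (indicator {a..b} y * w y) = 0"
        using ab AE_completion[OF AE_lborel_singleton[of b]] by (auto simp: a'_def indicator_def)
      then show ?thesis by (rule integral_eq_zero_AE)
    next
      case True
      define \<phi> where "\<phi> n = bump (1 / real (Suc n)) a' b 1 0" for n
      have t: "test_function (\<phi> n)" for n
        using True ab unfolding \<phi>_def by (intro bump_test_function) (auto simp: a'_def)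
      have 1: "(LINT y|lebesgue. indicator {a..b} y * w y * \<phi> n y) = 0" for n
      proof -
        have "(LINT y|unit_measure. w y * \<phi> n y) = (LINT y|lebesgue. indicator {a..b} y * w y * \<phi> n y)"
          using ab by (intro integral_unit_times_supported) (auto simp: \<phi>_def bump_def a'_def)
        then show ?thesis using z[OF t[of n]] by simp
      qed
      have "(\<lambda>n. LINT y|lebesgue. indicator {a..b} y * w y * \<phi> n y)
        \<longlonglongrightarrow> (LINT y|lebesgue. indicator {a..b} y * w y * indicator {a'<..<b} y)"
      proof (rule integral_dominated_convergence[where w = "\<lambda>y. norm (indicator {a..b} y * w y)"])
        show "(\<lambda>y. indicator {a..b} y * w y * indicator {a'<..<b} y) \<in> borel_measurable lebesgue"
          by (intro borel_measurable_times[OF borel_measurable_integrable[OF i]] borel_measurable_indicator) auto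
        show "(\<lambda>y. indicator {a..b} y * w y * \<phi> n y) \<in> borel_measurable lebesgue" for n
        proof -
          have "\<phi> n \<in> borel_measurable lebesgue"
            using borel_measurable_continuous_onI[OF test_function_continuous[OF t[of n]]]
            by (simp add: measurable_completion)
          then show ?thesis by (intro borel_measurable_times[OF borel_measurable_integrable[OF i]])
        qed
        show "AE y in lebesgue. (\<lambda>n. indicator {a..b} y * w y * \<phi> n y)
            \<longlonglongrightarrow> indicator {a..b} y * w y * indicator {a'<..<b} y"
          unfolding \<phi>_def by (intro AE_I2 tendsto_mult_left bump_tendsto_indicator)
        show "AE y in lebesgue. norm (indicator {a..b} y * w y * \<phi> n y) \<le> norm (indicator {a..b} y * w y)" for n
        proof (rule AE_I2)
          fix y
          have "0 \<le> \<phi> n y \<and> \<phi> n y \<le> 1" unfolding \<phi>_def by (rule bump_range) simp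
          then show "norm (indicator {a..b} y * w y * \<phi> n y) \<le> norm (indicator {a..b} y * w y)"
            by (simp add: abs_mult mult_left_le)
        qed
      qed (use i in auto)
      then have "(LINT y|lebesgue. indicator {a..b} y * w y * indicator {a'<..<b} y) = 0"
        unfolding 1 by (simp add: LIMSEQ_const_iff)
      moreover have "(LINT y|lebesgue. indicator {x<..} y * (indicator {a..b} y * w y)) =
          (LINT y|lebesgue. indicator {a..b} y * w y * indicator {a'<..<b} y)"
      proof (rule integral_cong_AE)
        show "AE y in lebesgue. indicator {x<..} y * (indicator {a..b} y * w y) =
            indicator {a..b} y * w y * indicator {a'<..<b} y"
          using AE_completion[OF AE_lborel_singleton[of b]] AE_completion[OF AE_lborel_singleton[of a]]
          by eventually_elim (auto simp: indicator_def a'_def)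
        show "(\<lambda>y. indicator {a..b} y * w y * indicator {a'<..<b} y) \<in> borel_measurable lebesgue"
          "(\<lambda>y. indicator {x<..} y * (indicator {a..b} y * w y)) \<in> borel_measurable lebesgue"
          by (intro borel_measurable_times[OF borel_measurable_integrable[OF i]]
                borel_measurable_times[OF _ borel_measurable_integrable[OF i]]
                borel_measurable_indicator; simp)+
      qed
      ultimately show ?thesis by simp
    qed
  qed
  \<comment> \<open>Countably many compact intervals exhaust \<open>(0,1)\<close>.\<close>
  have "AE x in lebesgue. \<forall>n::nat. indicator {1 / (real n + 3)..1 - 1 / (real n + 3)} x * w x = 0"
    unfolding AE_all_countable by (intro allI loc) (auto simp: field_simps)
  then have "AE x in lebesgue. x \<in> {0<..<1} \<longrightarrow> w x = 0"
  proof eventually_elim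
    case (elim x)
    show ?case
    proof
      assume x: "x \<in> {0<..<1}"
      then have "0 < min x (1 - x)" by auto
      then obtain n where n: "1 / real (Suc n) < min x (1 - x)"
        using reals_Archimedean[of "min x (1 - x)"] unfolding inverse_eq_divide by blast
      have "1 / (real n + 3) \<le> 1 / real (Suc n)" by (simp add: frac_le)
      then have "x \<in> {1 / (real n + 3)..1 - 1 / (real n + 3)}" using n by auto
      then show "w x = 0" using elim by (metis indicator_simps(1) mult_1)
    qed
  qed
  then show ?thesis by (subst AE_restrict_space_iff) auto
qed

lemma has_weak_deriv_unique:
  assumes "has_weak_deriv k v w1" "has_weak_deriv k v w2"
  shows "AE x in unit_measure. w1 x = w2 x"
proof -
  have "AE x in unit_measure. w1 x - w2 x = 0"
  proof (rule du_Bois_Reymond)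
    show "locally_integrable (\<lambda>x. w1 x - w2 x)"
      using assms by (auto simp: has_weak_deriv_def locally_integrable_def)
    fix \<phi> assume t: "test_function \<phi>"
    obtain K where K: "compact K" "K \<subseteq> {0<..<1}" "\<And>x. x \<notin> K \<Longrightarrow> \<phi> x = 0"
      using t by (auto simp: test_function_def)
    have "integrable unit_measure (\<lambda>x. w1 x * \<phi> x)" "integrable unit_measure (\<lambda>x. w2 x * \<phi> x)"
      using assms by (intro integrable_locally_integrable_times_test[OF _ test_function_continuous[OF t] K];
          simp add: has_weak_deriv_def)+
    moreover have "(LINT x|unit_measure. w1 x * \<phi> x) = (LINT x|unit_measure. w2 x * \<phi> x)"
      using assms t by (auto simp: has_weak_deriv_def dest!: spec[of _ \<phi>])
    ultimately show "(LINT x|unit_measure. (w1 x - w2 x) * \<phi> x) = 0"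
      by (simp add: left_diff_distrib)
  qed
  then show ?thesis by simp
qed

lemma weak_deriv_AE_eq:
  assumes "has_weak_deriv k v w"
  shows "AE x in unit_measure. weak_deriv k v x = w x"
  using has_weak_deriv_unique[OF _ assms] someI[of "has_weak_deriv k v", OF assms]
  unfolding weak_deriv_def by blast

section \<open>Calculus of piecewise continuously differentiable functions\<close>

text \<open>
  The integrands of the whole proof are of this kind. In contrast to boundedness, the property passes
  to functions that agree almost everywhere, such as the representatives chosen for weak derivatives.
\<close>

definition ess_bounded :: "(real \<Rightarrow> real) \<Rightarrow> bool" where
  "ess_bounded f \<longleftrightarrow> f \<in> borel_measurable unit_measure \<and> (\<exists>B. AE x in unit_measure. \<bar>f x\<bar> \<le> B)"

text \<open>
  Continuity across the finitely many exceptional points is what the fundamental theorem of calculus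
  needs there; at these points \<open>f'\<close> has to be bounded only.
\<close>

definition has_piecewise_deriv :: "(real \<Rightarrow> real) \<Rightarrow> (real \<Rightarrow> real) \<Rightarrow> bool" where
  "has_piecewise_deriv f f' \<longleftrightarrow>
    continuous_on {0..1} f \<and> f' \<in> borel_measurable unit_measure \<and>
    (\<exists>B. \<forall>x\<in>{0<..<1}. \<bar>f' x\<bar> \<le> B) \<and>
    (\<exists>S. finite S \<and> (\<forall>x\<in>{0<..<1} - S. (f has_real_derivative f' x) (at x)))"

definition piecewise_C1 :: "(real \<Rightarrow> real) \<Rightarrow> bool" where
  "piecewise_C1 f \<longleftrightarrow> (\<exists>f'. has_piecewise_deriv f f')"

lemma finite_unit_measure: "finite_measure unit_measure"
  by (rule finite_measure_lebesgue_on) simp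

lemma emeasure_unit_measure_space: "measure unit_measure (space unit_measure) = 1"
  by (simp add: measure_restrict_space)

lemma AE_unit_measureI: "(\<And>x. x \<in> {0<..<1} \<Longrightarrow> P x) \<Longrightarrow> AE x in unit_measure. P x"
  by (rule AE_I2) simp

lemma AE_unit_measure_finite_exception:
  assumes "finite S" "\<And>x. x \<in> {0<..<1} - S \<Longrightarrow> P x"
  shows "AE x in unit_measure. P x"
proof -
  have "AE x in lborel. \<forall>y\<in>S. x \<noteq> y"
    using assms(1) by (subst AE_ball_countable) (auto intro: countable_finite AE_lborel_singleton)
  then have "AE x in lebesgue. \<forall>y\<in>S. x \<noteq> y" by (rule AE_completion)
  then have "AE x in lebesgue. x \<in> {0<..<1} \<longrightarrow> P x"
    by eventually_elim (use assms(2) in auto)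
  then show ?thesis by (subst AE_restrict_space_iff) auto
qed

subsection \<open>Essentially bounded functions\<close>

lemma ess_bounded_measurable: "ess_bounded f \<Longrightarrow> f \<in> borel_measurable unit_measure"
  by (simp add: ess_bounded_def)

lemma ess_boundedI:
  "f \<in> borel_measurable unit_measure \<Longrightarrow> (\<And>x. x \<in> {0<..<1} \<Longrightarrow> \<bar>f x\<bar> \<le> B) \<Longrightarrow> ess_bounded f"
  unfolding ess_bounded_def by (auto intro!: exI[of _ B] AE_unit_measureI)

lemma ess_bounded_const: "ess_bounded (\<lambda>_. c)"
  by (rule ess_boundedI[of _ "\<bar>c\<bar>"]) auto

lemma ess_bounded_add:
  assumes "ess_bounded f" "ess_bounded g" shows "ess_bounded (\<lambda>x. f x + g x)"
proof -
  obtain B C where "AE x in unit_measure. \<bar>f x\<bar> \<le> B" "AE x in unit_measure. \<bar>g x\<bar> \<le> C"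
    using assms by (auto simp: ess_bounded_def)
  then have "AE x in unit_measure. \<bar>f x + g x\<bar> \<le> B + C" by eventually_elim linarith
  then show ?thesis using assms by (auto simp: ess_bounded_def)
qed

lemma ess_bounded_mult:
  assumes "ess_bounded f" "ess_bounded g" shows "ess_bounded (\<lambda>x. f x * g x)"
proof -
  obtain B C where "AE x in unit_measure. \<bar>f x\<bar> \<le> B" "AE x in unit_measure. \<bar>g x\<bar> \<le> C"
    using assms by (auto simp: ess_bounded_def)
  then have "AE x in unit_measure. \<bar>f x * g x\<bar> \<le> B * C"
  proof eventually_elim
    case (elim x)
    then show ?case unfolding abs_mult by (intro mult_mono) auto
  qed
  then show ?thesis using assms by (auto simp: ess_bounded_def)
qed

lemma ess_bounded_cmult: "ess_bounded f \<Longrightarrow> ess_bounded (\<lambda>x. c * f x)"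
  by (intro ess_bounded_mult ess_bounded_const)

lemma ess_bounded_minus: "ess_bounded f \<Longrightarrow> ess_bounded (\<lambda>x. - f x)"
  using ess_bounded_cmult[of f "-1"] by simp

lemma ess_bounded_diff: "ess_bounded f \<Longrightarrow> ess_bounded g \<Longrightarrow> ess_bounded (\<lambda>x. f x - g x)"
  using ess_bounded_add[OF _ ess_bounded_minus, of f g] by simp

lemma ess_bounded_power2: "ess_bounded f \<Longrightarrow> ess_bounded (\<lambda>x. (f x)\<^sup>2)"
  using ess_bounded_mult[of f f] by (simp add: power2_eq_square)

lemma ess_bounded_continuous:
  assumes "continuous_on {0..1} f" shows "ess_bounded f"
proof -
  have "bounded (f ` {0..1})"
    by (intro compact_imp_bounded compact_continuous_image assms) simp
  then obtain B where "\<forall>x\<in>{0..1}. \<bar>f x\<bar> \<le> B" by (auto simp: bounded_iff)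
  moreover have "f \<in> borel_measurable unit_measure"
    by (intro continuous_imp_measurable_on_sets_lebesgue continuous_on_subset[OF assms]) auto
  ultimately show ?thesis by (intro ess_boundedI[of _ B]) auto
qed

lemma ess_bounded_cong_AE:
  assumes "ess_bounded f" "AE x in unit_measure. g x = f x" shows "ess_bounded g"
proof -
  have "(\<lambda>x. if x \<in> {0<..<1} then f x else 0) \<in> borel_measurable lebesgue"
    using assms(1) by (subst borel_measurable_if) (auto simp: ess_bounded_def)
  moreover have "AE x in lebesgue. (if x \<in> {0<..<1} then f x else 0) = (if x \<in> {0<..<1} then g x else 0)"
    using assms(2) by (subst (asm) AE_restrict_space_iff) auto
  ultimately have "(\<lambda>x. if x \<in> {0<..<1} then g x else 0) \<in> borel_measurable lebesgue"
    by (rule borel_measurable_AE)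
  then have "g \<in> borel_measurable unit_measure" by (subst (asm) borel_measurable_if) auto
  moreover obtain B where "AE x in unit_measure. \<bar>f x\<bar> \<le> B"
    using assms(1) by (auto simp: ess_bounded_def)
  then have "AE x in unit_measure. \<bar>g x\<bar> \<le> B" using assms(2) by eventually_elim simp
  ultimately show ?thesis by (auto simp: ess_bounded_def)
qed

lemma ess_bounded_integrable:
  assumes "ess_bounded f" shows "integrable unit_measure f"
  using assms finite_measure.integrable_const_bound[OF finite_unit_measure, of f]
  by (auto simp: ess_bounded_def)

lemmas ess_bounded_intros =
  ess_bounded_const ess_bounded_add ess_bounded_mult ess_bounded_minus ess_bounded_diff
  ess_bounded_power2

lemma ess_bounded_locally_integrable:
  assumes "ess_bounded f" shows "locally_integrable f"
  unfolding locally_integrable_def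
proof safe
  fix K :: "real set" assume K: "compact K" "K \<subseteq> {0<..<1}"
  have "set_integrable lebesgue {0<..<1} f"
    using ess_bounded_integrable[OF assms] by (simp add: set_integrable_def integrable_restrict_space)
  then show "set_integrable lebesgue K f"
    by (rule set_integrable_subset) (use K in \<open>auto simp: compact_imp_closed lmeasurable_compact fmeasurableD\<close>)
qed

lemma integral_unit_mono:
  assumes "ess_bounded f" "ess_bounded g" "AE x in unit_measure. f x \<le> g x"
  shows "(LINT x|unit_measure. f x) \<le> (LINT x|unit_measure. g x)"
  using assms by (intro integral_mono_AE ess_bounded_integrable)

lemma integral_unit_cong_AE:
  assumes "ess_bounded f" "AE x in unit_measure. g x = f x"
  shows "(LINT x|unit_measure. g x) = (LINT x|unit_measure. f x)"
  by (intro integral_cong_AE ess_bounded_measurable ess_bounded_cong_AE[OF assms]) (use assms in auto)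

subsection \<open>The inner product of \<open>L\<^sup>2\<close> on essentially bounded functions\<close>

lemma L2_inner_commute: "L2_inner f g = L2_inner g f"
  by (simp add: L2_inner_def mult.commute)

lemma L2_inner_add_left:
  assumes "ess_bounded f" "ess_bounded g" "ess_bounded h"
  shows "L2_inner (\<lambda>x. f x + g x) h = L2_inner f h + L2_inner g h"
  unfolding L2_inner_def distrib_right
  by (intro Bochner_Integration.integral_add ess_bounded_integrable ess_bounded_intros assms)

lemma L2_inner_cmult_left: "L2_inner (\<lambda>x. c * f x) h = c * L2_inner f h"
  unfolding L2_inner_def by (simp add: mult.assoc)

lemma L2_inner_diff_left:
  assumes "ess_bounded f" "ess_bounded g" "ess_bounded h"
  shows "L2_inner (\<lambda>x. f x - g x) h = L2_inner f h - L2_inner g h"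
  unfolding L2_inner_def left_diff_distrib
  by (intro Bochner_Integration.integral_diff ess_bounded_integrable ess_bounded_intros assms)

lemma L2_inner_cong_AE:
  assumes "ess_bounded f" "ess_bounded h" "AE x in unit_measure. g x = f x"
    "AE x in unit_measure. k x = h x"
  shows "L2_inner g k = L2_inner f h"
  unfolding L2_inner_def
  by (rule integral_unit_cong_AE[OF ess_bounded_mult]) (use assms in auto)

lemma L2_inner_cong:
  assumes "\<And>x. x \<in> {0<..<1} \<Longrightarrow> f x = g x" "\<And>x. x \<in> {0<..<1} \<Longrightarrow> h x = k x"
  shows "L2_inner f h = L2_inner g k"
  unfolding L2_inner_def using assms by (intro Bochner_Integration.integral_cong) auto

lemma L2_inner_nonneg: "0 \<le> L2_inner f f"
  unfolding L2_inner_def by (intro Bochner_Integration.integral_nonneg) simp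

lemma L2_inner_le_bound:
  assumes "ess_bounded f" "AE x in unit_measure. \<bar>f x\<bar> \<le> B"
  shows "L2_inner f f \<le> B\<^sup>2"
proof -
  have "L2_inner f f \<le> (LINT x|unit_measure. B\<^sup>2)"
    unfolding L2_inner_def
  proof (intro integral_unit_mono ess_bounded_intros assms)
    show "AE x in unit_measure. f x * f x \<le> B\<^sup>2"
      using assms(2)
    proof eventually_elim
      case (elim x)
      then have "\<bar>f x\<bar>\<^sup>2 \<le> B\<^sup>2" by (intro power_mono) auto
      then show ?case by (simp add: power2_eq_square)
    qed
  qed
  also have "\<dots> = B\<^sup>2" using emeasure_unit_measure_space by simp
  finally show ?thesis .
qed

subsection \<open>Piecewise derivatives and their relation to weak derivatives\<close>

lemma has_piecewise_deriv_ess_bounded: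
  assumes "has_piecewise_deriv f f'" shows "ess_bounded f" "ess_bounded f'"
  using assms ess_bounded_continuous ess_boundedI unfolding has_piecewise_deriv_def by blast+

lemma has_piecewise_deriv_add:
  assumes "has_piecewise_deriv f f'" "has_piecewise_deriv g g'"
  shows "has_piecewise_deriv (\<lambda>x. f x + g x) (\<lambda>x. f' x + g' x)"
proof -
  obtain B C S R where
    B: "\<forall>x\<in>{0<..<1}. \<bar>f' x\<bar> \<le> B" "\<forall>x\<in>{0<..<1}. \<bar>g' x\<bar> \<le> C" and "finite S" "finite R" and
    d: "\<forall>x\<in>{0<..<1} - S. (f has_real_derivative f' x) (at x)"
    "\<forall>x\<in>{0<..<1} - R. (g has_real_derivative g' x) (at x)"
    using assms unfolding has_piecewise_deriv_def by blast
  have "\<forall>x\<in>{0<..<1}. \<bar>f' x + g' x\<bar> \<le> B + C"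
    using B by (meson abs_triangle_ineq add_mono order_trans)
  moreover have "\<forall>x\<in>{0<..<1} - (S \<union> R). ((\<lambda>x. f x + g x) has_real_derivative f' x + g' x) (at x)"
    using d by (auto intro!: DERIV_add)
  ultimately show ?thesis
    using assms \<open>finite S\<close> \<open>finite R\<close> unfolding has_piecewise_deriv_def
    by (auto intro!: continuous_on_add exI[of _ "S \<union> R"])
qed

lemma has_piecewise_deriv_mult:
  assumes "has_piecewise_deriv f f'" "has_piecewise_deriv g g'"
  shows "has_piecewise_deriv (\<lambda>x. f x * g x) (\<lambda>x. f' x * g x + f x * g' x)"
proof -
  have c: "continuous_on {0..1} f" "continuous_on {0..1} g"
    using assms by (auto simp: has_piecewise_deriv_def)
  have "bounded (f ` {0..1})" "bounded (g ` {0..1})"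
    by (intro compact_imp_bounded compact_continuous_image c; simp)+
  then obtain F G where F: "\<And>x. x \<in> {0..1} \<Longrightarrow> \<bar>f x\<bar> \<le> F" "\<And>x. x \<in> {0..1} \<Longrightarrow> \<bar>g x\<bar> \<le> G"
    unfolding bounded_iff by (metis imageI real_norm_def)
  obtain B C S R where
    B: "\<forall>x\<in>{0<..<1}. \<bar>f' x\<bar> \<le> B" "\<forall>x\<in>{0<..<1}. \<bar>g' x\<bar> \<le> C" and "finite S" "finite R" and
    d: "\<forall>x\<in>{0<..<1} - S. (f has_real_derivative f' x) (at x)"
    "\<forall>x\<in>{0<..<1} - R. (g has_real_derivative g' x) (at x)"
    using assms unfolding has_piecewise_deriv_def by blast
  have "\<forall>x\<in>{0<..<1}. \<bar>f' x * g x + f x * g' x\<bar> \<le> B * G + F * C"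
  proof
    fix x :: real assume x: "x \<in> {0<..<1}"
    then have "\<bar>f' x * g x\<bar> \<le> B * G" "\<bar>f x * g' x\<bar> \<le> F * C"
      using B F[of x] by (auto simp: abs_mult intro!: mult_mono intro: order_trans[OF abs_ge_zero])
    then show "\<bar>f' x * g x + f x * g' x\<bar> \<le> B * G + F * C" by linarith
  qed
  moreover have "\<forall>x\<in>{0<..<1} - (S \<union> R). ((\<lambda>x. f x * g x) has_real_derivative f' x * g x + f x * g' x) (at x)"
    using d by (auto intro!: derivative_eq_intros)
  moreover have "(\<lambda>x. f' x * g x + f x * g' x) \<in> borel_measurable unit_measure"
    using assms has_piecewise_deriv_ess_bounded ess_bounded_measurable
    by (intro borel_measurable_add borel_measurable_times) blast+
  ultimately show ?thesis
    using c \<open>finite S\<close> \<open>finite R\<close> unfolding has_piecewise_deriv_def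
    by (auto intro!: continuous_on_mult exI[of _ "S \<union> R"])
qed

lemma has_piecewise_deriv_const: "has_piecewise_deriv (\<lambda>_. c) (\<lambda>_. 0)"
  unfolding has_piecewise_deriv_def by (auto intro!: exI[of _ "{}"] exI[of _ 0])

lemma has_piecewise_deriv_cmult:
  assumes "has_piecewise_deriv f f'"
  shows "has_piecewise_deriv (\<lambda>x. c * f x) (\<lambda>x. c * f' x)"
  using has_piecewise_deriv_mult[OF has_piecewise_deriv_const assms] by simp

lemma has_piecewise_deriv_cong:
  assumes "has_piecewise_deriv f f'" "\<And>x. x \<in> {0..1} \<Longrightarrow> g x = f x"
  shows "has_piecewise_deriv g f'"
proof -
  have c: "continuous_on {0..1} g"
    using assms unfolding has_piecewise_deriv_def by (metis continuous_on_cong)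
  have "(g has_real_derivative f' x) (at x)"
    if "(f has_real_derivative f' x) (at x)" "x \<in> {0<..<1}" for x
    by (rule has_field_derivative_transform_within_open[OF that(1), of "{0<..<1}"])
      (use that assms(2) in auto)
  with assms(1) c show ?thesis unfolding has_piecewise_deriv_def by blast
qed

lemma has_piecewise_deriv_C1:
  assumes d: "\<And>x. x \<in> {0..1} \<Longrightarrow> (f has_real_derivative f' x) (at x within {0..1})"
    and c: "continuous_on {0..1} f'"
  shows "has_piecewise_deriv f f'"
  unfolding has_piecewise_deriv_def
proof (intro conjI)
  show "continuous_on {0..1} f" using d by (rule DERIV_continuous_on)
  have "bounded (f' ` {0..1})" by (intro compact_imp_bounded compact_continuous_image c) simp
  then obtain B where "\<forall>x\<in>{0..1}. \<bar>f' x\<bar> \<le> B" by (auto simp: bounded_iff)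
  then show "\<exists>B. \<forall>x\<in>{0<..<1}. \<bar>f' x\<bar> \<le> B" by (intro exI[of _ B]) auto
  show "f' \<in> borel_measurable unit_measure"
    using ess_bounded_continuous[OF c] by (rule ess_bounded_measurable)
  have "(f has_real_derivative f' x) (at x)" if "x \<in> {0<..<1}" for x
    using d[of x] that at_within_interior[of x "{0..1}"] by (auto simp: interior_atLeastAtMost_real)
  then show "\<exists>S. finite S \<and> (\<forall>x\<in>{0<..<1} - S. (f has_real_derivative f' x) (at x))"
    by (intro exI[of _ "{}"]) auto
qed

lemma integral_piecewise_deriv:
  assumes "has_piecewise_deriv f f'"
  shows "(LINT x|unit_measure. f' x) = f 1 - f 0"
proof -
  obtain S where S: "finite S" "\<forall>x\<in>{0<..<1} - S. (f has_real_derivative f' x) (at x)"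
    using assms unfolding has_piecewise_deriv_def by blast
  have "(f' has_integral f 1 - f 0) {0..1}"
  proof (rule fundamental_theorem_of_calculus_interior_strong[OF S(1)])
    show "continuous_on {0..1} f" using assms by (simp add: has_piecewise_deriv_def)
  qed (use S(2) in \<open>auto simp: has_real_derivative_iff_has_vector_derivative\<close>)
  then have "integral {0<..<1} f' = f 1 - f 0"
    by (simp add: has_integral_Icc_iff_Ioo integral_unique)
  moreover have "(LINT x|unit_measure. f' x) = integral {0<..<1} f'"
    using has_piecewise_deriv_ess_bounded[OF assms]
    by (intro lebesgue_integral_eq_integral ess_bounded_integrable) auto
  ultimately show ?thesis by simp
qed

lemma test_function_piecewise_deriv:
  assumes "test_function \<phi>" shows "has_piecewise_deriv \<phi> (deriv \<phi>)"
proof (rule has_piecewise_deriv_C1)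
  have "(deriv ^^ n) \<phi> field_differentiable at x" for n x
    using assms by (simp add: test_function_def)
  from this[of 0] this[of "Suc 0"] have
    1: "\<phi> field_differentiable at x" and 2: "deriv \<phi> field_differentiable at x" for x by simp_all
  show "(\<phi> has_real_derivative deriv \<phi> x) (at x within {0..1})" for x
    using 1 by (simp add: DERIV_deriv_iff_field_differentiable has_field_derivative_at_within)
  show "continuous_on {0..1} (deriv \<phi>)"
    using 2 by (intro continuous_at_imp_continuous_on ballI field_differentiable_imp_continuous_at)
qed

text \<open>
  Integration by parts: \<open>f \<phi>\<close> is again piecewise differentiable, and it vanishes at both ends.
\<close>

lemma has_weak_deriv_piecewise:
  assumes "has_piecewise_deriv f f'" shows "has_weak_deriv 1 f f'"
  unfolding has_weak_deriv_def
proof (intro conjI allI impI)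
  note b = has_piecewise_deriv_ess_bounded[OF assms]
  show "locally_integrable f" "locally_integrable f'"
    using b by (auto intro: ess_bounded_locally_integrable)
  fix \<phi> assume t: "test_function \<phi>"
  note d = test_function_piecewise_deriv[OF t]
  note bd = has_piecewise_deriv_ess_bounded[OF d]
  have z: "\<phi> 0 = 0" "\<phi> 1 = 0"
    using t unfolding test_function_def by (metis greaterThanLessThan_iff less_irrefl subsetD)+
  have "(LINT x|unit_measure. f' x * \<phi> x + f x * deriv \<phi> x) = 0"
    using integral_piecewise_deriv[OF has_piecewise_deriv_mult[OF assms d]] z by simp
  then have "(LINT x|unit_measure. f' x * \<phi> x) + (LINT x|unit_measure. f x * deriv \<phi> x) = 0"
    using b bd by (subst (asm) Bochner_Integration.integral_add)
      (auto intro!: ess_bounded_integrable ess_bounded_mult)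
  then show "(LINT x|unit_measure. f x * (deriv ^^ 1) \<phi> x) = (- 1) ^ 1 * (LINT x|unit_measure. f' x * \<phi> x)"
    by simp
qed

lemma Dx_AE_piecewise_deriv:
  assumes "has_piecewise_deriv f f'" shows "AE x in unit_measure. Dx f x = f' x"
  by (rule weak_deriv_AE_eq[OF has_weak_deriv_piecewise[OF assms]])

subsection \<open>Rules for the weak derivative\<close>

lemma piecewise_C1_ess_bounded:
  assumes "piecewise_C1 f" shows "ess_bounded f" "ess_bounded (Dx f)"
proof -
  obtain f' where f': "has_piecewise_deriv f f'" using assms by (auto simp: piecewise_C1_def)
  show "ess_bounded f" "ess_bounded (Dx f)"
    using has_piecewise_deriv_ess_bounded[OF f'] Dx_AE_piecewise_deriv[OF f']
    by (auto intro: ess_bounded_cong_AE)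
qed

lemma piecewise_C1_continuous: "piecewise_C1 f \<Longrightarrow> continuous_on {0..1} f"
  by (auto simp: piecewise_C1_def has_piecewise_deriv_def)

lemma piecewise_C1_const: "piecewise_C1 (\<lambda>_. c)"
  unfolding piecewise_C1_def using has_piecewise_deriv_const by blast

lemma Dx_const: "AE x in unit_measure. Dx (\<lambda>_. c) x = 0"
  by (rule Dx_AE_piecewise_deriv[OF has_piecewise_deriv_const])

lemma Dx_add:
  assumes "piecewise_C1 f" "piecewise_C1 g"
  shows "piecewise_C1 (\<lambda>x. f x + g x)"
    and "AE x in unit_measure. Dx (\<lambda>x. f x + g x) x = Dx f x + Dx g x"
proof -
  obtain f' g' where d: "has_piecewise_deriv f f'" "has_piecewise_deriv g g'"
    using assms by (auto simp: piecewise_C1_def)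
  note s = has_piecewise_deriv_add[OF this]
  show "piecewise_C1 (\<lambda>x. f x + g x)" using s by (auto simp: piecewise_C1_def)
  show "AE x in unit_measure. Dx (\<lambda>x. f x + g x) x = Dx f x + Dx g x"
    using Dx_AE_piecewise_deriv[OF d(1)] Dx_AE_piecewise_deriv[OF d(2)] Dx_AE_piecewise_deriv[OF s]
    by eventually_elim simp
qed

lemma Dx_mult:
  assumes "piecewise_C1 f" "piecewise_C1 g"
  shows "piecewise_C1 (\<lambda>x. f x * g x)"
    and "AE x in unit_measure. Dx (\<lambda>x. f x * g x) x = Dx f x * g x + f x * Dx g x"
proof -
  obtain f' g' where d: "has_piecewise_deriv f f'" "has_piecewise_deriv g g'"
    using assms by (auto simp: piecewise_C1_def)
  note s = has_piecewise_deriv_mult[OF this]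
  show "piecewise_C1 (\<lambda>x. f x * g x)" using s by (auto simp: piecewise_C1_def)
  show "AE x in unit_measure. Dx (\<lambda>x. f x * g x) x = Dx f x * g x + f x * Dx g x"
    using Dx_AE_piecewise_deriv[OF d(1)] Dx_AE_piecewise_deriv[OF d(2)] Dx_AE_piecewise_deriv[OF s]
    by eventually_elim simp
qed

lemma Dx_cmult:
  assumes "piecewise_C1 f"
  shows "piecewise_C1 (\<lambda>x. c * f x)" and "AE x in unit_measure. Dx (\<lambda>x. c * f x) x = c * Dx f x"
  using Dx_mult[OF piecewise_C1_const assms, of c] Dx_const[of c]
  by (auto elim: eventually_elim2)

lemma Dx_diff:
  assumes "piecewise_C1 f" "piecewise_C1 g"
  shows "piecewise_C1 (\<lambda>x. f x - g x)"
    and "AE x in unit_measure. Dx (\<lambda>x. f x - g x) x = Dx f x - Dx g x"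
  using Dx_add[OF assms(1) Dx_cmult(1)[OF assms(2), of "-1"]] Dx_cmult(2)[OF assms(2), of "-1"]
  by (auto elim: eventually_elim2)

lemma Dx_cong:
  assumes "piecewise_C1 f" "\<And>x. x \<in> {0..1} \<Longrightarrow> g x = f x"
  shows "piecewise_C1 g" and "AE x in unit_measure. Dx g x = Dx f x"
proof -
  obtain f' where d: "has_piecewise_deriv f f'" using assms by (auto simp: piecewise_C1_def)
  have s: "has_piecewise_deriv g f'" by (rule has_piecewise_deriv_cong[OF d assms(2)])
  show "piecewise_C1 g" using s by (auto simp: piecewise_C1_def)
  have "AE x in unit_measure. Dx g x = f' x" by (rule Dx_AE_piecewise_deriv[OF s])
  then show "AE x in unit_measure. Dx g x = Dx f x"
    using Dx_AE_piecewise_deriv[OF d] by eventually_elim simp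
qed

lemma Dx_sum:
  assumes "finite I" "\<And>i. i \<in> I \<Longrightarrow> piecewise_C1 (f i)"
  shows "piecewise_C1 (\<lambda>x. \<Sum>i\<in>I. c i * f i x)"
    and "AE x in unit_measure. Dx (\<lambda>x. \<Sum>i\<in>I. c i * f i x) x = (\<Sum>i\<in>I. c i * Dx (f i) x)"
proof -
  have "piecewise_C1 (\<lambda>x. \<Sum>i\<in>I. c i * f i x) \<and>
    (AE x in unit_measure. Dx (\<lambda>x. \<Sum>i\<in>I. c i * f i x) x = (\<Sum>i\<in>I. c i * Dx (f i) x))"
    using assms
  proof (induction I rule: finite_induct)
    case empty
    then show ?case using piecewise_C1_const[of 0] Dx_const[of 0] by simp
  next
    case (insert i I)
    then have 1: "piecewise_C1 (\<lambda>x. \<Sum>i\<in>I. c i * f i x)"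
      "AE x in unit_measure. Dx (\<lambda>x. \<Sum>i\<in>I. c i * f i x) x = (\<Sum>i\<in>I. c i * Dx (f i) x)"
      by auto
    have 2: "piecewise_C1 (f i)" using insert by simp
    note a = Dx_add[OF Dx_cmult(1)[OF 2, of "c i"] 1(1)]
    have "AE x in unit_measure. Dx (\<lambda>x. \<Sum>i\<in>insert i I. c i * f i x) x = (\<Sum>i\<in>insert i I. c i * Dx (f i) x)"
      using a(2) 1(2) Dx_cmult(2)[OF 2, of "c i"] by eventually_elim (simp add: insert(1,2))
    then show ?case using a(1) insert(1,2) by simp
  qed
  then show "piecewise_C1 (\<lambda>x. \<Sum>i\<in>I. c i * f i x)"
    "AE x in unit_measure. Dx (\<lambda>x. \<Sum>i\<in>I. c i * f i x) x = (\<Sum>i\<in>I. c i * Dx (f i) x)" by auto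
qed

lemma integral_Dx:
  assumes "piecewise_C1 f" shows "(LINT x|unit_measure. Dx f x) = f 1 - f 0"
proof -
  obtain f' where d: "has_piecewise_deriv f f'" using assms by (auto simp: piecewise_C1_def)
  then show ?thesis
    using integral_unit_cong_AE[OF has_piecewise_deriv_ess_bounded(2)[OF d] Dx_AE_piecewise_deriv[OF d]]
      integral_piecewise_deriv by simp
qed

section \<open>Lipschitz continuity from bounded weak derivatives\<close>

text \<open>
  The length of the part of \<open>[p,q]\<close> that lies to the left of \<open>x\<close>. These functions have indicators as
  derivatives and serve both to measure intervals and to build piecewise linear functions.
\<close>

definition ramp :: "real \<Rightarrow> real \<Rightarrow> real \<Rightarrow> real" where
  "ramp p q x = max p (min x q) - p"

lemma ramp_piecewise_deriv:
  assumes "p < q" shows "has_piecewise_deriv (ramp p q) (indicator {p<..<q})"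
  unfolding has_piecewise_deriv_def
proof (intro conjI)
  show "continuous_on {0..1} (ramp p q)"
    unfolding ramp_def by (intro continuous_intros)
  show "indicator {p<..<q} \<in> borel_measurable unit_measure"
    by (intro measurable_restrict_space1 borel_measurable_indicator) auto
  show "\<exists>B. \<forall>x\<in>{0<..<1}. \<bar>indicator {p<..<q} x :: real\<bar> \<le> B"
    by (intro exI[of _ 1]) (auto simp: indicator_def)
  have "(ramp p q has_real_derivative indicator {p<..<q} x) (at x)" if x: "x \<notin> {p, q}" for x
  proof -
    consider "x < p" | "p < x" "x < q" | "q < x" using x by force
    then show ?thesis
    proof cases
      case 1
      have "(ramp p q has_real_derivative 0) (at x)"
        by (rule has_field_derivative_transform_within_open[of "\<lambda>_. 0" _ x "{..<p}"])
          (use 1 assms in \<open>auto simp: ramp_def\<close>)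
      then show ?thesis using 1 by simp
    next
      case 2
      have "(ramp p q has_real_derivative 1) (at x)"
        by (rule has_field_derivative_transform_within_open[of "\<lambda>x. x - p" _ x "{p<..<q}"])
          (use 2 in \<open>auto simp: ramp_def intro!: derivative_eq_intros\<close>)
      then show ?thesis using 2 by simp
    next
      case 3
      have "(ramp p q has_real_derivative 0) (at x)"
        by (rule has_field_derivative_transform_within_open[of "\<lambda>_. q - p" _ x "{q<..}"])
          (use 3 assms in \<open>auto simp: ramp_def\<close>)
      then show ?thesis using 3 by simp
    qed
  qed
  then show "\<exists>S. finite S \<and> (\<forall>x\<in>{0<..<1} - S. (ramp p q has_real_derivative indicator {p<..<q} x) (at x))"
    by (intro exI[of _ "{p, q}"]) auto
qed

lemma ramp_le: "p \<le> q \<Longrightarrow> ramp p q x \<le> q - p" and ramp_nonneg: "p \<le> q \<Longrightarrow> 0 \<le> ramp p q x"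
  by (auto simp: ramp_def)

lemma integral_ramp_deriv:
  assumes "p < q" shows "(LINT x|unit_measure. indicator {p<..<q} x :: real) \<le> q - p"
  using integral_piecewise_deriv[OF ramp_piecewise_deriv[OF assms]]
    ramp_le[of p q 1] ramp_nonneg[of p q 0] assms by linarith

lemma continuous_on_shift:
  fixes f :: "real \<Rightarrow> real"
  assumes "continuous_on UNIV f" shows "continuous_on A (\<lambda>x. f (x - s))"
  by (rule continuous_on_compose2[OF assms]) (auto intro!: continuous_intros)

text \<open>
  For negative \<open>x\<close> the integral extends over the empty set and is \<open>0\<close>, which agrees with the bump
  vanishing to the left of \<open>a > 0\<close>.
\<close>

definition bump_integral :: "real \<Rightarrow> real \<Rightarrow> real \<Rightarrow> real" where
  "bump_integral a b x = integral {0..x} (bump 1 a b 1 0)"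

lemma bump_continuous: "a < b \<Longrightarrow> continuous_on A (bump 1 a b 1 0)"
  using bump_has_derivative[of 1 a b 1 0]
  by (metis DERIV_isCont continuous_at_imp_continuous_on zero_less_one)

lemma bump_integral_has_derivative:
  assumes "0 < a" "a < b"
  shows "(bump_integral a b has_real_derivative bump 1 a b 1 0 x) (at x)"
proof (cases "x < a")
  case True
  have z: "bump_integral a b y = 0" if "y < a" for y
  proof -
    have "bump_integral a b y = integral {0..y} (\<lambda>_. 0)"
      unfolding bump_integral_def using that by (intro integral_cong) (auto simp: bump_def)
    then show ?thesis by simp
  qed
  have "(bump_integral a b has_real_derivative 0) (at x)"
    by (rule has_field_derivative_transform_within_open[of "\<lambda>_. 0" _ x "{..<a}"])
      (use True z in auto)
  then show ?thesis using True by (simp add: bump_def)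
next
  case False
  have "(bump_integral a b has_real_derivative bump 1 a b 1 0 x) (at x within {0..x + 1})"
    unfolding bump_integral_def
    using False assms by (intro integral_has_real_derivative bump_continuous) auto
  then show ?thesis
    using False assms at_within_interior[of x "{0..x + 1}"] by (auto simp: interior_atLeastAtMost_real)
qed

lemma bump_integral_mono:
  assumes "0 < a" "a < b" "x \<le> y" shows "bump_integral a b x \<le> bump_integral a b y"
  by (rule DERIV_nonneg_imp_nondecreasing[OF assms(3)])
    (use bump_integral_has_derivative[OF assms(1,2)] bump_range[of 1 a b] in auto)

lemma bump_integral_outside:
  assumes "0 < a" "a < b"
  shows "x \<le> a \<Longrightarrow> bump_integral a b x = 0" and "b \<le> x \<Longrightarrow> bump_integral a b x = bump_integral a b b"
proof -
  have const: "bump_integral a b x = bump_integral a b y"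
    if "x \<le> y" "\<And>z. x \<le> z \<Longrightarrow> z \<le> y \<Longrightarrow> bump 1 a b 1 0 z = 0" for x y
    by (rule antisym) (use DERIV_nonneg_imp_nondecreasing[OF that(1), of "bump_integral a b"]
      DERIV_nonpos_imp_nonincreasing[OF that(1), of "bump_integral a b"] that(2)
      bump_integral_has_derivative[OF assms] in \<open>metis order_refl\<close>)+
  have "bump_integral a b 0 = 0" by (simp add: bump_integral_def)
  then show "bump_integral a b x = 0" if "x \<le> a"
    using const[of x 0] const[of 0 x] that assms by (cases "x \<le> 0") (auto simp: bump_def)
  show "bump_integral a b x = bump_integral a b b" if "b \<le> x"
    using const[of b x] that by (auto simp: bump_def)
qed

lemma bump_integral_pos:
  assumes "0 < a" "a < b" shows "0 < bump_integral a b b"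
proof -
  define c where "c = (a + b) / 2"
  have c: "a < c" "c < b" using assms by (auto simp: c_def)
  have "0 < bump 1 a b 1 0 c" using c by (simp add: bump_def)
  from DERIV_pos_inc_right[OF bump_integral_has_derivative[OF assms] this]
  obtain d where d: "d > 0" "\<And>h. 0 < h \<Longrightarrow> h < d \<Longrightarrow> bump_integral a b c < bump_integral a b (c + h)" by blast
  define h where "h = min (d / 2) (b - c)"
  have "bump_integral a b a \<le> bump_integral a b c" using c assms by (intro bump_integral_mono) auto
  also have "\<dots> < bump_integral a b (c + h)" using d c by (intro d(2)) (auto simp: h_def)
  also have "\<dots> \<le> bump_integral a b b" using assms by (intro bump_integral_mono) (auto simp: h_def)
  finally show ?thesis using bump_integral_outside(1)[OF assms, of a] by simp
qed

text \<open>
  A function that rises on \<open>[a,b]\<close> and falls on \<open>[a + s, b + s]\<close>. Its derivative is the difference of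
  two translates of one bump, so that integrating against it compares averages near two points.
\<close>

definition plateau :: "real \<Rightarrow> real \<Rightarrow> real \<Rightarrow> real \<Rightarrow> real" where
  "plateau a b s x = bump_integral a b x - bump_integral a b (x - s)"

lemma plateau_outside:
  assumes "0 < a" "a < b" "0 < s" "x \<notin> {a..b + s}" shows "plateau a b s x = 0"
proof (cases "x < a")
  case True
  then show ?thesis
    using assms bump_integral_outside(1)[OF assms(1,2), of x]
      bump_integral_outside(1)[OF assms(1,2), of "x - s"] by (simp add: plateau_def)
next
  case False
  then show ?thesis
    using assms bump_integral_outside(2)[OF assms(1,2), of x]
      bump_integral_outside(2)[OF assms(1,2), of "x - s"] by (simp add: plateau_def)
qed

lemma DERIV_minus_shift:
  fixes f :: "real \<Rightarrow> real"
  assumes "\<And>x. (f has_real_derivative f' x) (at x)"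
  shows "((\<lambda>x. f x - f (x - s)) has_real_derivative f' x - f' (x - s)) (at x)"
proof -
  have "((\<lambda>x. f (x - s)) has_real_derivative f' (x - s) * 1) (at x)"
    by (rule DERIV_chain2[OF assms]) (auto intro!: derivative_eq_intros)
  then show ?thesis using assms by (auto intro!: DERIV_diff)
qed

lemma plateau_test_function:
  assumes "0 < a" "a < b" "0 < s" "b + s < 1"
  shows "test_function (plateau a b s)"
    and "deriv (plateau a b s) = (\<lambda>x. bump 1 a b 1 0 x - bump 1 a b 1 0 (x - s))"
proof -
  let ?\<psi> = "bump 1 a b 1 0"
  have \<psi>: "test_function ?\<psi>" using assms by (intro bump_test_function) auto
  define D where "D n x = (deriv ^^ n) ?\<psi> x - (deriv ^^ n) ?\<psi> (x - s)" for n x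
  have d: "((deriv ^^ n) ?\<psi> has_real_derivative (deriv ^^ Suc n) ?\<psi> x) (at x)" for n x
    using \<psi> by (simp add: test_function_def DERIV_deriv_iff_field_differentiable)
  have D: "(D n has_real_derivative D (Suc n) x) (at x)" for n x
    unfolding D_def by (rule DERIV_minus_shift[OF d])
  have P: "(plateau a b s has_real_derivative D 0 x) (at x)" for x
    unfolding plateau_def D_def
    using DERIV_minus_shift[of "bump_integral a b" ?\<psi> s x] bump_integral_has_derivative[OF assms(1,2)] by simp
  have it: "(deriv ^^ Suc n) (plateau a b s) = D n" for n
  proof (induction n)
    case 0 then show ?case using P by (auto intro!: ext DERIV_imp_deriv)
  next
    case (Suc n)
    have "deriv (D n) = D (Suc n)" using D by (auto intro!: ext DERIV_imp_deriv)
    then show ?case using Suc by simp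
  qed
  show "deriv (plateau a b s) = (\<lambda>x. ?\<psi> x - ?\<psi> (x - s))"
    using it[of 0] by (simp add: D_def[abs_def])
  show "test_function (plateau a b s)"
    unfolding test_function_def
  proof (intro conjI allI exI[of _ "{a..b + s}"])
    fix n x
    show "(deriv ^^ n) (plateau a b s) field_differentiable at x"
    proof (cases n)
      case 0 then show ?thesis using P by (auto simp: field_differentiable_def)
    next
      case (Suc k) then show ?thesis using it[of k] D[of k] by (auto simp: field_differentiable_def)
    qed
    show "x \<notin> {a..b + s} \<longrightarrow> plateau a b s x = 0"
      using plateau_outside[OF assms(1-3)] by blast
  qed (use assms in auto)
qed

lemma bump_average_close:
  assumes "0 < a" "a < b" "b + s < 1" "0 \<le> s" and g: "continuous_on {0..1} g"
    and e: "\<And>x. x \<in> {a + s..b + s} \<Longrightarrow> \<bar>g x - c\<bar> \<le> e"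
  shows "\<bar>(LINT x|unit_measure. g x * bump 1 a b 1 0 (x - s)) - c * bump_integral a b b\<bar>
    \<le> e * bump_integral a b b"
proof -
  let ?\<psi> = "\<lambda>x. bump 1 a b 1 0 (x - s)"
  have c: "continuous_on {0..1} ?\<psi>"
    by (rule continuous_on_shift[OF bump_continuous[OF assms(2)]])
  have "has_piecewise_deriv (\<lambda>x. bump_integral a b (x - s)) ?\<psi>"
  proof (rule has_piecewise_deriv_C1[OF _ c])
    fix x
    have "((\<lambda>x. bump_integral a b (x - s)) has_real_derivative ?\<psi> x * 1) (at x)"
      by (rule DERIV_chain2[OF bump_integral_has_derivative[OF assms(1,2)]])
        (auto intro!: derivative_eq_intros)
    then show "((\<lambda>x. bump_integral a b (x - s)) has_real_derivative ?\<psi> x) (at x within {0..1})"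
      by (simp add: has_field_derivative_at_within)
  qed
  from integral_piecewise_deriv[OF this]
  have I: "(LINT x|unit_measure. ?\<psi> x) = bump_integral a b b"
    using bump_integral_outside(1)[OF assms(1,2), of "0 - s"]
      bump_integral_outside(2)[OF assms(1,2), of "1 - s"] assms by simp
  note cb = ess_bounded_continuous[OF c] and gb = ess_bounded_continuous[OF g]
  have "\<bar>LINT x|unit_measure. g x * ?\<psi> x - c * ?\<psi> x\<bar> \<le> (LINT x|unit_measure. e * ?\<psi> x)"
  proof (rule order_trans[OF integral_abs_bound integral_mono_AE])
    show "AE x in unit_measure. \<bar>g x * ?\<psi> x - c * ?\<psi> x\<bar> \<le> e * ?\<psi> x"
    proof (rule AE_unit_measureI)
      fix x
      have p: "0 \<le> ?\<psi> x" using bump_range[of 1 a b "x - s"] by simp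
      have "\<bar>g x * ?\<psi> x - c * ?\<psi> x\<bar> = \<bar>g x - c\<bar> * ?\<psi> x"
        using p by (simp add: abs_mult flip: left_diff_distrib)
      also have "\<dots> \<le> e * ?\<psi> x"
      proof (cases "x \<in> {a + s..b + s}")
        case True then show ?thesis using e p by (intro mult_right_mono) auto
      qed (auto simp: bump_def)
      finally show "\<bar>g x * ?\<psi> x - c * ?\<psi> x\<bar> \<le> e * ?\<psi> x" .
    qed
    show "integrable unit_measure (\<lambda>x. \<bar>g x * ?\<psi> x - c * ?\<psi> x\<bar>)"
      by (intro integrable_abs ess_bounded_integrable ess_bounded_diff ess_bounded_mult
          ess_bounded_const cb gb)
    show "integrable unit_measure (\<lambda>x. e * ?\<psi> x)"
      by (intro ess_bounded_integrable ess_bounded_cmult cb)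
  qed
  also have "(LINT x|unit_measure. g x * ?\<psi> x - c * ?\<psi> x) =
      (LINT x|unit_measure. g x * ?\<psi> x) - c * bump_integral a b b"
    by (subst Bochner_Integration.integral_diff)
      (auto intro!: ess_bounded_integrable ess_bounded_mult ess_bounded_const cb gb simp: I)
  finally show ?thesis using I by simp
qed

text \<open>
  Test with a plateau whose flanks have width \<open>2 \<delta>\<close> and lie around \<open>p\<close> and \<open>q\<close>. The integral of \<open>w\<close> against it is at most
  \<open>M (q - p + 2 \<delta>)\<close> times its height, and integration by parts turns the same integral into the
  difference of averages of \<open>g\<close> near \<open>p\<close> and near \<open>q\<close>. Then \<open>\<delta>\<close> tends to \<open>0\<close>.
\<close>

lemma weak_deriv_2_bounded_imp_Lipschitz_interior:
  assumes d: "\<And>x. x \<in> {0..1} \<Longrightarrow> (v has_real_derivative g x) (at x within {0..1})"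
    and g: "continuous_on {0..1} g" and w: "has_weak_deriv 2 v w" "ess_bounded w"
    and M: "AE x in unit_measure. \<bar>w x\<bar> \<le> M" "0 \<le> M"
    and xy: "0 < p" "p < q" "q < 1"
  shows "\<bar>g q - g p\<bar> \<le> M * (q - p)"
proof (rule field_le_epsilon)
  fix \<epsilon> :: real assume "0 < \<epsilon>"
  \<comment> \<open>The final bound exceeds \<open>M (q - p)\<close> by \<open>2 \<delta> M + 2 e\<close>, and \<open>\<delta> < e\<close>.\<close>
  define e where "e = \<epsilon> / (2 * M + 2)"
  have e: "0 < e" using \<open>0 < \<epsilon>\<close> M by (simp add: e_def)
  have ge: "\<exists>\<delta>>0. \<forall>y\<in>{0..1}. \<bar>y - x\<bar> < \<delta> \<longrightarrow> \<bar>g y - g x\<bar> \<le> e" if "x \<in> {0..1}" for x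
    using g e that unfolding continuous_on_iff dist_real_def by (meson less_imp_le)
  obtain \<delta>1 where \<delta>1: "\<delta>1 > 0" "\<And>y. y \<in> {0..1} \<Longrightarrow> \<bar>y - p\<bar> < \<delta>1 \<Longrightarrow> \<bar>g y - g p\<bar> \<le> e"
    using ge[of p] xy by auto
  obtain \<delta>2 where \<delta>2: "\<delta>2 > 0" "\<And>y. y \<in> {0..1} \<Longrightarrow> \<bar>y - q\<bar> < \<delta>2 \<Longrightarrow> \<bar>g y - g q\<bar> \<le> e"
    using ge[of q] xy by auto
  define \<delta> where "\<delta> = min (min \<delta>1 \<delta>2) (min e (min p (1 - q))) / 2"
  have \<delta>: "0 < \<delta>" "\<delta> < \<delta>1" "\<delta> < \<delta>2" "\<delta> < e" "\<delta> < p" "\<delta> < 1 - q"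
    using \<delta>1(1) \<delta>2(1) e xy by (auto simp: \<delta>_def)
  define a b s where "a = p - \<delta>" and "b = p + \<delta>" and "s = q - p"
  have ab: "0 < a" "a < b" "0 < s" "b + s < 1" "b < 1" using \<delta> xy by (auto simp: a_def b_def s_def)
  let ?\<psi> = "bump 1 a b 1 0" and ?\<Phi> = "plateau a b s" and ?I = "bump_integral a b b"
  note t = plateau_test_function[OF ab(1-4)]
  note I = bump_integral_pos[OF ab(1,2)]
  have \<psi>: "test_function ?\<psi>" using ab by (intro bump_test_function) auto
  have dd: "(?\<psi> has_real_derivative deriv ?\<psi> x) (at x)" for x
    using \<psi> by (simp add: test_function_def DERIV_deriv_iff_field_differentiable) (metis funpow_0)
  define \<Phi>'' where "\<Phi>'' x = deriv ?\<psi> x - deriv ?\<psi> (x - s)" for x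
  have d2: "(deriv ?\<Phi> has_real_derivative \<Phi>'' x) (at x)" for x
    unfolding t(2) \<Phi>''_def by (rule DERIV_minus_shift[OF dd])
  have "continuous_on UNIV (deriv ?\<psi>)"
    using \<psi> unfolding test_function_def
    by (metis (no_types, lifting) continuous_at_imp_continuous_on field_differentiable_imp_continuous_at funpow_0 funpow_simps_right(2) o_apply funpow.simps(2))
  then have c2: "continuous_on {0..1} \<Phi>''"
    unfolding \<Phi>''_def by (intro continuous_on_diff continuous_on_shift) (auto elim: continuous_on_subset)
  have c1: "continuous_on {0..1} (deriv ?\<Phi>)"
    using d2 by (meson DERIV_isCont continuous_at_imp_continuous_on)
  have "has_piecewise_deriv (deriv ?\<Phi>) \<Phi>''"
    using d2 by (intro has_piecewise_deriv_C1[OF _ c2]) (auto intro: has_field_derivative_at_within)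
  from has_piecewise_deriv_mult[OF has_piecewise_deriv_C1[OF d g] this]
  have "(LINT x|unit_measure. g x * deriv ?\<Phi> x + v x * \<Phi>'' x) = v 1 * deriv ?\<Phi> 1 - v 0 * deriv ?\<Phi> 0"
    by (rule integral_piecewise_deriv)
  also have "\<dots> = 0" using ab by (simp add: t(2) bump_def)
  finally have "(LINT x|unit_measure. g x * deriv ?\<Phi> x) + (LINT x|unit_measure. v x * \<Phi>'' x) = 0"
    using ess_bounded_continuous[OF c1] ess_bounded_continuous[OF c2] ess_bounded_continuous[OF g]
      has_piecewise_deriv_ess_bounded(1)[OF has_piecewise_deriv_C1[OF d g]]
    by (subst (asm) Bochner_Integration.integral_add) (auto intro!: ess_bounded_integrable ess_bounded_mult)
  moreover have "(LINT x|unit_measure. v x * \<Phi>'' x) = (LINT x|unit_measure. w x * ?\<Phi> x)"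
  proof -
    have "(deriv ^^ 2) ?\<Phi> = \<Phi>''"
      using d2 by (auto simp: numeral_2_eq_2 intro!: ext DERIV_imp_deriv)
    then show ?thesis using w(1) t(1) unfolding has_weak_deriv_def by force
  qed
  ultimately have eq: "(LINT x|unit_measure. g x * deriv ?\<Phi> x) = - (LINT x|unit_measure. w x * ?\<Phi> x)" by simp
  have b1: "\<bar>(LINT x|unit_measure. g x * ?\<psi> (x - 0)) - g p * ?I\<bar> \<le> e * ?I"
    using ab g \<delta>1(2) \<delta> by (intro bump_average_close) (auto simp: a_def b_def)
  have b2: "\<bar>(LINT x|unit_measure. g x * ?\<psi> (x - s)) - g q * ?I\<bar> \<le> e * ?I"
    using ab g \<delta>2(2) \<delta> by (intro bump_average_close) (auto simp: a_def b_def s_def)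
  have "continuous_on {0..1} (\<lambda>x. ?\<psi> (x - s))" for s
    by (rule continuous_on_shift[OF bump_continuous[OF ab(2)]])
  from ess_bounded_continuous[OF this]
  have "ess_bounded (\<lambda>x. ?\<psi> (x - s))" for s .
  from this this[of 0]
  have "(LINT x|unit_measure. g x * deriv ?\<Phi> x) =
    (LINT x|unit_measure. g x * ?\<psi> (x - 0)) - (LINT x|unit_measure. g x * ?\<psi> (x - s))"
    unfolding t(2) right_diff_distrib diff_zero
    using ess_bounded_continuous[OF g]
    by (intro Bochner_Integration.integral_diff ess_bounded_integrable ess_bounded_mult) auto
  moreover have "\<bar>LINT x|unit_measure. w x * ?\<Phi> x\<bar> \<le> M * ?I * (s + 2 * \<delta>)"
  proof -
    have ind: "ess_bounded (\<lambda>x. M * ?I * indicator {a..b + s} x)"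
      by (intro ess_bounded_cmult ess_boundedI[of _ 1] measurable_restrict_space1
          borel_measurable_indicator) (auto simp: indicator_def)
    have \<Phi>b: "ess_bounded ?\<Phi>" by (rule ess_bounded_continuous[OF test_function_continuous[OF t(1)]])
    have "\<bar>LINT x|unit_measure. w x * ?\<Phi> x\<bar> \<le> (LINT x|unit_measure. M * ?I * indicator {a..b + s} x)"
    proof (rule order_trans[OF integral_abs_bound integral_mono_AE])
      show "AE x in unit_measure. \<bar>w x * ?\<Phi> x\<bar> \<le> M * ?I * indicator {a..b + s} x"
        using M(1)
      proof eventually_elim
        case (elim x)
        have le: "bump_integral a b y \<le> ?I" for y
          using bump_integral_mono[OF ab(1,2), of y b] bump_integral_outside(2)[OF ab(1,2), of y]
          by (cases "y \<le> b") auto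
        have "0 \<le> bump_integral a b (x - s)"
          using bump_integral_mono[OF ab(1,2), of a "x - s"] bump_integral_outside(1)[OF ab(1,2)]
          by (cases "x - s \<le> a") auto
        then have "0 \<le> ?\<Phi> x \<and> ?\<Phi> x \<le> ?I"
          using le[of x] bump_integral_mono[OF ab(1,2), of "x - s" x] ab by (auto simp: plateau_def)
        moreover have "?\<Phi> x = 0" if "x \<notin> {a..b + s}"
          by (rule plateau_outside[OF ab(1-3) that])
        ultimately show ?case
          using elim by (auto simp: abs_mult indicator_def intro!: mult_mono)
      qed
    qed (intro integrable_abs ess_bounded_integrable ess_bounded_mult w \<Phi>b ind)+
    also have "\<dots> = M * ?I * (LINT x|unit_measure. indicator {a..b + s} x)" by simp
    also have "(LINT x|unit_measure. indicator {a..b + s} x) = (LINT x|unit_measure. indicator {a<..<b + s} x :: real)"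
    proof (rule integral_unit_cong_AE)
      show "ess_bounded (indicator {a<..<b + s})"
        by (rule has_piecewise_deriv_ess_bounded(2)[OF ramp_piecewise_deriv]) (use ab in auto)
      show "AE x in unit_measure. indicator {a..b + s} x = (indicator {a<..<b + s} x :: real)"
        by (rule AE_unit_measure_finite_exception[of "{a, b + s}"]) (auto simp: indicator_def)
    qed
    also have "M * ?I * \<dots> \<le> M * ?I * (b + s - a)"
      using M I ab by (intro mult_left_mono integral_ramp_deriv) auto
    finally show ?thesis by (simp add: a_def b_def algebra_simps)
  qed
  ultimately have "\<bar>(g q - g p) * ?I\<bar> \<le> (M * (s + 2 * \<delta>) + 2 * e) * ?I"
    using eq b1 b2 by (simp add: algebra_simps abs_le_iff)
  then have "\<bar>g q - g p\<bar> * ?I \<le> (M * (s + 2 * \<delta>) + 2 * e) * ?I" using I by (simp add: abs_mult)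
  then have "\<bar>g q - g p\<bar> \<le> M * (s + 2 * \<delta>) + 2 * e" using I by simp
  also have "\<dots> \<le> M * (s + 2 * e) + 2 * e" using \<delta> M by (intro add_mono mult_left_mono) auto
  also have "\<dots> = M * (q - p) + e * (2 * M + 2)" by (simp add: s_def algebra_simps)
  also have "e * (2 * M + 2) = \<epsilon>" using M by (simp add: e_def)
  finally show "\<bar>g q - g p\<bar> \<le> M * (q - p) + \<epsilon>" .
qed

lemma weak_deriv_2_bounded_imp_Lipschitz:
  assumes d: "\<And>x. x \<in> {0..1} \<Longrightarrow> (v has_real_derivative g x) (at x within {0..1})"
    and g: "continuous_on {0..1} g" and w: "has_weak_deriv 2 v w" "ess_bounded w"
    and M: "AE x in unit_measure. \<bar>w x\<bar> \<le> M" "0 \<le> M"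
  shows "M-lipschitz_on {0..1} g"
proof -
  have "M-lipschitz_on {0<..<1} g"
  proof (rule lipschitz_onI)
    fix x y :: real assume xy: "x \<in> {0<..<1}" "y \<in> {0<..<1}"
    show "dist (g x) (g y) \<le> M * dist x y"
      using weak_deriv_2_bounded_imp_Lipschitz_interior[OF assms, of x y]
        weak_deriv_2_bounded_imp_Lipschitz_interior[OF assms, of y x] xy
      by (cases x y rule: linorder_cases) (auto simp: dist_real_def abs_minus_commute)
  qed (rule M)
  then show ?thesis
    using lipschitz_on_closure[of M "{0<..<1}" g] g by simp
qed

text \<open>
  Continuity in time of the norm bounds it uniformly. The norm is that of an arbitrarily chosen second
  weak derivative, which agrees almost everywhere with an essentially bounded one.
\<close>

lemma C_time_Winf_imp_Lipschitz_deriv: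
  assumes v: "v \<in> C_time T (Winf 2) (Winf_norm 2)"
    and d: "\<And>t x. t \<in> {0..T} \<Longrightarrow> x \<in> {0..1} \<Longrightarrow> (v t has_real_derivative g t x) (at x within {0..1})"
    and g: "\<And>t. t \<in> {0..T} \<Longrightarrow> continuous_on {0..1} (g t)"
  shows "\<exists>M\<ge>0. \<forall>t\<in>{0..T}. M-lipschitz_on {0..1} (g t)"
proof -
  have c: "continuous_on {0..T} (\<lambda>t. Winf_norm 2 (v t))" and W: "\<And>t. t \<in> {0..T} \<Longrightarrow> v t \<in> Winf 2"
    using v by (auto simp: C_time_def)
  have "bounded ((\<lambda>t. Winf_norm 2 (v t)) ` {0..T})"
    by (intro compact_imp_bounded compact_continuous_image c) simp
  then obtain M0 where M0: "\<And>t. t \<in> {0..T} \<Longrightarrow> \<bar>Winf_norm 2 (v t)\<bar> \<le> M0"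
    unfolding bounded_iff by (metis imageI real_norm_def)
  define M where "M = max M0 0"
  have "M-lipschitz_on {0..1} (g t)" if t: "t \<in> {0..T}" for t
  proof -
    obtain w where w: "w \<in> Linf_space" "has_weak_deriv 2 (v t) w"
      using W[OF t] by (auto simp: Winf_def)
    let ?e = "esssup unit_measure (\<lambda>x. ereal \<bar>w x\<bar>)"
    have wm[measurable]: "w \<in> borel_measurable unit_measure" and wf: "?e < \<infinity>"
      using w by (auto simp: Linf_space_def)
    have ae: "AE x in unit_measure. weak_deriv 2 (v t) x = w x"
      by (rule weak_deriv_AE_eq[OF w(2)])
    have le: "AE x in unit_measure. ereal \<bar>w x\<bar> \<le> ?e" by (rule esssup_AE)
    have n: "0 \<le> ?e"
    proof (rule ccontr)
      assume neg: "\<not> 0 \<le> ?e"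
      have "AE x in unit_measure. False"
      proof (rule eventually_mono[OF le])
        fix x assume "ereal \<bar>w x\<bar> \<le> ?e"
        then have "ereal 0 \<le> ?e" by (rule order_trans[rotated]) simp
        then show False using neg by (simp add: zero_ereal_def)
      qed
      then have "emeasure unit_measure {x \<in> space unit_measure. True} = 0"
        by (intro emeasure_eq_0_AE) simp
      also have "{x \<in> space unit_measure. True} = space unit_measure" by blast
      finally have "emeasure unit_measure (space unit_measure) = 0" .
      then show False using emeasure_unit_measure_space by (simp add: measure_def)
    qed
    then obtain r where r: "?e = ereal r" "0 \<le> r" using wf by (cases ?e) auto
    then have ler: "AE x in unit_measure. \<bar>w x\<bar> \<le> r" using le by simp
    have eb: "ess_bounded w" using ler by (auto simp: ess_bounded_def)
    have wdm: "weak_deriv 2 (v t) \<in> borel_measurable unit_measure"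
      by (rule ess_bounded_measurable[OF ess_bounded_cong_AE[OF eb ae]])
    have "Linf_norm (weak_deriv 2 (v t)) = Linf_norm w"
      unfolding Linf_norm_def using ae wdm wm
      by (subst esssup_AE_cong[of _ _ "\<lambda>x. ereal \<bar>w x\<bar>"]) auto
    also have "\<dots> = r" using r by (simp add: Linf_norm_def)
    finally have "r \<le> Winf_norm 2 (v t)"
      unfolding Winf_norm_def by (intro Max_ge) auto
    then have "r \<le> M" using M0[OF t] by (auto simp: M_def)
    show ?thesis
      using ler \<open>r \<le> M\<close> \<open>0 \<le> r\<close>
      by (intro weak_deriv_2_bounded_imp_Lipschitz[OF d[OF t] g[OF t] w(2) eb]) auto
  qed
  then show ?thesis by (intro exI[of _ M]) (auto simp: M_def)
qed

section \<open>Meshes and piecewise linear interpolation\<close>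

definition slope :: "(nat \<Rightarrow> real) \<Rightarrow> (real \<Rightarrow> real) \<Rightarrow> nat \<Rightarrow> real" where
  "slope X v j = (v (X (j + 1)) - v (X j)) / (X (j + 1) - X j)"

text \<open>
  A sum of slopes times ramps needs no distinction between inner and outer cells and shows the linear
  dependence on the nodal values.
\<close>

definition interp :: "mesh \<Rightarrow> (real \<Rightarrow> real) \<Rightarrow> real \<Rightarrow> real" where
  "interp = (\<lambda>(N, X) v x. v (X 1) + (\<Sum>j=1..N. slope X v j * ramp (X j) (X (j + 1)) x))"

definition interp_deriv :: "mesh \<Rightarrow> (real \<Rightarrow> real) \<Rightarrow> real \<Rightarrow> real" where
  "interp_deriv = (\<lambda>(N, X) v x. \<Sum>j=1..N. slope X v j * indicator {X j<..<X (j + 1)} x)"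

definition nodes :: "mesh \<Rightarrow> real set" where
  "nodes = (\<lambda>(N, X). X ` {1..N + 1})"

lemma mesh_less:
  assumes "is_mesh (N, X)" "1 \<le> i" "i < j" "j \<le> N + 1"
  shows "X i < X j"
  using assms(3,4)
proof (induction j)
  case (Suc j)
  have "X j < X (Suc j)" if "1 \<le> j" using assms(1) Suc.prems that by (auto simp: is_mesh_def)
  with Suc assms(2) show ?case by (cases "i = j") force+
qed simp

lemma mesh_le:
  assumes "is_mesh (N, X)" "1 \<le> i" "i \<le> j" "j \<le> N + 1"
  shows "X i \<le> X j"
  using mesh_less[OF assms(1,2), of j] assms by (cases "i = j") auto

lemma mesh_node_bounds:
  assumes "is_mesh (N, X)" "1 \<le> i" "i \<le> N + 1" shows "0 \<le> X i" "X i \<le> 1"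
  using mesh_le[OF assms(1), of 1 i] mesh_le[OF assms(1), of i "N + 1"] assms
  by (auto simp: is_mesh_def)

lemma mesh_cell_less: "is_mesh (N, X) \<Longrightarrow> j \<in> {1..N} \<Longrightarrow> X j < X (j + 1)"
  by (auto simp: is_mesh_def)

lemma finite_nodes: "finite (nodes m)"
  by (cases m) (simp add: nodes_def)

lemma nodes_subset: "is_mesh m \<Longrightarrow> nodes m \<subseteq> {0..1}"
  using mesh_node_bounds by (cases m) (auto simp: nodes_def)

lemma mesh_cover:
  assumes "is_mesh (N, X)" "x \<in> {0..1}"
  shows "\<exists>j\<in>{1..N}. x \<in> {X j..X (j + 1)}"
proof -
  have "\<exists>j\<in>{1..n}. x \<in> {X j..X (j + 1)}" if "1 \<le> n" "n \<le> N" "x \<in> {0..X (n + 1)}" for n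
    using that
  proof (induction n rule: nat_induct_at_least)
    case base
    then show ?case using assms(1) by (auto simp: is_mesh_def)
  next
    case (Suc n)
    then show ?case
    proof (cases "x \<le> X (n + 1)")
      case True
      then show ?thesis using Suc by fastforce
    next
      case False
      then show ?thesis using Suc by (intro bexI[of _ "Suc n"]) auto
    qed
  qed
  from this[of N] show ?thesis using assms by (auto simp: is_mesh_def)
qed

lemma mesh_cover_interior:
  assumes "is_mesh (N, X)" "x \<in> {0<..<1} - nodes (N, X)"
  shows "\<exists>j\<in>{1..N}. x \<in> {X j<..<X (j + 1)}"
proof -
  obtain j where j: "j \<in> {1..N}" "x \<in> {X j..X (j + 1)}"
    using mesh_cover[of N X x] assms by auto
  have "j \<in> {1..N + 1}" "j + 1 \<in> {1..N + 1}" using j(1) by auto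
  then have "X j \<in> nodes (N, X)" "X (j + 1) \<in> nodes (N, X)"
    unfolding nodes_def by blast+
  then have "x \<noteq> X j" "x \<noteq> X (j + 1)" using assms(2) by blast+
  then show ?thesis using j by (intro bexI[of _ j]) auto
qed

lemma mesh_size_bounds:
  assumes "is_mesh (N, X)" "j \<in> {1..N}"
  shows "X (j + 1) - X j \<le> mesh_size (N, X)" "min_mesh_size (N, X) \<le> X (j + 1) - X j"
  using assms by (auto simp: mesh_size_def min_mesh_size_def)

lemma min_mesh_size_pos:
  assumes "is_mesh m" shows "0 < min_mesh_size m"
proof -
  obtain N X where m: "m = (N, X)" by (cases m)
  have "0 < (MIN i\<in>{1..N}. X (i + 1) - X i)"
    using assms unfolding m is_mesh_def by (subst Min_gr_iff) auto
  then show ?thesis by (simp add: m min_mesh_size_def)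
qed

lemma mesh_size_pos:
  assumes "is_mesh m" shows "0 < mesh_size m"
proof -
  obtain N X where m: "m = (N, X)" by (cases m)
  then have "1 \<in> {1..N}" using assms by (auto simp: is_mesh_def)
  then show ?thesis
    using mesh_size_bounds[of N X 1] mesh_cell_less[of N X 1] assms m by simp
qed

lemma mesh_size_le_1:
  assumes "is_mesh m" shows "mesh_size m \<le> 1"
proof -
  obtain N X where m: "m = (N, X)" by (cases m)
  have "(MAX i\<in>{1..N}. X (i + 1) - X i) \<le> 1"
  proof (subst Max_le_iff)
    show "\<forall>a\<in>(\<lambda>i. X (i + 1) - X i) ` {1..N}. a \<le> 1"
      using mesh_node_bounds[of N X] assms m by (auto simp: algebra_simps intro: order_trans[of _ 1])
  qed (use assms m in \<open>auto simp: is_mesh_def\<close>)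
  then show ?thesis by (simp add: m mesh_size_def)
qed

text \<open>
  To the left of the cell the ramps are complete and the sum telescopes; to the right they vanish.
\<close>

lemma interp_on_cell:
  assumes m: "is_mesh (N, X)" and j: "j \<in> {1..N}" and x: "x \<in> {X j..X (j + 1)}"
  shows "interp (N, X) v x = v (X j) + slope X v j * (x - X j)"
proof -
  have tele: "(\<Sum>i=1..<k. v (X (i + 1)) - v (X i)) = v (X k) - v (X 1)" if "1 \<le> k" for k
    using sum_Suc_diff'[of 1 k "\<lambda>i. v (X i)"] that by simp
  have "(\<Sum>i=1..N. slope X v i * ramp (X i) (X (i + 1)) x) =
    (\<Sum>i\<in>{1..<j} \<union> {j} \<union> {j<..N}. slope X v i * ramp (X i) (X (i + 1)) x)"
    using j by (intro sum.cong) auto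
  also have "\<dots> = (\<Sum>i\<in>{1..<j}. slope X v i * ramp (X i) (X (i + 1)) x)
      + slope X v j * ramp (X j) (X (j + 1)) x + (\<Sum>i\<in>{j<..N}. slope X v i * ramp (X i) (X (i + 1)) x)"
    by (subst sum.union_disjoint; (subst sum.union_disjoint)?) auto
  also have "(\<Sum>i\<in>{1..<j}. slope X v i * ramp (X i) (X (i + 1)) x) = (\<Sum>i=1..<j. v (X (i + 1)) - v (X i))"
  proof (rule sum.cong)
    fix i assume i: "i \<in> {1..<j}"
    then have "X i < X (i + 1)" "X (i + 1) \<le> X j"
      using mesh_cell_less[OF m, of i] mesh_le[OF m, of "i + 1" j] j by auto
    then show "slope X v i * ramp (X i) (X (i + 1)) x = v (X (i + 1)) - v (X i)"
      using x by (simp add: slope_def ramp_def)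
  qed simp
  also have "\<dots> = v (X j) - v (X 1)" using j by (intro tele) simp
  also have "(\<Sum>i\<in>{j<..N}. slope X v i * ramp (X i) (X (i + 1)) x) = 0"
  proof (rule sum.neutral, rule ballI)
    fix i assume i: "i \<in> {j<..N}"
    then have "X i < X (i + 1)" "X (j + 1) \<le> X i"
      using mesh_cell_less[OF m, of i] mesh_le[OF m, of "j + 1" i] j by auto
    then show "slope X v i * ramp (X i) (X (i + 1)) x = 0"
      using x by (simp add: ramp_def)
  qed
  also have "ramp (X j) (X (j + 1)) x = x - X j" using x by (simp add: ramp_def)
  finally show ?thesis by (simp add: interp_def)
qed

lemma interp_at_node:
  assumes m: "is_mesh (N, X)" and j: "j \<in> {1..N + 1}"
  shows "interp (N, X) v (X j) = v (X j)"
proof (cases "j \<le> N")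
  case True
  then show ?thesis
    using j mesh_cell_less[OF m, of j] by (subst interp_on_cell[OF m, of j]) auto
next
  case False
  then have "j = N + 1" "N \<in> {1..N}" using j m by (auto simp: is_mesh_def)
  moreover from this have "X N < X (N + 1)" using mesh_cell_less[OF m] by blast
  ultimately show ?thesis
    by (subst interp_on_cell[OF m, of N]) (auto simp: slope_def)
qed

lemma interp_deriv_on_cell:
  assumes m: "is_mesh (N, X)" and j: "j \<in> {1..N}" and x: "x \<in> {X j<..<X (j + 1)}"
  shows "interp_deriv (N, X) v x = slope X v j"
proof -
  have "x \<notin> {X i<..<X (i + 1)}" if "i \<in> {1..N}" "i \<noteq> j" for i
  proof (cases "i < j")
    case True
    then show ?thesis using mesh_le[OF m, of "i + 1" j] j x by auto
  next
    case False
    then show ?thesis using mesh_le[OF m, of "j + 1" i] that x by auto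
  qed
  then have "(\<Sum>i=1..N. slope X v i * indicator {X i<..<X (i + 1)} x) =
      (\<Sum>i\<in>{1..N}. if i = j then slope X v j else 0)"
    using x by (intro sum.cong) auto
  then show ?thesis using j by (simp add: interp_deriv_def)
qed

lemma interp_piecewise_deriv:
  assumes "is_mesh m" shows "has_piecewise_deriv (interp m v) (interp_deriv m v)"
proof -
  obtain N X where m: "m = (N, X)" by (cases m)
  have "has_piecewise_deriv (\<lambda>x. \<Sum>j\<in>J. slope X v j * ramp (X j) (X (j + 1)) x)
      (\<lambda>x. \<Sum>j\<in>J. slope X v j * indicator {X j<..<X (j + 1)} x)" if "finite J" "J \<subseteq> {1..N}" for J
    using that
  proof (induction J rule: finite_induct)
    case empty
    then show ?case using has_piecewise_deriv_const[of 0] by simp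
  next
    case (insert j J)
    have "X j < X (j + 1)" using mesh_cell_less[of N X j] assms m insert by auto
    have "J \<subseteq> {1..N}" using insert by simp
    from has_piecewise_deriv_add[OF has_piecewise_deriv_cmult[OF ramp_piecewise_deriv[OF \<open>X j < X (j + 1)\<close>], of "slope X v j"]
        insert(3)[OF this]]
    show ?case using insert(1,2) by (simp only: sum.insert not_False_eq_True if_False)
  qed
  from has_piecewise_deriv_add[OF has_piecewise_deriv_const[of "v (X 1)"] this[of "{1..N}"]]
  show ?thesis by (simp add: m interp_def[abs_def] interp_deriv_def[abs_def])
qed

lemma interp_cong:
  assumes "is_mesh m" "\<And>x. x \<in> nodes m \<Longrightarrow> v x = w x"
  shows "interp m v = interp m w" "interp_deriv m v = interp_deriv m w"
proof -
  obtain N X where m: "m = (N, X)" by (cases m)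
  have e: "v (X i) = w (X i)" if "i \<in> {1..N + 1}" for i using assms(2) that by (auto simp: m nodes_def)
  then have "slope X v j = slope X w j" if "j \<in> {1..N}" for j using that by (simp add: slope_def)
  moreover have "v (X 1) = w (X 1)" using e by simp
  ultimately show "interp m v = interp m w" "interp_deriv m v = interp_deriv m w"
    by (auto simp: m interp_def interp_deriv_def intro!: ext sum.cong)
qed

lemma slope_sum: "slope X (\<lambda>x. \<Sum>i\<in>I. c i * f i x) j = (\<Sum>i\<in>I. c i * slope X (f i) j)"
  by (simp add: slope_def sum_subtractf[symmetric] sum_divide_distrib right_diff_distrib)

lemma interp_sum:
  "interp m (\<lambda>x. \<Sum>i\<in>I. c i * f i x) x = (\<Sum>i\<in>I. c i * interp m (f i) x)"
proof -
  obtain N X where m: "m = (N, X)" by (cases m)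
  show ?thesis
    by (simp add: m interp_def slope_sum sum_distrib_right sum_distrib_left distrib_left sum.distrib
        sum.swap[of _ I] mult.assoc)
qed

subsection \<open>The finite element spaces\<close>

lemma interp_in_S_h:
  assumes "is_mesh m" shows "interp m v \<in> S_h m"
proof -
  obtain N X where m: "m = (N, X)" by (cases m)
  have "\<exists>p :: real poly. degree p \<le> 1 \<and> (\<forall>x\<in>{X j..X (j + 1)}. interp m v x = poly p x)"
    if "j \<in> {1..N}" for j
    using interp_on_cell[of N X j _ v] that assms m
    by (intro exI[of _ "[: v (X j) - slope X v j * X j, slope X v j :]"]) (auto simp: algebra_simps)
  moreover have "continuous_on {0..1} (interp m v)"
    using interp_piecewise_deriv[OF assms] by (auto simp: has_piecewise_deriv_def)
  ultimately show ?thesis by (simp add: m S_h_def)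
qed

text \<open>
  On a cell both sides are affine with the same values at its ends.
\<close>

lemma S_h_eq_interp:
  assumes "is_mesh m" "\<phi> \<in> S_h m" "x \<in> {0..1}"
  shows "\<phi> x = interp m \<phi> x"
proof -
  obtain N X where m: "m = (N, X)" by (cases m)
  obtain j where j: "j \<in> {1..N}" "x \<in> {X j..X (j + 1)}"
    using mesh_cover[of N X x] assms m by auto
  obtain p :: "real poly" where p: "degree p \<le> 1" "\<And>x. x \<in> {X j..X (j + 1)} \<Longrightarrow> \<phi> x = poly p x"
    using assms(2) j(1) unfolding m S_h_def by blast
  have "p = [:coeff p 0, coeff p 1:]"
    using p(1) by (intro poly_eqI) (auto simp: coeff_pCons coeff_eq_0 split: nat.split)
  then obtain a b where ab: "p = [:a, b:]" by blast
  have lt: "X j < X (j + 1)" using mesh_cell_less[of N X j] assms m j by auto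
  have "slope X \<phi> j = b"
    using p(2)[of "X j"] p(2)[of "X (j + 1)"] lt
    by (simp add: slope_def ab divide_simps) (simp add: algebra_simps)
  then show ?thesis
    using interp_on_cell[of N X j x \<phi>] assms m j p(2)[of x] p(2)[of "X j"] lt
    by (simp add: ab algebra_simps)
qed

lemma S_h_piecewise_deriv:
  assumes "is_mesh m" "\<phi> \<in> S_h m" shows "has_piecewise_deriv \<phi> (interp_deriv m \<phi>)"
  by (rule has_piecewise_deriv_cong[OF interp_piecewise_deriv[OF assms(1)]])
    (use S_h_eq_interp[OF assms] in auto)

lemma S_h_piecewise_C1: "is_mesh m \<Longrightarrow> \<phi> \<in> S_h m \<Longrightarrow> piecewise_C1 \<phi>"
  unfolding piecewise_C1_def using S_h_piecewise_deriv by blast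

lemma S_h_cong:
  assumes "is_mesh m" "\<phi> \<in> S_h m" "\<And>x. x \<in> {0..1} \<Longrightarrow> \<psi> x = \<phi> x" shows "\<psi> \<in> S_h m"
proof -
  obtain N X where m: "m = (N, X)" by (cases m)
  have sub: "{X j..X (j + 1)} \<subseteq> {0..1}" if "j \<in> {1..N}" for j
    using mesh_node_bounds[of N X j] mesh_node_bounds[of N X "j + 1"] assms(1) that m by auto
  have c: "continuous_on {0..1} \<psi>"
    using assms(2,3) continuous_on_cong[of "{0..1}" "{0..1}" \<psi> \<phi>] unfolding m S_h_def by auto
  have "\<exists>p :: real poly. degree p \<le> 1 \<and> (\<forall>x\<in>{X j..X (j + 1)}. \<psi> x = poly p x)"
    if j: "j \<in> {1..N}" for j
  proof -
    obtain p :: "real poly" where "degree p \<le> 1" "\<forall>x\<in>{X j..X (j + 1)}. \<phi> x = poly p x"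
      using assms(2) j unfolding m S_h_def by blast
    then show ?thesis using sub[OF j] assms(3) by (intro exI[of _ p]) auto
  qed
  with c show ?thesis unfolding m S_h_def by blast
qed

lemma S_h_iff:
  assumes "is_mesh m" shows "\<phi> \<in> S_h m \<longleftrightarrow> (\<forall>x\<in>{0..1}. \<phi> x = interp m \<phi> x)"
  using S_h_eq_interp[OF assms] S_h_cong[OF assms interp_in_S_h[OF assms]] by blast

lemma S_h_sum:
  assumes "is_mesh m" "\<And>i. i \<in> I \<Longrightarrow> f i \<in> S_h m"
  shows "(\<lambda>x. \<Sum>i\<in>I. c i * f i x) \<in> S_h m"
  using assms S_h_eq_interp[OF assms(1)] unfolding S_h_iff[OF assms(1)]
  by (auto simp: interp_sum intro!: sum.cong)

lemma S_h_lincomb: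
  assumes "is_mesh m" "f \<in> S_h m" "g \<in> S_h m"
  shows "(\<lambda>x. a * f x + b * g x) \<in> S_h m"
  using S_h_sum[of m "{0, 1 :: nat}" "\<lambda>i. if i = 0 then f else g" "\<lambda>i. if i = 0 then a else b"] assms
  by simp

lemma S_h0_lincomb:
  assumes "is_mesh m" "f \<in> S_h0 m" "g \<in> S_h0 m"
  shows "(\<lambda>x. a * f x + b * g x) \<in> S_h0 m"
  using S_h_lincomb[OF assms(1)] assms by (auto simp: S_h0_def)

subsection \<open>The nodal basis\<close>

text \<open>
  As interpolants of indicators, the nodal basis functions, including the one-sided ones at the end
  points, inherit all properties of interpolants.
\<close>

definition hat :: "mesh \<Rightarrow> real \<Rightarrow> real \<Rightarrow> real" where
  "hat m y = interp m (indicator {y})"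

lemma interp_eq_hat_sum:
  assumes "is_mesh m" shows "interp m v x = (\<Sum>y\<in>nodes m. v y * hat m y x)"
proof -
  have "interp m v = interp m (\<lambda>x. \<Sum>y\<in>nodes m. v y * indicator {y} x)"
    by (rule interp_cong(1)[OF assms]) (simp add: indicator_def finite_nodes if_distrib cong: if_cong)
  then show ?thesis by (simp add: interp_sum hat_def)
qed

lemma hat_in_S_h: "is_mesh m \<Longrightarrow> hat m y \<in> S_h m"
  unfolding hat_def by (rule interp_in_S_h)

lemma interp_endpoints:
  assumes "is_mesh m" shows "interp m v 0 = v 0" "interp m v 1 = v 1"
proof -
  obtain N X where m: "m = (N, X)" by (cases m)
  have "X 1 = 0" "X (N + 1) = 1" using assms m by (auto simp: is_mesh_def)
  then show "interp m v 0 = v 0" "interp m v 1 = v 1"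
    using interp_at_node[of N X 1 v] interp_at_node[of N X "N + 1" v] assms m by auto
qed

lemma hat_in_S_h0: "is_mesh m \<Longrightarrow> y \<noteq> 0 \<Longrightarrow> y \<noteq> 1 \<Longrightarrow> hat m y \<in> S_h0 m"
  by (auto simp: S_h0_def hat_in_S_h) (auto simp: hat_def interp_endpoints)

lemma interp_in_S_h0: "is_mesh m \<Longrightarrow> v 0 = 0 \<Longrightarrow> v 1 = 0 \<Longrightarrow> interp m v \<in> S_h0 m"
  by (simp add: S_h0_def interp_in_S_h interp_endpoints)

lemma S_h0_eq_hat_sum:
  assumes "is_mesh m" "\<phi> \<in> S_h0 m" "x \<in> {0..1}"
  shows "\<phi> x = (\<Sum>y\<in>nodes m - {0, 1}. \<phi> y * hat m y x)"
proof -
  have "\<phi> x = (\<Sum>y\<in>nodes m. \<phi> y * hat m y x)"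
    using S_h_eq_interp[OF assms(1), of \<phi> x] assms by (simp add: S_h0_def interp_eq_hat_sum)
  also have "\<dots> = (\<Sum>y\<in>nodes m - {0, 1}. \<phi> y * hat m y x)"
    using assms(2) by (intro sum.mono_neutral_right) (auto simp: finite_nodes S_h0_def)
  finally show ?thesis .
qed

subsection \<open>Approximation and inverse properties\<close>

lemma interp_error_Lipschitz:
  assumes "is_mesh m" "L-lipschitz_on {0..1} v" "x \<in> {0..1}"
  shows "\<bar>v x - interp m v x\<bar> \<le> 2 * L * mesh_size m"
proof -
  obtain N X where m: "m = (N, X)" by (cases m)
  obtain j where j: "j \<in> {1..N}" "x \<in> {X j..X (j + 1)}"
    using mesh_cover[of N X x] assms m by auto
  have lt: "X j < X (j + 1)" using mesh_cell_less[of N X j] assms m j by auto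
  have in01: "X j \<in> {0..1}" "X (j + 1) \<in> {0..1}"
    using mesh_node_bounds[of N X j] mesh_node_bounds[of N X "j + 1"] assms m j by auto
  have h: "x - X j \<le> mesh_size m" using mesh_size_bounds(1)[of N X j] assms m j by auto
  have L: "0 \<le> L" using assms(2) by (rule lipschitz_on_nonneg)
  have "\<bar>v x - v (X j)\<bar> \<le> L * \<bar>x - X j\<bar>"
    using lipschitz_onD[OF assms(2,3) in01(1)] by (simp add: dist_real_def)
  also have "\<dots> \<le> L * mesh_size m" using L h j by (intro mult_left_mono) auto
  finally have 1: "\<bar>v x - v (X j)\<bar> \<le> L * mesh_size m" .
  have "\<bar>v (X (j + 1)) - v (X j)\<bar> \<le> L * \<bar>X (j + 1) - X j\<bar>"
    using lipschitz_onD[OF assms(2) in01(2,1)] by (simp add: dist_real_def)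
  then have "\<bar>slope X v j\<bar> \<le> L" using lt by (simp add: slope_def abs_divide divide_le_eq)
  then have "\<bar>slope X v j * (x - X j)\<bar> \<le> L * mesh_size m"
    unfolding abs_mult using h j by (intro mult_mono) auto
  moreover have "interp m v x = v (X j) + slope X v j * (x - X j)"
    using interp_on_cell[of N X j x v] assms m j by simp
  ultimately show ?thesis using 1 by linarith
qed

lemma mvt_unit_interval:
  assumes d: "\<And>x. x \<in> {0..1} \<Longrightarrow> (v has_real_derivative g x) (at x within {0..1})"
    and "0 \<le> a" "a < b" "b \<le> 1"
  shows "\<exists>z\<in>{a<..<b}. v b - v a = g z * (b - a)"
proof (rule mvt_simple[OF assms(3)])
  fix x assume "a \<le> x" "x \<le> b"
  then show "(v has_derivative (*) (g x)) (at x within {a..b})"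
    using has_field_derivative_subset[OF d, of x "{a..b}"] assms
    by (auto simp: has_field_derivative_def)
qed

lemma interp_slope_mvt:
  assumes "is_mesh (N, X)" "j \<in> {1..N}"
    and d: "\<And>x. x \<in> {0..1} \<Longrightarrow> (v has_real_derivative g x) (at x within {0..1})"
  shows "\<exists>z\<in>{X j<..<X (j + 1)}. slope X v j = g z"
proof -
  have lt: "X j < X (j + 1)" using mesh_cell_less[OF assms(1,2)] .
  have in01: "0 \<le> X j" "X (j + 1) \<le> 1"
    using mesh_node_bounds[OF assms(1), of j] mesh_node_bounds[OF assms(1), of "j + 1"] assms(2) by auto
  show ?thesis
    using mvt_unit_interval[OF d in01(1) lt in01(2)] lt by (auto simp: slope_def)
qed

lemma interp_deriv_error:
  assumes "is_mesh m"
    and d: "\<And>x. x \<in> {0..1} \<Longrightarrow> (v has_real_derivative g x) (at x within {0..1})"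
    and g: "M-lipschitz_on {0..1} g" and x: "x \<in> {0<..<1} - nodes m"
  shows "\<bar>g x - interp_deriv m v x\<bar> \<le> M * mesh_size m"
proof -
  obtain N X where m: "m = (N, X)" by (cases m)
  obtain j where j: "j \<in> {1..N}" and xj: "x \<in> {X j<..<X (j + 1)}"
    using mesh_cover_interior[of N X x] assms(1) m x by auto
  obtain z where z: "z \<in> {X j<..<X (j + 1)}" "slope X v j = g z"
    using interp_slope_mvt[of N X j v g] assms(1) d m j by blast
  have in01: "0 \<le> X j" "X (j + 1) \<le> 1"
    using mesh_node_bounds[of N X j] mesh_node_bounds[of N X "j + 1"] assms(1) m j by auto
  have "\<bar>g x - g z\<bar> \<le> M * \<bar>x - z\<bar>"
    using lipschitz_onD[OF g, of x z] x z in01 by (auto simp: dist_real_def)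
  also have "\<dots> \<le> M * mesh_size m"
    using mesh_size_bounds(1)[of N X j] assms(1) m j xj z lipschitz_on_nonneg[OF g]
    by (intro mult_left_mono) auto
  finally show ?thesis using interp_deriv_on_cell[of N X j x v] assms(1) m j xj z by simp
qed

lemma interp_deriv_bound:
  assumes "is_mesh m" "L-lipschitz_on {0..1} v"
  shows "\<bar>interp_deriv m v x\<bar> \<le> L"
proof -
  obtain N X where m: "m = (N, X)" by (cases m)
  have L: "0 \<le> L" using assms(2) by (rule lipschitz_on_nonneg)
  show ?thesis
  proof (cases "\<exists>j\<in>{1..N}. x \<in> {X j<..<X (j + 1)}")
    case True
    then obtain j where j: "j \<in> {1..N}" "x \<in> {X j<..<X (j + 1)}" by blast
    have lt: "X j < X (j + 1)" using mesh_cell_less[of N X j] assms m j by auto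
    have in01: "X j \<in> {0..1}" "X (j + 1) \<in> {0..1}"
      using mesh_node_bounds[of N X j] mesh_node_bounds[of N X "j + 1"] assms m j by auto
    have "\<bar>v (X (j + 1)) - v (X j)\<bar> \<le> L * \<bar>X (j + 1) - X j\<bar>"
      using lipschitz_onD[OF assms(2) in01(2,1)] by (simp add: dist_real_def)
    then show ?thesis
      using lt interp_deriv_on_cell[of N X j x v] assms(1) m j
      by (simp add: slope_def abs_divide divide_le_eq)
  next
    case False
    then have "interp_deriv m v x = 0"
      unfolding m interp_deriv_def by (auto intro!: sum.neutral)
    then show ?thesis using L by simp
  qed
qed

lemma integral_deriv_times_indicator:
  assumes "has_piecewise_deriv f f'" "0 \<le> p" "p < q" "q \<le> 1"
  shows "(LINT x|unit_measure. f' x * indicator {p<..<q} x) = f q - f p"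
proof -
  obtain S where S: "finite S" "\<forall>x\<in>{0<..<1} - S. (f has_real_derivative f' x) (at x)"
    using assms(1) unfolding has_piecewise_deriv_def by blast
  have "(f' has_integral f q - f p) {p..q}"
  proof (rule fundamental_theorem_of_calculus_interior_strong[OF S(1)])
    show "continuous_on {p..q} f"
      using assms continuous_on_subset[of "{0..1}" f "{p..q}"] by (auto simp: has_piecewise_deriv_def)
  qed (use S(2) assms in \<open>auto simp: has_real_derivative_iff_has_vector_derivative\<close>)
  then have "(f' has_integral f q - f p) {p<..<q}" by (simp add: has_integral_Icc_iff_Ioo)
  then have "((\<lambda>x. if x \<in> {p<..<q} then f' x else 0) has_integral f q - f p) {0<..<1}"
    using assms by (subst has_integral_restrict) auto
  moreover have "(\<lambda>x. if x \<in> {p<..<q} then f' x else 0) = (\<lambda>x. f' x * indicator {p<..<q} x)"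
    by (auto simp: indicator_def)
  ultimately have "integral {0<..<1} (\<lambda>x. f' x * indicator {p<..<q} x) = f q - f p"
    by (simp add: integral_unique)
  moreover have "ess_bounded (\<lambda>x. f' x * indicator {p<..<q} x)"
    by (intro ess_bounded_mult has_piecewise_deriv_ess_bounded(2)[OF assms(1)]
        has_piecewise_deriv_ess_bounded(2)[OF ramp_piecewise_deriv] assms)
  ultimately show ?thesis
    by (subst lebesgue_integral_eq_integral) (auto intro: ess_bounded_integrable)
qed

lemma interp_deriv_ess_bounded: "is_mesh m \<Longrightarrow> ess_bounded (interp_deriv m v)"
  using has_piecewise_deriv_ess_bounded(2)[OF interp_piecewise_deriv] .

text \<open>
  The derivative of an interpolation error has mean zero on every cell, and \<open>interp_deriv m \<psi>\<close> is
  constant there.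
\<close>

lemma interp_orthogonality:
  assumes m: "is_mesh m" and f: "has_piecewise_deriv f f'"
  shows "L2_inner f' (interp_deriv m \<psi>) = L2_inner (interp_deriv m f) (interp_deriv m \<psi>)"
proof -
  obtain N X where mX: "m = (N, X)" by (cases m)
  have eq: "L2_inner g' (interp_deriv m \<psi>) = (\<Sum>j=1..N. slope X \<psi> j * (g (X (j + 1)) - g (X j)))"
    if g: "has_piecewise_deriv g g'" for g g'
  proof -
    have cell: "X j < X (j + 1)" "0 \<le> X j" "X (j + 1) \<le> 1" if "j \<in> {1..N}" for j
      using mesh_cell_less[of N X j] mesh_node_bounds[of N X j] mesh_node_bounds[of N X "j + 1"] that m mX
      by auto
    have "L2_inner g' (interp_deriv m \<psi>) =
        (LINT x|unit_measure. (\<Sum>j=1..N. slope X \<psi> j * (g' x * indicator {X j<..<X (j + 1)} x)))"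
      unfolding L2_inner_def mX interp_deriv_def prod.case sum_distrib_left
      by (intro Bochner_Integration.integral_cong sum.cong refl) (rule mult.left_commute)
    also have "\<dots> = (\<Sum>j=1..N. (LINT x|unit_measure. slope X \<psi> j * (g' x * indicator {X j<..<X (j + 1)} x)))"
    proof (rule Bochner_Integration.integral_sum)
      fix j assume "j \<in> {1..N}"
      from cell[OF this] show "integrable unit_measure (\<lambda>x. slope X \<psi> j * (g' x * indicator {X j<..<X (j + 1)} x))"
        by (intro ess_bounded_integrable ess_bounded_cmult ess_bounded_mult
            has_piecewise_deriv_ess_bounded(2)[OF g]
            has_piecewise_deriv_ess_bounded(2)[OF ramp_piecewise_deriv])
    qed
    also have "\<dots> = (\<Sum>j=1..N. slope X \<psi> j * (g (X (j + 1)) - g (X j)))"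
      using cell by (intro sum.cong) (simp_all add: integral_deriv_times_indicator[OF g])
    finally show ?thesis .
  qed
  have "interp m f (X j) = f (X j)" if "j \<in> {1..N + 1}" for j
    using interp_at_node[of N X j f] m mX that by simp
  then show ?thesis
    unfolding eq[OF f] eq[OF interp_piecewise_deriv[OF m]] by (intro sum.cong) auto
qed

text \<open>
  The squared slope of a cell times its length is a part of the integral.
\<close>

lemma interp_deriv_inverse_estimate:
  assumes m: "is_mesh m" and x: "x \<in> {0<..<1} - nodes m"
  shows "(interp_deriv m \<phi> x)\<^sup>2 * min_mesh_size m \<le> L2_inner (interp_deriv m \<phi>) (interp_deriv m \<phi>)"
proof -
  obtain N X where mX: "m = (N, X)" by (cases m)
  obtain j where j: "j \<in> {1..N}" and xj: "x \<in> {X j<..<X (j + 1)}"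
    using mesh_cover_interior[of N X x] m mX x by auto
  have cell: "X j < X (j + 1)" "0 \<le> X j" "X (j + 1) \<le> 1"
    using mesh_cell_less[of N X j] mesh_node_bounds[of N X j] mesh_node_bounds[of N X "j + 1"] j m mX
    by auto
  define s where "s = slope X \<phi> j"
  have val: "interp_deriv m \<phi> y = s" if "y \<in> {X j<..<X (j + 1)}" for y
    using interp_deriv_on_cell[of N X j y \<phi>] m mX j that by (simp add: s_def)
  have "has_piecewise_deriv (\<lambda>x. x) (\<lambda>_. 1)"
    by (rule has_piecewise_deriv_C1) (auto intro!: derivative_eq_intros)
  from integral_deriv_times_indicator[OF this] cell
  have "(LINT y|unit_measure. indicator {X j<..<X (j + 1)} y) = X (j + 1) - X j" by simp
  then have "s\<^sup>2 * (X (j + 1) - X j) = (LINT y|unit_measure. s\<^sup>2 * indicator {X j<..<X (j + 1)} y)" by simp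
  also have "\<dots> \<le> L2_inner (interp_deriv m \<phi>) (interp_deriv m \<phi>)"
    unfolding L2_inner_def
  proof (rule integral_unit_mono)
    show "AE y in unit_measure. s\<^sup>2 * indicator {X j<..<X (j + 1)} y \<le> interp_deriv m \<phi> y * interp_deriv m \<phi> y"
      using val by (auto intro!: AE_unit_measureI simp: indicator_def power2_eq_square)
  qed (intro ess_bounded_cmult ess_bounded_mult interp_deriv_ess_bounded m
      has_piecewise_deriv_ess_bounded(2)[OF ramp_piecewise_deriv] cell)+
  finally have "s\<^sup>2 * (X (j + 1) - X j) \<le> L2_inner (interp_deriv m \<phi>) (interp_deriv m \<phi>)" .
  moreover have "s\<^sup>2 * min_mesh_size m \<le> s\<^sup>2 * (X (j + 1) - X j)"
    using mesh_size_bounds(2)[of N X j] m mX j by (intro mult_left_mono) auto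
  ultimately show ?thesis using val[OF xj] by simp
qed

section \<open>Orthonormal bases\<close>

text \<open>
  Finite element spaces are sets of functions whose dimension depends on the mesh and whose elements
  count as equal when they agree on \<open>[0,1]\<close>; hence a form on a set, required to be only
  semidefinite.
\<close>

definition inner_form_on :: "('x \<Rightarrow> real) set \<Rightarrow> (('x \<Rightarrow> real) \<Rightarrow> ('x \<Rightarrow> real) \<Rightarrow> real) \<Rightarrow> bool" where
  "inner_form_on V B \<longleftrightarrow>
    (\<lambda>_. 0) \<in> V \<and> (\<forall>f\<in>V. \<forall>g\<in>V. \<forall>a b. (\<lambda>x. a * f x + b * g x) \<in> V) \<and>
    (\<forall>f\<in>V. \<forall>g\<in>V. B f g = B g f) \<and>
    (\<forall>f\<in>V. \<forall>g\<in>V. \<forall>h\<in>V. \<forall>a b. B (\<lambda>x. a * f x + b * g x) h = a * B f h + b * B g h) \<and>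
    (\<forall>f\<in>V. 0 \<le> B f f)"

lemma inner_form_onD:
  assumes "inner_form_on V B" "f \<in> V" "g \<in> V"
  shows "(\<lambda>x. a * f x + b * g x) \<in> V" "B f g = B g f" "0 \<le> B f f"
    "h \<in> V \<Longrightarrow> B (\<lambda>x. a * f x + b * g x) h = a * B f h + b * B g h"
  using assms by (auto simp: inner_form_on_def)

lemma inner_form_sum:
  assumes B: "inner_form_on V B" and "finite I" "\<And>i. i \<in> I \<Longrightarrow> f i \<in> V" and h: "h \<in> V"
  shows "(\<lambda>x. \<Sum>i\<in>I. c i * f i x) \<in> V"
    and "B (\<lambda>x. \<Sum>i\<in>I. c i * f i x) h = (\<Sum>i\<in>I. c i * B (f i) h)"
proof -
  have z: "(\<lambda>_. 0) \<in> V" using B by (simp add: inner_form_on_def)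
  have "(\<lambda>x. \<Sum>i\<in>I. c i * f i x) \<in> V \<and> B (\<lambda>x. \<Sum>i\<in>I. c i * f i x) h = (\<Sum>i\<in>I. c i * B (f i) h)"
    using assms(2,3)
  proof (induction I rule: finite_induct)
    case empty
    show ?case using z inner_form_onD(4)[OF B z z h, of 0 0] by simp
  next
    case (insert i I)
    then have "f i \<in> V" "(\<lambda>x. \<Sum>i\<in>I. c i * f i x) \<in> V"
      "B (\<lambda>x. \<Sum>i\<in>I. c i * f i x) h = (\<Sum>i\<in>I. c i * B (f i) h)" by auto
    then show ?case
      using inner_form_onD(1)[OF B, of "f i" "\<lambda>x. \<Sum>i\<in>I. c i * f i x" "c i" 1]
        inner_form_onD(4)[OF B, of "f i" "\<lambda>x. \<Sum>i\<in>I. c i * f i x" h "c i" 1] h insert(1,2) by simp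
  qed
  then show "(\<lambda>x. \<Sum>i\<in>I. c i * f i x) \<in> V"
    "B (\<lambda>x. \<Sum>i\<in>I. c i * f i x) h = (\<Sum>i\<in>I. c i * B (f i) h)" by auto
qed

lemma inner_form_zero_left:
  assumes B: "inner_form_on V B" and "h \<in> V" shows "B (\<lambda>_. 0) h = 0"
  using inner_form_sum(2)[OF B, of "{} :: nat set" _ h] assms by simp

definition orthonormal :: "(('x \<Rightarrow> real) \<Rightarrow> ('x \<Rightarrow> real) \<Rightarrow> real) \<Rightarrow> (nat \<Rightarrow> 'x \<Rightarrow> real) \<Rightarrow> nat \<Rightarrow> bool" where
  "orthonormal B e n \<longleftrightarrow> (\<forall>i<n. \<forall>j<n. B (e i) (e j) = (if i = j then 1 else 0))"

lemma Gram_Schmidt: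
  assumes B: "inner_form_on V B" and def: "\<And>f x. f \<in> V \<Longrightarrow> B f f = 0 \<Longrightarrow> x \<in> D \<Longrightarrow> f x = 0"
    and "finite I" "\<And>i. i \<in> I \<Longrightarrow> h i \<in> V"
  shows "\<exists>n e. (\<forall>i<n. e i \<in> V) \<and> orthonormal B e n \<and>
    (\<forall>i\<in>I. \<exists>c. \<forall>x\<in>D. h i x = (\<Sum>k<n. c k * e k x))"
  using assms(3,4)
proof (induction I rule: finite_induct)
  case empty
  then show ?case by (intro exI[of _ 0]) (auto simp: orthonormal_def)
next
  case (insert i I)
  then obtain n e where e: "\<And>k. k < n \<Longrightarrow> e k \<in> V" "orthonormal B e n"
    and sp: "\<And>i. i \<in> I \<Longrightarrow> \<exists>c. \<forall>x\<in>D. h i x = (\<Sum>k<n. c k * e k x)" by blast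
  have hi: "h i \<in> V" using insert by simp
  define p where "p = (\<lambda>x. \<Sum>k<n. B (h i) (e k) * e k x)"
  have pV: "p \<in> V" unfolding p_def by (rule inner_form_sum(1)[OF B _ _ hi]) (use e in auto)
  define r where "r = (\<lambda>x. 1 * h i x + (- 1) * p x)"
  have rV: "r \<in> V" unfolding r_def by (rule inner_form_onD(1)[OF B hi pV])
  have orth: "B r (e k) = 0" if k: "k < n" for k
  proof -
    have "B r (e k) = B (h i) (e k) - B p (e k)"
      unfolding r_def using inner_form_onD(4)[OF B hi pV e(1)[OF k], of 1 "-1"] by simp
    also have "B p (e k) = (\<Sum>l<n. B (h i) (e l) * B (e l) (e k))"
      unfolding p_def by (rule inner_form_sum(2)[OF B _ _ e(1)[OF k]]) (use e in auto)
    also have "\<dots> = (\<Sum>l<n. if l = k then B (h i) (e k) else 0)"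
      using e(2) k by (intro sum.cong) (auto simp: orthonormal_def)
    finally show ?thesis using k by simp
  qed
  show ?case
  proof (cases "B r r = 0")
    case True
    then have "\<forall>x\<in>D. h i x = (\<Sum>k<n. B (h i) (e k) * e k x)"
      using def[OF rV] by (auto simp: r_def p_def)
    then have "\<forall>j\<in>insert i I. \<exists>c. \<forall>x\<in>D. h j x = (\<Sum>k<n. c k * e k x)"
      using sp by (auto intro: exI[of _ "\<lambda>k. B (h i) (e k)"])
    then show ?thesis using e by (intro exI[of _ n] exI[of _ e]) auto
  next
    case False
    define \<rho> where "\<rho> = sqrt (B r r)"
    have \<rho>: "0 < \<rho>" "\<rho> * \<rho> = B r r"
      using False inner_form_onD(3)[OF B rV rV] by (auto simp: \<rho>_def)
    define q where "q = (\<lambda>x. (1 / \<rho>) * r x + 0 * r x)"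
    have qV: "q \<in> V" unfolding q_def by (rule inner_form_onD(1)[OF B rV rV])
    have Bq: "B q g = B r g / \<rho>" if "g \<in> V" for g
      unfolding q_def using inner_form_onD(4)[OF B rV rV that, of "1 / \<rho>" 0] by simp
    define e' where "e' = e(n := q)"
    have e': "e' k \<in> V" if "k < Suc n" for k
      using that e qV by (auto simp: e'_def less_Suc_eq)
    have "B q q = 1"
      using Bq[OF qV] inner_form_onD(2)[OF B rV qV] Bq[OF rV] \<rho> False by (simp add: field_simps)
    moreover have "B q (e k) = 0" "B (e k) q = 0" if "k < n" for k
      using Bq[OF e(1)[OF that]] orth[OF that] inner_form_onD(2)[OF B qV e(1)[OF that]] by auto
    ultimately have "orthonormal B e' (Suc n)"
      using e(2) unfolding orthonormal_def e'_def by (auto simp: less_Suc_eq)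
    moreover have "\<exists>c. \<forall>x\<in>D. h j x = (\<Sum>k<Suc n. c k * e' k x)" if j: "j \<in> insert i I" for j
    proof (cases "j = i")
      case True
      have "h i x = (\<Sum>k<Suc n. ((\<lambda>k. B (h i) (e k))(n := \<rho>)) k * e' k x)" for x
        using \<rho>(1) by (simp add: e'_def q_def r_def p_def)
      then show ?thesis using True by blast
    next
      case False
      then obtain c where "\<forall>x\<in>D. h j x = (\<Sum>k<n. c k * e k x)" using sp j by blast
      then have "\<forall>x\<in>D. h j x = (\<Sum>k<Suc n. (c(n := 0)) k * e' k x)" by (simp add: e'_def)
      then show ?thesis by blast
    qed
    ultimately show ?thesis using e' by (intro exI[of _ "Suc n"] exI[of _ e']) auto
  qed
qed

text \<open>
  Equalities are asserted on \<open>D\<close> only, since the form does not see the functions elsewhere.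
\<close>

lemma orthonormal_basis_exists:
  assumes B: "inner_form_on V B" and def: "\<And>f x. f \<in> V \<Longrightarrow> B f f = 0 \<Longrightarrow> x \<in> D \<Longrightarrow> f x = 0"
    and cong: "\<And>f g k. f \<in> V \<Longrightarrow> g \<in> V \<Longrightarrow> k \<in> V \<Longrightarrow> (\<forall>x\<in>D. f x = g x) \<Longrightarrow> B f k = B g k"
    and I: "finite I" "\<And>i. i \<in> I \<Longrightarrow> h i \<in> V"
    and span: "\<And>f. f \<in> V \<Longrightarrow> \<exists>a. \<forall>x\<in>D. f x = (\<Sum>i\<in>I. a i * h i x)"
  shows "\<exists>n e. (\<forall>i<n. e i \<in> V) \<and> orthonormal B e n \<and>
    (\<forall>f\<in>V. \<forall>x\<in>D. f x = (\<Sum>k<n. B f (e k) * e k x))"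
proof -
  obtain n e where e: "\<And>k. k < n \<Longrightarrow> e k \<in> V" "orthonormal B e n"
    and sp: "\<And>i. i \<in> I \<Longrightarrow> \<exists>c. \<forall>x\<in>D. h i x = (\<Sum>k<n. c k * e k x)"
    using Gram_Schmidt[of V B D I h] B def I by blast
  obtain c where c: "\<And>i x. i \<in> I \<Longrightarrow> x \<in> D \<Longrightarrow> h i x = (\<Sum>k<n. c i k * e k x)"
    using sp by metis
  have "f x = (\<Sum>k<n. B f (e k) * e k x)" if f: "f \<in> V" and x: "x \<in> D" for f x
  proof -
    obtain a where a: "\<And>x. x \<in> D \<Longrightarrow> f x = (\<Sum>i\<in>I. a i * h i x)" using span[OF f] by blast
    define b where "b k = (\<Sum>i\<in>I. a i * c i k)" for k
    have fb: "f x = (\<Sum>k<n. b k * e k x)" if "x \<in> D" for x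
    proof -
      have "f x = (\<Sum>i\<in>I. \<Sum>k<n. a i * c i k * e k x)"
        using a[OF that] c that by (simp add: sum_distrib_left mult.assoc)
      also have "\<dots> = (\<Sum>k<n. b k * e k x)"
        unfolding b_def sum_distrib_right by (rule sum.swap)
      finally show ?thesis .
    qed
    have "B f (e k) = b k" if k: "k < n" for k
    proof -
      have "B f (e k) = B (\<lambda>x. \<Sum>k<n. b k * e k x) (e k)"
      proof (rule cong[OF f _ e(1)[OF k]])
        show "(\<lambda>x. \<Sum>k<n. b k * e k x) \<in> V" by (rule inner_form_sum(1)[OF B _ _ f]) (use e in auto)
      qed (use fb in blast)
      also have "\<dots> = (\<Sum>l<n. b l * B (e l) (e k))"
        by (rule inner_form_sum(2)[OF B _ _ e(1)[OF k]]) (use e in auto)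
      also have "\<dots> = (\<Sum>l<n. if l = k then b k else 0)"
        using e(2) k by (intro sum.cong) (auto simp: orthonormal_def)
      finally show ?thesis using k by simp
    qed
    then show ?thesis using fb[OF x] by simp
  qed
  then show ?thesis using e by (intro exI[of _ n] exI[of _ e]) auto
qed

section \<open>Ordinary differential equations\<close>

text \<open>
  The substitution \<open>y t = exp (2 K t) z t\<close> turns the integral equation on all of \<open>[0,T]\<close> into a fixed
  point equation for \<open>z\<close> with contraction constant \<open>1/2\<close> in the supremum norm.
\<close>

lemma global_Lipschitz_ode:
  fixes f :: "'a::banach \<Rightarrow> 'a"
  assumes lip: "\<And>x y. norm (f x - f y) \<le> L * norm (x - y)" and T: "0 < T"
  shows "\<exists>y. y 0 = y0 \<and> (\<forall>t\<in>{0..T}. (y has_vector_derivative f (y t)) (at t within {0..T}))"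
proof -
  define K where "K = max L 1"
  have K: "0 < K" "\<And>x y. norm (f x - f y) \<le> K * norm (x - y)"
    using order_trans[OF lip mult_right_mono[of L "max L 1"]] by (auto simp: K_def)
  have "K-lipschitz_on UNIV f"
    using K by (intro lipschitz_onI) (auto simp: dist_norm)
  then have fc: "continuous_on A f" for A
    using lipschitz_on_continuous_on continuous_on_subset by blast
  define h where "h z s = f (exp (2 * K * s) *\<^sub>R z s)" for z :: "real \<Rightarrow> 'a" and s
  have hc: "continuous_on A (h z)" if "continuous_on A z" for A z
    unfolding h_def by (intro continuous_on_compose2[OF fc[of UNIV]] continuous_intros that) auto
  define g where "g z t = exp (- (2 * K * t)) *\<^sub>R (y0 + integral {0..t} (h z))" for z t
  have gc: "continuous_on {0..T} (g z)" if "continuous_on {0..T} z" for z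
    unfolding g_def
    by (intro continuous_intros indefinite_integral_continuous_1 integrable_continuous_real hc that)
  have "\<exists>G :: real \<Rightarrow>\<^sub>C 'a. (\<forall>t\<in>{0..T}. G t = g z t) \<and> (\<forall>t. G t = g z (clamp 0 T t))" for z :: "real \<Rightarrow>\<^sub>C 'a"
  proof -
    have "continuous_on (cbox 0 T) (g z)" using gc[of z] by simp
    from continuous_on_cbox_bcontfunE[OF this] obtain G :: "real \<Rightarrow>\<^sub>C 'a"
      where "\<And>t. t \<in> cbox 0 T \<Longrightarrow> G t = g z t" "\<And>t. G t = g z (clamp 0 T t)"
      by metis
    then show ?thesis unfolding cbox_interval by blast
  qed
  then obtain \<Phi> :: "(real \<Rightarrow>\<^sub>C 'a) \<Rightarrow> (real \<Rightarrow>\<^sub>C 'a)"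
    where \<Phi>: "\<And>z t. t \<in> {0..T} \<Longrightarrow> \<Phi> z t = g z t" "\<And>z t. \<Phi> z t = g z (clamp 0 T t)" by metis
  have "dist (\<Phi> z) (\<Phi> w) \<le> 1 / 2 * dist z w" for z w
  proof (rule dist_bound)
    fix t0
    define t where "t = clamp 0 T t0"
    have t: "t \<in> {0..T}" using clamp_in_interval[of 0 T t0] T by (simp add: t_def)
    have ii: "h z integrable_on {0..t}" "h w integrable_on {0..t}"
      by (intro integrable_continuous_real hc continuous_on_apply_bcontfun)+
    define d where "d = dist z w"
    have "((\<lambda>s. K * exp (2 * K * s) * d) has_integral exp (2 * K * t) * d / 2 - exp (2 * K * 0) * d / 2) {0..t}"
      using t by (intro fundamental_theorem_of_calculus)
        (auto intro!: derivative_eq_intros simp flip: has_real_derivative_iff_has_vector_derivative)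
    then have I: "(\<lambda>s. K * exp (2 * K * s) * d) integrable_on {0..t}"
      "integral {0..t} (\<lambda>s. K * exp (2 * K * s) * d) = exp (2 * K * t) * d / 2 - d / 2"
      by (auto simp: has_integral_integrable_integral)
    have "dist (\<Phi> z t0) (\<Phi> w t0) = norm (g z t - g w t)"
      by (simp add: \<Phi>(2) t_def dist_norm)
    also have "g z t - g w t = exp (- (2 * K * t)) *\<^sub>R integral {0..t} (\<lambda>s. h z s - h w s)"
      using ii by (simp add: g_def integral_diff algebra_simps)
    also have "norm \<dots> \<le> exp (- (2 * K * t)) * integral {0..t} (\<lambda>s. K * exp (2 * K * s) * d)"
    proof -
      have "norm (integral {0..t} (\<lambda>s. h z s - h w s)) \<le> integral {0..t} (\<lambda>s. K * exp (2 * K * s) * d)"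
      proof (rule integral_norm_bound_integral)
        fix s
        have "norm (h z s - h w s) \<le> K * norm (exp (2 * K * s) *\<^sub>R z s - exp (2 * K * s) *\<^sub>R w s)"
          unfolding h_def by (rule K(2))
        also have "\<dots> = K * exp (2 * K * s) * dist (z s) (w s)"
          by (simp add: dist_norm flip: scaleR_diff_right)
        also have "\<dots> \<le> K * exp (2 * K * s) * d"
          unfolding d_def using K by (intro mult_left_mono dist_bounded) auto
        finally show "norm (h z s - h w s) \<le> K * exp (2 * K * s) * d" .
      qed (use ii I in \<open>auto intro: integrable_diff\<close>)
      then show ?thesis by (simp add: mult_left_mono)
    qed
    also have "\<dots> = d / 2 - exp (- (2 * K * t)) * d / 2"
      unfolding I(2) by (simp add: right_diff_distrib exp_minus)
    also have "\<dots> \<le> 1 / 2 * d" by (simp add: d_def)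
    finally show "dist (\<Phi> z t0) (\<Phi> w t0) \<le> 1 / 2 * dist z w" by (simp add: d_def)
  qed
  then obtain z where z: "\<Phi> z = z" using banach_fix_type[of "1 / 2" \<Phi>] by auto
  define y where "y t = exp (2 * K * t) *\<^sub>R z t" for t
  have hy: "h z = (\<lambda>s. f (y s))" by (simp add: h_def[abs_def] y_def)
  have yI: "y t = y0 + integral {0..t} (\<lambda>s. f (y s))" if "t \<in> {0..T}" for t
  proof -
    have "z t = g z t" using \<Phi>(1)[OF that, of z] z by simp
    then show ?thesis unfolding y_def g_def hy by (simp add: exp_minus)
  qed
  have "continuous_on {0..T} (\<lambda>s. f (y s))"
    using hc[of "{0..T}" z] unfolding hy by simp
  then have "((\<lambda>t. integral {0..t} (\<lambda>s. f (y s))) has_vector_derivative f (y t)) (at t within {0..T})"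
    if "t \<in> {0..T}" for t
    using that by (intro integral_has_vector_derivative)
  then have d: "((\<lambda>t. y0 + integral {0..t} (\<lambda>s. f (y s))) has_vector_derivative f (y t)) (at t within {0..T})"
    if "t \<in> {0..T}" for t
    using that by (auto intro!: derivative_eq_intros)
  have "(y has_vector_derivative f (y t)) (at t within {0..T})" if "t \<in> {0..T}" for t
    using has_vector_derivative_transform[OF that _ d[OF that], of y] yI by simp
  moreover have "y 0 = y0" using yI[of 0] T by simp
  ultimately show ?thesis by blast
qed

instance bcontfun :: (metric_space, banach) banach ..

text \<open>
  The combinations \<open>\<Sum>i<n. c i * tent i\<close> embed coefficient vectors of every length \<open>n\<close> into one and the
  same Banach space of bounded continuous functions; the coefficients are the values at the natural
  numbers.
\<close>

definition tent :: "nat \<Rightarrow> real \<Rightarrow> real" where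
  "tent i x = max 0 (1 - \<bar>x - real i\<bar>)"

lemma tent_at_nat: "tent i (real k) = (if i = k then 1 else 0)"
proof (cases "i = k")
  case False
  then have "1 \<le> \<bar>int k - int i\<bar>" by linarith
  then have "1 \<le> \<bar>real k - real i\<bar>" by linarith
  then show ?thesis using False by (simp add: tent_def)
qed (simp add: tent_def)

lemma tent_sum_bcontfun: "(\<lambda>x. \<Sum>i<n. c i * tent i x) \<in> bcontfun"
proof (rule bcontfun_normI)
  show "continuous_on UNIV (\<lambda>x. \<Sum>i<n. c i * tent i x)"
    unfolding tent_def by (intro continuous_intros)
  show "norm (\<Sum>i<n. c i * tent i x) \<le> (\<Sum>i<n. \<bar>c i\<bar>)" for x
    unfolding real_norm_def
    by (intro order_trans[OF sum_abs] sum_mono) (simp add: abs_mult tent_def mult_left_le)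
qed

lemma ode_system_exists:
  fixes F :: "nat \<Rightarrow> (nat \<Rightarrow> real) \<Rightarrow> real"
  assumes lip: "\<And>i x y d. i < n \<Longrightarrow> (\<And>k. k < n \<Longrightarrow> \<bar>x k - y k\<bar> \<le> d) \<Longrightarrow> 0 \<le> d \<Longrightarrow> \<bar>F i x - F i y\<bar> \<le> L * d"
    and T: "0 < T" and L: "0 \<le> L"
  shows "\<exists>y. (\<forall>i<n. y 0 i = y0 i) \<and>
    (\<forall>i<n. \<forall>t\<in>{0..T}. ((\<lambda>t. y t i) has_real_derivative F i (y t)) (at t within {0..T}))"
proof -
  define emb where "emb c = Bcontfun (\<lambda>x. \<Sum>i<n. c i * tent i x)" for c
  have emb: "apply_bcontfun (emb c) x = (\<Sum>i<n. c i * tent i x)" for c x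
    unfolding emb_def by (subst Bcontfun_inverse[OF tent_sum_bcontfun]) simp
  have emb_nat: "apply_bcontfun (emb c) (real k) = c k" if "k < n" for c k
  proof -
    have "(\<Sum>i<n. c i * tent i (real k)) = (\<Sum>i<n. if i = k then c k else 0)"
      by (intro sum.cong) (auto simp: tent_at_nat)
    then show ?thesis using that by (simp add: emb)
  qed
  define f where "f v = emb (\<lambda>i. F i (\<lambda>k. apply_bcontfun v (real k)))" for v
  have "norm (f v - f w) \<le> (real n * L) * norm (v - w)" for v w
  proof (rule norm_bound)
    fix x
    have "\<bar>apply_bcontfun v y - apply_bcontfun w y\<bar> \<le> norm (v - w)" for y
      using norm_bounded[of "v - w" y] by simp
    then have 1: "\<bar>F i (\<lambda>k. apply_bcontfun v (real k)) - F i (\<lambda>k. apply_bcontfun w (real k))\<bar> \<le> L * norm (v - w)"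
      if "i < n" for i
      using that by (intro lip) auto
    have "norm (apply_bcontfun (f v - f w) x) =
      \<bar>\<Sum>i<n. (F i (\<lambda>k. apply_bcontfun v (real k)) - F i (\<lambda>k. apply_bcontfun w (real k))) * tent i x\<bar>"
      by (simp add: f_def emb sum_subtractf left_diff_distrib)
    also have "\<dots> \<le> (\<Sum>i<n. L * norm (v - w))"
    proof (intro order_trans[OF sum_abs] sum_mono)
      fix i assume "i \<in> {..<n}"
      then have "\<bar>F i (\<lambda>k. apply_bcontfun v (real k)) - F i (\<lambda>k. apply_bcontfun w (real k))\<bar> * \<bar>tent i x\<bar>
          \<le> (L * norm (v - w)) * 1"
        using 1 L by (intro mult_mono) (auto simp: tent_def)
      then show "\<bar>(F i (\<lambda>k. apply_bcontfun v (real k)) - F i (\<lambda>k. apply_bcontfun w (real k))) * tent i x\<bar>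
          \<le> L * norm (v - w)" by (simp add: abs_mult)
    qed
    finally show "norm (apply_bcontfun (f v - f w) x) \<le> (real n * L) * norm (v - w)" by simp
  qed
  then obtain y where
    y: "y 0 = emb y0" "\<And>t. t \<in> {0..T} \<Longrightarrow> (y has_vector_derivative f (y t)) (at t within {0..T})"
    using global_Lipschitz_ode[of f "real n * L" T "emb y0"] T by blast
  have bl: "bounded_linear (\<lambda>v :: real \<Rightarrow>\<^sub>C real. apply_bcontfun v x)" for x
  proof (rule bounded_linear_intro[of _ 1])
    fix v :: "real \<Rightarrow>\<^sub>C real"
    show "norm (apply_bcontfun v x) \<le> norm v * 1" using norm_bounded[of v x] by simp
  qed simp_all
  have "((\<lambda>t. apply_bcontfun (y t) (real i)) has_real_derivative F i (\<lambda>k. apply_bcontfun (y t) (real k))) (at t within {0..T})"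
    if "i < n" "t \<in> {0..T}" for i t
    using bounded_linear.has_vector_derivative[OF bl y(2)[OF that(2)], of "real i"] that(1)
    by (simp add: has_real_derivative_iff_has_vector_derivative f_def emb_nat)
  then show ?thesis using y(1) emb_nat by (intro exI[of _ "\<lambda>t i. apply_bcontfun (y t) (real i)"]) auto
qed

definition trunc :: "real \<Rightarrow> real \<Rightarrow> real" where
  "trunc R x = max (- R) (min R x)"

lemma trunc_simps: "\<bar>x\<bar> \<le> R \<Longrightarrow> trunc R x = x" "0 \<le> R \<Longrightarrow> \<bar>trunc R x\<bar> \<le> R"
  "\<bar>trunc R x - trunc R y\<bar> \<le> \<bar>x - y\<bar>"
  by (auto simp: trunc_def)

text \<open>
  A quadratic polynomial of truncated variables is globally Lipschitz.
\<close>

lemma truncated_quadratic_ode: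
  fixes A :: "nat \<Rightarrow> nat \<Rightarrow> real" and Q :: "nat \<Rightarrow> nat \<Rightarrow> nat \<Rightarrow> real"
  assumes T: "0 < T" and R: "0 \<le> R"
  shows "\<exists>y. (\<forall>i<n. y 0 i = y0 i) \<and>
    (\<forall>i<n. \<forall>t\<in>{0..T}. ((\<lambda>t. y t i) has_real_derivative
      (\<Sum>k<n. A i k * trunc R (y t k)) + (\<Sum>k<n. \<Sum>l<n. Q i k l * (trunc R (y t k) * trunc R (y t l))))
      (at t within {0..T}))"
proof -
  define F where "F i x = (\<Sum>k<n. A i k * trunc R (x k)) +
    (\<Sum>k<n. \<Sum>l<n. Q i k l * (trunc R (x k) * trunc R (x l)))" for i x
  define l where "l i = (\<Sum>k<n. \<bar>A i k\<bar>) + (\<Sum>k<n. \<Sum>l<n. \<bar>Q i k l\<bar> * (2 * R))" for i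
  define L where "L = (\<Sum>i<n. l i)"
  have l0: "0 \<le> l i" for i unfolding l_def using R by (intro add_nonneg_nonneg sum_nonneg) auto
  have lip: "\<bar>F i x - F i y\<bar> \<le> L * d" if i: "i < n" and xy: "\<And>k. k < n \<Longrightarrow> \<bar>x k - y k\<bar> \<le> d" and d: "0 \<le> d" for i x y d
  proof -
    have td: "\<bar>trunc R (x k) - trunc R (y k)\<bar> \<le> d" if "k < n" for k
      using trunc_simps(3)[of R "x k" "y k"] xy[OF that] by linarith
    have "\<bar>(\<Sum>k<n. A i k * trunc R (x k)) - (\<Sum>k<n. A i k * trunc R (y k))\<bar> \<le> (\<Sum>k<n. \<bar>A i k\<bar> * d)"
      unfolding sum_subtractf[symmetric] right_diff_distrib[symmetric]
      by (intro order_trans[OF sum_abs] sum_mono) (auto simp: abs_mult td intro!: mult_left_mono)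
    moreover have "\<bar>(\<Sum>k<n. \<Sum>l<n. Q i k l * (trunc R (x k) * trunc R (x l))) -
        (\<Sum>k<n. \<Sum>l<n. Q i k l * (trunc R (y k) * trunc R (y l)))\<bar> \<le> (\<Sum>k<n. \<Sum>l<n. \<bar>Q i k l\<bar> * (2 * R) * d)"
      unfolding sum_subtractf[symmetric] right_diff_distrib[symmetric]
    proof (intro order_trans[OF sum_abs] sum_mono)
      fix k l assume "k \<in> {..<n}" "l \<in> {..<n}"
      then have kl: "k < n" "l < n" by auto
      have "trunc R (x k) * trunc R (x l) - trunc R (y k) * trunc R (y l) =
        trunc R (x k) * (trunc R (x l) - trunc R (y l)) + trunc R (y l) * (trunc R (x k) - trunc R (y k))"
        by (simp add: algebra_simps)
      also have "\<bar>\<dots>\<bar> \<le> R * d + R * d"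
        by (intro order_trans[OF abs_triangle_ineq] add_mono)
          (auto simp: abs_mult trunc_simps(2)[OF R] td kl R intro!: mult_mono)
      finally have "\<bar>trunc R (x k) * trunc R (x l) - trunc R (y k) * trunc R (y l)\<bar> \<le> 2 * R * d" by simp
      from mult_left_mono[OF this, of "\<bar>Q i k l\<bar>"]
      show "\<bar>Q i k l * (trunc R (x k) * trunc R (x l) - trunc R (y k) * trunc R (y l))\<bar> \<le> \<bar>Q i k l\<bar> * (2 * R) * d"
        by (simp add: abs_mult mult.assoc)
    qed
    ultimately have "\<bar>F i x - F i y\<bar> \<le> (\<Sum>k<n. \<bar>A i k\<bar> * d) + (\<Sum>k<n. \<Sum>l<n. \<bar>Q i k l\<bar> * (2 * R) * d)"
      unfolding F_def by linarith
    also have "\<dots> = l i * d" by (simp add: l_def sum_distrib_right distrib_right)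
    also have "l i \<le> L" unfolding L_def using i l0 by (intro member_le_sum) auto
    finally show ?thesis using d by (simp add: mult_right_mono order_trans)
  qed
  have "0 \<le> L" unfolding L_def by (intro sum_nonneg l0)
  then show ?thesis using ode_system_exists[of n F L T y0] lip T unfolding F_def by blast
qed

section \<open>A Gronwall inequality with continuation\<close>

text \<open>
  The differential inequality is known only as long as \<open>E\<close> is at most \<open>\<delta>\<close>. At the first time at which
  \<open>E\<close> were equal to \<open>\<delta>\<close>, Gronwall's inequality up to that time would give a smaller value.
\<close>

lemma Gronwall_continuation:
  fixes E :: "real \<Rightarrow> real"
  assumes d: "\<And>t. t \<in> {0..T} \<Longrightarrow> (E has_real_derivative E' t) (at t within {0..T})"
    and K: "0 \<le> K" and r: "0 \<le> r" and E0: "0 \<le> E 0"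
    and ineq: "\<And>t. t \<in> {0..T} \<Longrightarrow> E t \<le> \<delta> \<Longrightarrow> E' t \<le> K * (E t + r)"
    and small: "(E 0 + r) * exp (K * T) < \<delta>" and t: "t \<in> {0..T}"
  shows "E t + r \<le> (E 0 + r) * exp (K * t)" "E t < \<delta>"
proof -
  have Ec: "continuous_on {0..T} E" using d by (rule DERIV_continuous_on)
  define F where "F t = (E t + r) * exp (- (K * t))" for t
  have Fd: "(F has_real_derivative (E' t - K * (E t + r)) * exp (- (K * t))) (at t within {0..T})"
    if "t \<in> {0..T}" for t
    unfolding F_def by (rule derivative_eq_intros d[OF that] refl)+ (simp add: algebra_simps)
  have main: "E s + r \<le> (E 0 + r) * exp (K * s)"
    if s: "s \<in> {0..T}" and le: "\<And>\<tau>. \<tau> \<in> {0..s} \<Longrightarrow> E \<tau> \<le> \<delta>" for s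
  proof -
    have "F s \<le> F 0"
    proof (cases "s = 0")
      case False
      have "\<exists>z\<in>{0<..<s}. F s - F 0 = (E' z - K * (E z + r)) * exp (- (K * z)) * (s - 0)"
      proof (rule mvt_simple)
        fix x assume "0 \<le> x" "x \<le> s"
        then show "(F has_derivative (*) ((E' x - K * (E x + r)) * exp (- (K * x)))) (at x within {0..s})"
          using has_field_derivative_subset[OF Fd, of x "{0..s}"] s by (auto simp: has_field_derivative_def)
      qed (use s False in auto)
      then obtain z where z: "z \<in> {0<..<s}" "F s - F 0 = (E' z - K * (E z + r)) * exp (- (K * z)) * s" by auto
      have "E' z \<le> K * (E z + r)" using ineq[of z] le[of z] z s by auto
      then have "F s - F 0 \<le> 0" unfolding z(2) using s by (intro mult_nonpos_nonneg) auto
      then show ?thesis by simp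
    qed simp
    then have "(E s + r) * exp (- (K * s)) * exp (K * s) \<le> (E 0 + r) * exp (K * s)"
      by (intro mult_right_mono) (auto simp: F_def)
    then show ?thesis by (simp add: mult.assoc flip: exp_add)
  qed
  have growth: "(E 0 + r) * exp (K * s) < \<delta>" if "s \<in> {0..T}" for s
  proof -
    have "(E 0 + r) * exp (K * s) \<le> (E 0 + r) * exp (K * T)"
      using that K r E0 by (intro mult_left_mono) (auto intro!: mult_left_mono)
    then show ?thesis using small by linarith
  qed
  have lt: "E s < \<delta>" if s: "s \<in> {0..T}" for s
  proof (rule ccontr)
    assume "\<not> E s < \<delta>"
    have E0lt: "E 0 < \<delta>" using growth[of 0] s r by simp
    define A where "A = {\<tau> \<in> {0..T}. E \<tau> = \<delta>}"
    have hit: "\<exists>y\<in>A. y \<le> x" if "x \<in> {0..T}" "\<delta> \<le> E x" for x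
      using IVT'[of E 0 \<delta> x] that E0lt continuous_on_subset[OF Ec, of "{0..x}"]
      by (auto simp: A_def)
    have "closed A" unfolding A_def
      using continuous_closed_preimage[OF Ec closed_real_atLeastAtMost, of "{\<delta>}"]
      by (simp add: vimage_def Int_def)
    moreover have "A \<noteq> {}" using hit[OF s] \<open>\<not> E s < \<delta>\<close> by auto
    moreover have bA: "bdd_below A" by (auto simp: A_def intro!: bdd_belowI[of _ 0])
    ultimately have inA: "Inf A \<in> A" by (intro closed_contains_Inf)
    define \<tau> where "\<tau> = Inf A"
    have \<tau>: "\<tau> \<in> {0..T}" "E \<tau> = \<delta>" using inA by (auto simp: A_def \<tau>_def)
    have "E x \<le> \<delta>" if x: "x \<in> {0..\<tau>}" for x
    proof (cases "x = \<tau>")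
      case False
      show ?thesis
      proof (rule ccontr)
        assume "\<not> E x \<le> \<delta>"
        then obtain y where "y \<in> A" "y \<le> x" using hit[of x] x \<tau>(1) by auto
        moreover from this have "\<tau> \<le> y" unfolding \<tau>_def using bA by (intro cInf_lower)
        ultimately show False using x False by auto
      qed
    qed (simp add: \<tau>)
    from main[OF \<tau>(1) this] growth[OF \<tau>(1)] \<tau>(2) r show False by linarith
  qed
  show "E t + r \<le> (E 0 + r) * exp (K * t)"
    by (rule main[OF t]) (use lt t in \<open>auto intro: less_imp_le\<close>)
  show "E t < \<delta>" by (rule lt[OF t])
qed

text \<open>
  The first weak derivative is \<open>weak_deriv 1\<close>; rewriting \<open>1\<close> to \<open>Suc 0\<close> would keep the rules about it
  from matching.
\<close>

declare One_nat_def [simp del]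

section \<open>The bilinear forms on the finite element spaces\<close>

lemma S_h0_subset: "\<psi> \<in> S_h0 m \<Longrightarrow> \<psi> \<in> S_h m"
  by (simp add: S_h0_def)

lemma L2_definite:
  assumes "continuous_on {0..1} f" "L2_inner f f = 0" "x \<in> {0..1}" shows "f x = 0"
proof -
  have c: "continuous_on {0..1} (\<lambda>x. f x * f x)" by (intro continuous_intros assms)
  have "integral {0<..<1} (\<lambda>x. f x * f x) = 0"
    using assms(2) ess_bounded_integrable[OF ess_bounded_continuous[OF c]]
    unfolding L2_inner_def by (subst (asm) lebesgue_integral_eq_integral) auto
  then have "((\<lambda>x. f x * f x) has_integral 0) (cbox 0 1)"
    using integrable_integral[OF integrable_continuous_real[OF c]] integral_open_interval_real[of 0 1 "\<lambda>x. f x * f x"]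
    by simp
  then have "f x * f x = 0"
    using c assms(3) by (intro has_integral_0_cbox_imp_0[of 0 1 "\<lambda>x. f x * f x"]) auto
  then show ?thesis by simp
qed

lemma a_form_commute: "a_form f g = a_form g f"
  by (simp add: a_form_def L2_inner_commute)

lemma a_form_nonneg: "0 \<le> a_form f f"
  by (simp add: a_form_def L2_inner_nonneg)

lemma a_form_lincomb:
  assumes "piecewise_C1 f" "piecewise_C1 g" "piecewise_C1 h"
  shows "a_form (\<lambda>x. a * f x + b * g x) h = a * a_form f h + b * a_form g h"
proof -
  note e = piecewise_C1_ess_bounded
  have "AE x in unit_measure. Dx (\<lambda>x. a * f x + b * g x) x = a * Dx f x + b * Dx g x"
    using Dx_add(2)[OF Dx_cmult(1)[OF assms(1), of a] Dx_cmult(1)[OF assms(2), of b]]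
      Dx_cmult(2)[OF assms(1), of a] Dx_cmult(2)[OF assms(2), of b]
    by eventually_elim simp
  then have "L2_inner (Dx (\<lambda>x. a * f x + b * g x)) (Dx h) = L2_inner (\<lambda>x. a * Dx f x + b * Dx g x) (Dx h)"
    by (intro L2_inner_cong_AE ess_bounded_intros e assms) auto
  then show ?thesis
    unfolding a_form_def
    by (simp add: L2_inner_add_left L2_inner_cmult_left ess_bounded_intros e assms algebra_simps)
qed

lemma a_form_cong:
  assumes "piecewise_C1 f" "piecewise_C1 h" "\<And>x. x \<in> {0..1} \<Longrightarrow> g x = f x"
    "\<And>x. x \<in> {0..1} \<Longrightarrow> k x = h x"
  shows "a_form g k = a_form f h"
proof -
  have "L2_inner g k = L2_inner f h" using assms by (intro L2_inner_cong) auto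
  moreover have "L2_inner (Dx g) (Dx k) = L2_inner (Dx f) (Dx h)"
    by (intro L2_inner_cong_AE piecewise_C1_ess_bounded Dx_cong(2) assms)
  ultimately show ?thesis by (simp add: a_form_def)
qed

lemma L2_inner_form_S_h:
  assumes "is_mesh m" shows "inner_form_on (S_h m) L2_inner"
proof -
  note e = piecewise_C1_ess_bounded(1)[OF S_h_piecewise_C1[OF assms]]
  have "(\<lambda>_. 0) \<in> S_h m" using S_h_sum[OF assms, of "{} :: nat set"] by simp
  moreover have "L2_inner (\<lambda>x. a * f x + b * g x) h = a * L2_inner f h + b * L2_inner g h"
    if "f \<in> S_h m" "g \<in> S_h m" "h \<in> S_h m" for f g h a b
    by (simp add: L2_inner_add_left L2_inner_cmult_left ess_bounded_cmult e that)
  ultimately show ?thesis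
    unfolding inner_form_on_def
    by (intro conjI ballI allI S_h_lincomb[OF assms] L2_inner_nonneg) (auto intro: L2_inner_commute)
qed

lemma a_form_inner_form_S_h:
  assumes "is_mesh m" shows "inner_form_on (S_h m) a_form"
proof -
  have "(\<lambda>_. 0) \<in> S_h m" using S_h_sum[OF assms, of "{} :: nat set"] by simp
  then show ?thesis
    unfolding inner_form_on_def
    by (intro conjI ballI allI S_h_lincomb[OF assms] a_form_nonneg a_form_lincomb S_h_piecewise_C1[OF assms])
      (auto intro: a_form_commute)
qed

lemma inner_form_on_subset:
  assumes "inner_form_on V B" "W \<subseteq> V" "(\<lambda>_. 0) \<in> W"
    "\<And>f g a b. f \<in> W \<Longrightarrow> g \<in> W \<Longrightarrow> (\<lambda>x. a * f x + b * g x) \<in> W"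
  shows "inner_form_on W B"
  using assms(2-) assms(1)[unfolded inner_form_on_def] unfolding inner_form_on_def
  by (intro conjI ballI allI) (blast dest: subsetD)+

lemma a_form_inner_form_S_h0:
  assumes "is_mesh m" shows "inner_form_on (S_h0 m) a_form"
proof (rule inner_form_on_subset[OF a_form_inner_form_S_h[OF assms]])
  show "(\<lambda>_. 0) \<in> S_h0 m" using S_h_sum[OF assms, of "{} :: nat set"] by (simp add: S_h0_def)
qed (use S_h0_lincomb[OF assms] S_h0_subset in blast)+

lemma S_h_continuous: "is_mesh m \<Longrightarrow> \<phi> \<in> S_h m \<Longrightarrow> continuous_on {0..1} \<phi>"
  by (rule piecewise_C1_continuous[OF S_h_piecewise_C1])

lemma S_h_orthonormal_basis:
  assumes "is_mesh m"
  shows "\<exists>n e. (\<forall>i<n. e i \<in> S_h m) \<and> orthonormal L2_inner e n \<and>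
    (\<forall>\<phi>\<in>S_h m. \<forall>x\<in>{0..1}. \<phi> x = (\<Sum>k<n. L2_inner \<phi> (e k) * e k x))"
proof (rule orthonormal_basis_exists[OF L2_inner_form_S_h[OF assms] _ _ finite_nodes[of m], of _ "hat m"])
  show "f x = 0" if "f \<in> S_h m" "L2_inner f f = 0" "x \<in> {0..1}" for f x
    using L2_definite[OF S_h_continuous[OF assms]] that by blast
  show "L2_inner f k = L2_inner g k" if "\<forall>x\<in>{0..1}. f x = g x" for f g k
    using that by (intro L2_inner_cong) auto
  show "hat m y \<in> S_h m" for y by (rule hat_in_S_h[OF assms])
  show "\<exists>a. \<forall>x\<in>{0..1}. f x = (\<Sum>y\<in>nodes m. a y * hat m y x)" if "f \<in> S_h m" for f
    using S_h_eq_interp[OF assms that] interp_eq_hat_sum[OF assms, of f] by auto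
qed

lemma S_h0_orthonormal_basis:
  assumes "is_mesh m"
  shows "\<exists>n e. (\<forall>i<n. e i \<in> S_h0 m) \<and> orthonormal a_form e n \<and>
    (\<forall>\<psi>\<in>S_h0 m. \<forall>x\<in>{0..1}. \<psi> x = (\<Sum>k<n. a_form \<psi> (e k) * e k x))"
proof (rule orthonormal_basis_exists[OF a_form_inner_form_S_h0[OF assms], of _ "nodes m - {0, 1}" "hat m"])
  show "f x = 0" if "f \<in> S_h0 m" "a_form f f = 0" "x \<in> {0..1}" for f x
  proof -
    have "L2_inner f f = 0"
      using that(2) L2_inner_nonneg[of f] L2_inner_nonneg[of "Dx f"] by (simp add: a_form_def)
    then show ?thesis using L2_definite[OF S_h_continuous[OF assms S_h0_subset]] that by blast
  qed
  show "a_form f k = a_form g k" if "g \<in> S_h0 m" "k \<in> S_h0 m" "\<forall>x\<in>{0..1}. f x = g x" for f g k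
    using that by (intro a_form_cong S_h_piecewise_C1[OF assms] S_h0_subset) auto
  show "finite (nodes m - {0, 1})" using finite_nodes by simp
  show "hat m y \<in> S_h0 m" if "y \<in> nodes m - {0, 1}" for y using that by (intro hat_in_S_h0[OF assms]) auto
  show "\<exists>a. \<forall>x\<in>{0..1}. f x = (\<Sum>y\<in>nodes m - {0, 1}. a y * hat m y x)" if "f \<in> S_h0 m" for f
    using S_h0_eq_hat_sum[OF assms that] by auto
qed

section \<open>Curves in the finite element spaces\<close>

lemma t_differentiable_has_derivative:
  assumes "t_differentiable T w" "t \<in> {0..T}" "x \<in> {0..1}"
  shows "((\<lambda>s. w s x) has_real_derivative dt T w t x) (at t within {0..T})"
  using assms unfolding t_differentiable_def dt_def
  by (simp add: has_real_derivative_iff_has_vector_derivative flip: vector_derivative_works)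

lemma has_derivative_imp_dt:
  assumes "0 < T" "t \<in> {0..T}" "((\<lambda>s. w s x) has_real_derivative D) (at t within {0..T})"
  shows "dt T w t x = D"
  using vector_derivative_within_cbox[of 0 T t "\<lambda>s. w s x" D] assms unfolding dt_def
  by (simp add: has_real_derivative_iff_has_vector_derivative)

lemma has_real_derivative_transform:
  fixes f g :: "real \<Rightarrow> real"
  assumes "t \<in> S" "\<And>s. s \<in> S \<Longrightarrow> g s = f s" "(f has_real_derivative D) (at t within S)"
  shows "(g has_real_derivative D) (at t within S)"
  using has_vector_derivative_transform[OF assms(1,2)] assms(3)
  by (simp add: has_real_derivative_iff_has_vector_derivative)

lemma t_differentiableI:
  assumes "\<And>t x. t \<in> {0..T} \<Longrightarrow> x \<in> {0..1} \<Longrightarrow> ((\<lambda>s. w s x) has_real_derivative w' t x) (at t within {0..T})"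
  shows "t_differentiable T w"
  unfolding t_differentiable_def
  using assms by (meson has_real_derivative_iff_has_vector_derivative differentiableI_vector)

lemma t_differentiable_diff:
  assumes "t_differentiable T v" "t_differentiable T w"
  shows "t_differentiable T (\<lambda>t x. v t x - w t x)"
    and "0 < T \<Longrightarrow> t \<in> {0..T} \<Longrightarrow> x \<in> {0..1} \<Longrightarrow> dt T (\<lambda>t x. v t x - w t x) t x = dt T v t x - dt T w t x"
proof -
  have d: "((\<lambda>s. v s x - w s x) has_real_derivative dt T v t x - dt T w t x) (at t within {0..T})"
    if "t \<in> {0..T}" "x \<in> {0..1}" for t x
    using that assms by (intro DERIV_diff t_differentiable_has_derivative)
  then show "t_differentiable T (\<lambda>t x. v t x - w t x)" by (rule t_differentiableI)
  show "dt T (\<lambda>t x. v t x - w t x) t x = dt T v t x - dt T w t x"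
    if "0 < T" "t \<in> {0..T}" "x \<in> {0..1}"
    by (rule has_derivative_imp_dt[OF that(1,2)]) (rule d[OF that(2,3)])
qed

lemma interp_curve:
  assumes m: "is_mesh m" and T: "0 < T" and w: "t_differentiable T w"
  shows "t_differentiable T (\<lambda>t. interp m (w t))"
    and "t \<in> {0..T} \<Longrightarrow> dt T (\<lambda>t. interp m (w t)) t x = interp m (dt T w t) x"
proof -
  have d: "((\<lambda>s. interp m (w s) x) has_real_derivative interp m (dt T w t) x) (at t within {0..T})"
    if t: "t \<in> {0..T}" for t x
    unfolding interp_eq_hat_sum[OF m]
    using nodes_subset[OF m] t
    by (intro DERIV_sum DERIV_cmult_right t_differentiable_has_derivative[OF w]) auto
  then show "t_differentiable T (\<lambda>t. interp m (w t))" by (intro t_differentiableI)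
  show "dt T (\<lambda>t. interp m (w t)) t x = interp m (dt T w t) x" if "t \<in> {0..T}"
    using has_derivative_imp_dt[OF T that d[OF that]] .
qed

text \<open>
  The time derivative of an identity between a function and its interpolant.
\<close>

lemma dt_in_S_h:
  assumes m: "is_mesh m" and T: "0 < T" and w: "t_differentiable T w"
    and wS: "\<And>t. t \<in> {0..T} \<Longrightarrow> w t \<in> S_h m" and t: "t \<in> {0..T}"
  shows "dt T w t \<in> S_h m"
proof -
  have "dt T w t x = interp m (dt T w t) x" if x: "x \<in> {0..1}" for x
  proof -
    have "((\<lambda>s. interp m (w s) x) has_real_derivative interp m (dt T w t) x) (at t within {0..T})"
      using t_differentiable_has_derivative[OF interp_curve(1)[OF m T w] t x]
        interp_curve(2)[OF m T w t] by simp
    from has_real_derivative_transform[OF t _ this, of "\<lambda>s. w s x"]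
    have "((\<lambda>s. w s x) has_real_derivative interp m (dt T w t) x) (at t within {0..T})"
      using S_h_eq_interp[OF m wS x] by blast
    then show ?thesis by (rule has_derivative_imp_dt[OF T t])
  qed
  then show ?thesis using S_h_iff[OF m] by blast
qed

lemma dt_in_S_h0:
  assumes m: "is_mesh m" and T: "0 < T" and w: "t_differentiable T w"
    and wS: "\<And>t. t \<in> {0..T} \<Longrightarrow> w t \<in> S_h0 m" and t: "t \<in> {0..T}"
  shows "dt T w t \<in> S_h0 m"
proof -
  have "dt T w t \<in> S_h m" using dt_in_S_h[OF m T w _ t] wS S_h0_subset by blast
  moreover have "dt T w t x = 0" if "x = 0 \<or> x = 1" for x
  proof (rule has_derivative_imp_dt[OF T t])
    show "((\<lambda>s. w s x) has_real_derivative 0) (at t within {0..T})"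
      by (rule has_real_derivative_transform[OF t, of _ "\<lambda>_. 0"])
        (use wS that in \<open>auto simp: S_h0_def\<close>)
  qed
  ultimately show ?thesis by (simp add: S_h0_def)
qed

text \<open>
  In the nodal basis the form is a finite double sum of products of nodal values, each of which is
  differentiable in time.
\<close>

lemma inner_form_curve_derivative:
  assumes m: "is_mesh m" and T: "0 < T" and B: "inner_form_on (S_h m) B"
    and cong: "\<And>f g h k. f \<in> S_h m \<Longrightarrow> h \<in> S_h m \<Longrightarrow> (\<And>x. x \<in> {0..1} \<Longrightarrow> g x = f x) \<Longrightarrow>
      (\<And>x. x \<in> {0..1} \<Longrightarrow> k x = h x) \<Longrightarrow> B g k = B f h"
    and w: "t_differentiable T w" "\<And>t. t \<in> {0..T} \<Longrightarrow> w t \<in> S_h m" and t: "t \<in> {0..T}"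
  shows "((\<lambda>t. B (w t) (w t)) has_real_derivative 2 * B (dt T w t) (w t)) (at t within {0..T})"
proof -
  note H = hat_in_S_h[OF m]
  have exp: "B f g = (\<Sum>y\<in>nodes m. \<Sum>z\<in>nodes m. f y * g z * B (hat m y) (hat m z))"
    if fg: "f \<in> S_h m" "g \<in> S_h m" for f g
  proof -
    have "interp m f = (\<lambda>x. \<Sum>y\<in>nodes m. f y * hat m y x)" for f
      using interp_eq_hat_sum[OF m] by blast
    then have "B f g = B (\<lambda>x. \<Sum>y\<in>nodes m. f y * hat m y x) (\<lambda>x. \<Sum>y\<in>nodes m. g y * hat m y x)"
      using cong[OF interp_in_S_h[OF m] interp_in_S_h[OF m], of f f g g] S_h_eq_interp[OF m] fg by simp
    also have "\<dots> = (\<Sum>y\<in>nodes m. f y * B (hat m y) (\<lambda>x. \<Sum>y\<in>nodes m. g y * hat m y x))"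
      by (rule inner_form_sum(2)[OF B finite_nodes H S_h_sum[OF m H]])
    also have "\<dots> = (\<Sum>y\<in>nodes m. f y * (\<Sum>z\<in>nodes m. g z * B (hat m z) (hat m y)))"
    proof (intro sum.cong refl)
      fix y
      have "B (hat m y) (\<lambda>x. \<Sum>y\<in>nodes m. g y * hat m y x) = B (\<lambda>x. \<Sum>y\<in>nodes m. g y * hat m y x) (hat m y)"
        by (rule inner_form_onD(2)[OF B H S_h_sum[OF m H]])
      then show "f y * B (hat m y) (\<lambda>x. \<Sum>y\<in>nodes m. g y * hat m y x) = f y * (\<Sum>z\<in>nodes m. g z * B (hat m z) (hat m y))"
        by (simp add: inner_form_sum(2)[OF B finite_nodes H H])
    qed
    finally show ?thesis
      using inner_form_onD(2)[OF B H H] by (simp add: sum_distrib_left mult.assoc)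
  qed
  have "((\<lambda>s. \<Sum>y\<in>nodes m. \<Sum>z\<in>nodes m. w s y * w s z * B (hat m y) (hat m z)) has_real_derivative
      (\<Sum>y\<in>nodes m. \<Sum>z\<in>nodes m. (dt T w t y * w t z + dt T w t z * w t y) * B (hat m y) (hat m z))) (at t within {0..T})"
    using nodes_subset[OF m] t
    by (intro DERIV_sum DERIV_cmult_right DERIV_mult t_differentiable_has_derivative[OF w(1)]) auto
  also have "(\<Sum>y\<in>nodes m. \<Sum>z\<in>nodes m. (dt T w t y * w t z + dt T w t z * w t y) * B (hat m y) (hat m z)) =
      B (dt T w t) (w t) + B (w t) (dt T w t)"
    using exp[OF dt_in_S_h[OF m T w(1,2) t] w(2)[OF t]] exp[OF w(2)[OF t] dt_in_S_h[OF m T w(1,2) t]]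
    by (simp add: distrib_right sum.distrib mult.commute[of "w t _" "dt T w t _"])
  also have "\<dots> = 2 * B (dt T w t) (w t)"
    using inner_form_onD(2)[OF B dt_in_S_h[OF m T w(1,2) t] w(2)[OF t]] by simp
  finally have "((\<lambda>s. \<Sum>y\<in>nodes m. \<Sum>z\<in>nodes m. w s y * w s z * B (hat m y) (hat m z)) has_real_derivative
      2 * B (dt T w t) (w t)) (at t within {0..T})" .
  from has_real_derivative_transform[OF t _ this, of "\<lambda>s. B (w s) (w s)"]
  show ?thesis using exp[OF w(2) w(2)] by blast
qed

section \<open>The energy estimate\<close>

text \<open>
  The system is \<open>\<eta>\<^sub>t + (flux1 \<alpha> \<eta> u)\<^sub>x = 0\<close>, \<open>u\<^sub>t - 1/3 u\<^sub>x\<^sub>x\<^sub>t + (flux2 \<beta> \<gamma> \<eta> u)\<^sub>x = 0\<close>. In this form all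
  nonlinear terms are derivatives of products.
\<close>

definition flux1 :: "real \<Rightarrow> (real \<Rightarrow> real) \<Rightarrow> (real \<Rightarrow> real) \<Rightarrow> real \<Rightarrow> real" where
  "flux1 \<alpha> \<eta> u x = u x + \<alpha> * (\<eta> x * u x)"

definition flux2 :: "real \<Rightarrow> real \<Rightarrow> (real \<Rightarrow> real) \<Rightarrow> (real \<Rightarrow> real) \<Rightarrow> real \<Rightarrow> real" where
  "flux2 \<beta> \<gamma> \<eta> u x = \<eta> x + (\<beta> / 2 * (u x * u x) + \<gamma> / 2 * (\<eta> x * \<eta> x))"

lemma Dx_flux1:
  assumes "piecewise_C1 \<eta>" "piecewise_C1 u"
  shows "piecewise_C1 (flux1 \<alpha> \<eta> u)"
    and "AE x in unit_measure. Dx (flux1 \<alpha> \<eta> u) x = Dx u x + \<alpha> * (Dx \<eta> x * u x + \<eta> x * Dx u x)"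
proof -
  note p = Dx_mult[OF assms]
  note q = Dx_cmult[OF p(1), of \<alpha>]
  note s = Dx_add[OF assms(2) q(1)]
  show "piecewise_C1 (flux1 \<alpha> \<eta> u)" using s(1) by (simp add: flux1_def[abs_def])
  show "AE x in unit_measure. Dx (flux1 \<alpha> \<eta> u) x = Dx u x + \<alpha> * (Dx \<eta> x * u x + \<eta> x * Dx u x)"
    using s(2) q(2) p(2) unfolding flux1_def[abs_def] by eventually_elim simp
qed

lemma Dx_flux2:
  assumes "piecewise_C1 \<eta>" "piecewise_C1 u"
  shows "piecewise_C1 (flux2 \<beta> \<gamma> \<eta> u)"
    and "AE x in unit_measure. Dx (flux2 \<beta> \<gamma> \<eta> u) x = Dx \<eta> x + \<beta> * (u x * Dx u x) + \<gamma> * (\<eta> x * Dx \<eta> x)"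
proof -
  note p = Dx_mult[OF assms(2) assms(2)] and p' = Dx_mult[OF assms(1) assms(1)]
  note q = Dx_cmult[OF p(1), of "\<beta> / 2"] and q' = Dx_cmult[OF p'(1), of "\<gamma> / 2"]
  note r = Dx_add[OF q(1) q'(1)]
  note s = Dx_add[OF assms(1) r(1)]
  show "piecewise_C1 (flux2 \<beta> \<gamma> \<eta> u)" using s(1) by (simp add: flux2_def[abs_def])
  show "AE x in unit_measure. Dx (flux2 \<beta> \<gamma> \<eta> u) x = Dx \<eta> x + \<beta> * (u x * Dx u x) + \<gamma> * (\<eta> x * Dx \<eta> x)"
    using s(2) r(2) q(2) p(2) q'(2) p'(2) unfolding flux2_def[abs_def]
    by eventually_elim (simp add: algebra_simps)
qed

text \<open>
  A convenient, not an optimal, constant for the estimate of the energy density below.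
\<close>

definition energy_rate :: "real \<Rightarrow> real \<Rightarrow> real \<Rightarrow> real \<Rightarrow> real" where
  "energy_rate \<alpha> \<beta> \<gamma> M = 2 * (1 + \<bar>\<alpha>\<bar> + \<bar>\<beta>\<bar> + \<bar>\<gamma>\<bar>) * (M + 1)"

lemma mult_le_half_squares: "\<bar>a * b\<bar> \<le> (a\<^sup>2 + b\<^sup>2) / 2" for a b :: real
proof -
  have "0 \<le> (\<bar>a\<bar> - \<bar>b\<bar>)\<^sup>2" by simp
  then show ?thesis by (simp add: power2_diff abs_mult)
qed

text \<open>
  Young's inequality, term by term. The bound on \<open>\<xi>x\<close> reduces the cubic terms to quadratic ones.
\<close>

lemma energy_density_bound:
  fixes \<alpha> \<beta> \<gamma> M c r1 r2 \<theta> \<xi> \<xi>x Z Zx U Ux :: real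
  assumes M: "\<bar>Z\<bar> \<le> M" "\<bar>Zx\<bar> \<le> M" "\<bar>U\<bar> \<le> M" "\<bar>Ux\<bar> \<le> M" and \<xi>: "\<bar>\<xi>x\<bar> \<le> 1"
    and r: "\<bar>r1\<bar> \<le> c" "\<bar>r2\<bar> \<le> c"
  shows "r1 * \<theta> + r2 * \<xi> - \<alpha> * (Zx * \<xi> + Z * \<xi>x) * \<theta> - \<alpha> / 2 * (\<theta>\<^sup>2 * (Ux - \<xi>x))
      - \<beta> * (Ux * \<xi> + U * \<xi>x - \<xi> * \<xi>x) * \<xi> + \<gamma> * (Z * \<theta> - \<theta>\<^sup>2 / 2) * \<xi>x
    \<le> c\<^sup>2 + energy_rate \<alpha> \<beta> \<gamma> M * (\<theta>\<^sup>2 + \<xi>\<^sup>2 + 1 / 3 * \<xi>x\<^sup>2)"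
proof -
  let ?a = "\<theta>\<^sup>2" and ?b = "\<xi>\<^sup>2" and ?d = "\<xi>x\<^sup>2"
  have M0: "0 \<le> M" using M(1) by linarith
  have nn: "0 \<le> M * ?a" "0 \<le> M * ?b" "0 \<le> M * ?d" "0 \<le> ?a" "0 \<le> ?b" "0 \<le> ?d"
    using M0 by auto
  have ex: "M * ((x + y) / 2) = (M * x + M * y) / 2" "(M + 1) * x = M * x + x"
    "M * (2 * x + 2 * y + 2 / 3 * z) = 2 * (M * x) + 2 * (M * y) + 2 / 3 * (M * z)" for x y z :: real
    by (simp_all add: field_simps)
  have lin: "(B + A) / 2 + (D + A) / 2 + 1 / 2 * (A + a) \<le> 2 * A + 2 * B + 2 / 3 * D + (2 * a + 2 * b + 2 / 3 * d)"
    "B + b + (D + B) / 2 \<le> 2 * A + 2 * B + 2 / 3 * D + (2 * a + 2 * b + 2 / 3 * d)"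
    "(A + D) / 2 + 1 / 2 * a \<le> 2 * A + 2 * B + 2 / 3 * D + (2 * a + 2 * b + 2 / 3 * d)"
    if "0 \<le> A" "0 \<le> B" "0 \<le> D" "0 \<le> a" "0 \<le> b" "0 \<le> d" for A B D a b d :: real
    using that by (auto simp: field_simps)
  have prod: "\<bar>k * (x * y)\<bar> \<le> K * ((x\<^sup>2 + y\<^sup>2) / 2)" if "\<bar>k\<bar> \<le> K" for k K x y :: real
    unfolding abs_mult[of k] using that mult_le_half_squares[of x y] by (intro mult_mono) auto
  have sq: "\<bar>k * x\<^sup>2\<bar> \<le> K * x\<^sup>2" if "\<bar>k\<bar> \<le> K" for k K x :: real
    using that by (simp add: abs_mult mult_right_mono)
  have res: "r * x \<le> (c\<^sup>2 + x\<^sup>2) / 2" if "\<bar>r\<bar> \<le> c" for r x :: real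
  proof -
    have "r\<^sup>2 \<le> c\<^sup>2" using that by (simp add: power2_le_iff_abs_le abs_le_square_iff order_trans[OF abs_ge_zero])
    have "r * x \<le> \<bar>r * x\<bar>" by simp
    also have "\<dots> \<le> (r\<^sup>2 + x\<^sup>2) / 2" by (rule mult_le_half_squares)
    also have "\<dots> \<le> (c\<^sup>2 + x\<^sup>2) / 2" using \<open>r\<^sup>2 \<le> c\<^sup>2\<close> by simp
    finally show ?thesis .
  qed
  have t1: "r1 * \<theta> \<le> (c\<^sup>2 + ?a) / 2" "r2 * \<xi> \<le> (c\<^sup>2 + ?b) / 2" using res r by auto
  have "\<bar>Zx * (\<xi> * \<theta>) + Z * (\<xi>x * \<theta>) + 1 / 2 * ((Ux - \<xi>x) * ?a)\<bar>
      \<le> M * ((?b + ?a) / 2) + M * ((?d + ?a) / 2) + 1 / 2 * ((M + 1) * ?a)"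
    using prod[OF M(2), of \<xi> \<theta>] prod[OF M(1), of \<xi>x \<theta>] sq[of "Ux - \<xi>x" "M + 1" \<theta>] M(4) \<xi> by linarith
  also have "\<dots> \<le> (M + 1) * (2 * ?a + 2 * ?b + 2 / 3 * ?d)"
    unfolding ex by (rule lin(1)[OF nn])
  finally have A: "\<bar>Zx * (\<xi> * \<theta>) + Z * (\<xi>x * \<theta>) + 1 / 2 * ((Ux - \<xi>x) * ?a)\<bar> \<le> (M + 1) * (2 * ?a + 2 * ?b + 2 / 3 * ?d)" .
  have "\<bar>(Ux - \<xi>x) * ?b + U * (\<xi>x * \<xi>)\<bar> \<le> (M + 1) * ?b + M * ((?d + ?b) / 2)"
    using sq[of "Ux - \<xi>x" "M + 1" \<xi>] prod[OF M(3), of \<xi>x \<xi>] M(4) \<xi> by linarith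
  also have "\<dots> \<le> (M + 1) * (2 * ?a + 2 * ?b + 2 / 3 * ?d)"
    unfolding ex by (rule lin(2)[OF nn])
  finally have Bd: "\<bar>(Ux - \<xi>x) * ?b + U * (\<xi>x * \<xi>)\<bar> \<le> (M + 1) * (2 * ?a + 2 * ?b + 2 / 3 * ?d)" .
  have "\<bar>Z * (\<theta> * \<xi>x) - 1 / 2 * (\<xi>x * ?a)\<bar> \<le> M * ((?a + ?d) / 2) + 1 / 2 * (1 * ?a)"
    using prod[OF M(1), of \<theta> \<xi>x] sq[OF \<xi>, of \<theta>] by linarith
  also have "\<dots> \<le> (M + 1) * (2 * ?a + 2 * ?b + 2 / 3 * ?d)"
    unfolding ex mult_1 by (rule lin(3)[OF nn])
  finally have Cd: "\<bar>Z * (\<theta> * \<xi>x) - 1 / 2 * (\<xi>x * ?a)\<bar> \<le> (M + 1) * (2 * ?a + 2 * ?b + 2 / 3 * ?d)" .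
  define S where "S = (M + 1) * (2 * ?a + 2 * ?b + 2 / 3 * ?d)"
  have le: "k * x \<le> \<bar>k\<bar> * S" if "\<bar>x\<bar> \<le> S" for k x
  proof -
    have "k * x \<le> \<bar>k\<bar> * \<bar>x\<bar>" by (metis abs_ge_self abs_mult)
    also have "\<dots> \<le> \<bar>k\<bar> * S" using that by (intro mult_left_mono) auto
    finally show ?thesis .
  qed
  have "0 \<le> M * (2 * ?a + 2 * ?b + 2 / 3 * ?d)" using M0 by (intro mult_nonneg_nonneg) auto
  then have half: "(?a + ?b) / 2 \<le> S" unfolding S_def by (simp add: distrib_right)
  have comb: "p + q + x + y + z \<le> k + (S + X + Y + W)"
    if "p \<le> (k + ?a) / 2" "q \<le> (k + ?b) / 2" "x \<le> X" "y \<le> Y" "z \<le> W" for p q x y z k X Y W :: real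
    using that half by (simp add: field_simps)
  have "r1 * \<theta> + r2 * \<xi> + - \<alpha> * (Zx * (\<xi> * \<theta>) + Z * (\<xi>x * \<theta>) + 1 / 2 * ((Ux - \<xi>x) * ?a))
      + - \<beta> * ((Ux - \<xi>x) * ?b + U * (\<xi>x * \<xi>)) + \<gamma> * (Z * (\<theta> * \<xi>x) - 1 / 2 * (\<xi>x * ?a))
    \<le> c\<^sup>2 + (S + \<bar>\<alpha>\<bar> * S + \<bar>\<beta>\<bar> * S + \<bar>\<gamma>\<bar> * S)"
    by (rule comb[OF t1 le[OF A[folded S_def], of "- \<alpha>", unfolded abs_minus_cancel]
        le[OF Bd[folded S_def], of "- \<beta>", unfolded abs_minus_cancel] le[OF Cd[folded S_def], of \<gamma>]])
  moreover have "S + \<bar>\<alpha>\<bar> * S + \<bar>\<beta>\<bar> * S + \<bar>\<gamma>\<bar> * S = energy_rate \<alpha> \<beta> \<gamma> M * (\<theta>\<^sup>2 + \<xi>\<^sup>2 + 1 / 3 * \<xi>x\<^sup>2)"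
    unfolding energy_rate_def S_def by (simp add: algebra_simps add_divide_distrib)
  ultimately show ?thesis by (simp add: algebra_simps power2_eq_square)
qed

text \<open>
  Write \<open>W = U - \<xi>\<close> for \<open>u\<close>. The terms with a derivative of \<open>\<theta>\<close> are
  \<open>(\<theta> W)\<^sub>x \<theta> = 1/2 (\<theta>\<^sup>2 W)\<^sub>x + 1/2 \<theta>\<^sup>2 W\<^sub>x\<close>, \<open>\<theta>\<^sub>x \<xi> = (\<theta> \<xi>)\<^sub>x - \<theta> \<xi>\<^sub>x\<close> and
  \<open>(Z \<theta> - \<theta>\<^sup>2/2)\<^sub>x \<xi> = ((Z \<theta> - \<theta>\<^sup>2/2) \<xi>)\<^sub>x - (Z \<theta> - \<theta>\<^sup>2/2) \<xi>\<^sub>x\<close>. The complete derivatives integrate to \<open>0\<close>, the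
  remaining \<open>\<theta> \<xi>\<^sub>x\<close> cancels against the term \<open>\<xi>\<^sub>x \<theta>\<close> of the other equation, and the rest is estimated
  pointwise.
\<close>

lemma energy_production_bound:
  assumes pw: "piecewise_C1 Z" "piecewise_C1 U" "piecewise_C1 \<eta>" "piecewise_C1 u"
    and bc: "U 0 = 0" "U 1 = 0" "u 0 = 0" "u 1 = 0"
    and r: "ess_bounded r1" "ess_bounded r2"
    and rb: "AE x in unit_measure. \<bar>r1 x\<bar> \<le> c" "AE x in unit_measure. \<bar>r2 x\<bar> \<le> c"
    and M: "AE x in unit_measure. \<bar>Z x\<bar> \<le> M" "AE x in unit_measure. \<bar>Dx Z x\<bar> \<le> M"
      "AE x in unit_measure. \<bar>U x\<bar> \<le> M" "AE x in unit_measure. \<bar>Dx U x\<bar> \<le> M"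
    and \<theta>_def: "\<theta> = (\<lambda>x. Z x - \<eta> x)" and \<xi>_def: "\<xi> = (\<lambda>x. U x - u x)"
    and \<xi>x: "AE x in unit_measure. \<bar>Dx \<xi> x\<bar> \<le> 1"
  shows "(L2_inner r1 \<theta> - L2_inner (Dx (flux1 \<alpha> Z U)) \<theta> + L2_inner (Dx (flux1 \<alpha> \<eta> u)) \<theta>) +
      (L2_inner r2 \<xi> - L2_inner (Dx (flux2 \<beta> \<gamma> Z U)) \<xi> + L2_inner (Dx (flux2 \<beta> \<gamma> \<eta> u)) \<xi>)
    \<le> c\<^sup>2 + energy_rate \<alpha> \<beta> \<gamma> M * (L2_inner \<theta> \<theta> + a_form \<xi> \<xi>)"
proof -
  note e = piecewise_C1_ess_bounded
  note \<theta> = Dx_diff[OF pw(1,3), folded \<theta>_def] and \<xi> = Dx_diff[OF pw(2,4), folded \<xi>_def]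
  note F = Dx_flux1[OF pw(1,2), of \<alpha>] and f = Dx_flux1[OF pw(3,4), of \<alpha>]
  note G = Dx_flux2[OF pw(1,2), of \<beta> \<gamma>] and g = Dx_flux2[OF pw(3,4), of \<beta> \<gamma>]
  note p1 = Dx_mult[OF \<theta>(1) \<xi>(1)] and p2 = Dx_mult[OF \<theta>(1) \<theta>(1)]
  note p3 = Dx_mult[OF p2(1) pw(4)] and p4 = Dx_mult[OF pw(1) \<theta>(1)]
  note p5 = Dx_add[OF p4(1) Dx_cmult(1)[OF p2(1), of "- 1 / 2"]] and c2 = Dx_cmult(2)[OF p2(1), of "- 1 / 2"]
  note p6 = Dx_mult[OF p5(1) \<xi>(1)]
  note q1 = Dx_cmult[OF p1(1), of "- 1"] and q3 = Dx_cmult[OF p3(1), of "- \<alpha> / 2"] and q6 = Dx_cmult[OF p6(1), of "- \<gamma>"]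
  note s1 = Dx_add[OF q1(1) q3(1)]
  note s2 = Dx_add[OF s1(1) q6(1)]
  \<comment> \<open>The function whose derivative collects all complete derivatives; each summand has a factor \<open>\<xi>\<close> or
    \<open>u\<close> and so vanishes at both ends.\<close>
  define H where "H = (\<lambda>x. - 1 * (\<theta> x * \<xi> x) + - \<alpha> / 2 * (\<theta> x * \<theta> x * u x) +
      - \<gamma> * ((Z x * \<theta> x + - 1 / 2 * (\<theta> x * \<theta> x)) * \<xi> x))"
  have Hpw: "piecewise_C1 H" using s2(1) by (simp add: H_def)
  have DH: "AE x in unit_measure. Dx H x =
      - (Dx \<theta> x * \<xi> x + \<theta> x * Dx \<xi> x) - \<alpha> / 2 * (2 * \<theta> x * Dx \<theta> x * u x + \<theta> x * \<theta> x * Dx u x)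
      - \<gamma> * ((Dx Z x * \<theta> x + Z x * Dx \<theta> x - \<theta> x * Dx \<theta> x) * \<xi> x + (Z x * \<theta> x - \<theta> x * \<theta> x / 2) * Dx \<xi> x)"
    using s2(2) s1(2) q1(2) q3(2) q6(2) p1(2) p2(2) p3(2) p4(2) p5(2) p6(2) c2 unfolding H_def
  proof eventually_elim
    case (elim x)
    show ?case by (simp only: elim) (simp add: field_simps)
  qed
  have H0: "(LINT x|unit_measure. Dx H x) = 0"
    using integral_Dx[OF Hpw] bc by (simp add: H_def \<xi>_def)
  define I where "I x = r1 x * \<theta> x - Dx (flux1 \<alpha> Z U) x * \<theta> x + Dx (flux1 \<alpha> \<eta> u) x * \<theta> x +
    (r2 x * \<xi> x - Dx (flux2 \<beta> \<gamma> Z U) x * \<xi> x + Dx (flux2 \<beta> \<gamma> \<eta> u) x * \<xi> x)" for x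
  define W where "W x = c\<^sup>2 + energy_rate \<alpha> \<beta> \<gamma> M * (\<theta> x * \<theta> x + \<xi> x * \<xi> x + 1 / 3 * (Dx \<xi> x * Dx \<xi> x))" for x
  note eb = e[OF \<theta>(1)] e[OF \<xi>(1)] e[OF F(1)] e[OF f(1)] e[OF G(1)] e[OF g(1)] e[OF Hpw] r
  have Ieb: "ess_bounded I" unfolding I_def by (intro ess_bounded_intros eb)
  have Web: "ess_bounded W" unfolding W_def by (intro ess_bounded_intros eb)
  have "AE x in unit_measure. I x \<le> Dx H x + W x"
    using rb M \<xi>x \<theta>(2) \<xi>(2) F(2) f(2) G(2) g(2) DH
  proof eventually_elim
    case (elim x)
    have \<eta>: "\<eta> x = Z x - \<theta> x" "Dx \<eta> x = Dx Z x - Dx \<theta> x" and u: "u x = U x - \<xi> x" "Dx u x = Dx U x - Dx \<xi> x"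
      using elim by (auto simp: \<theta>_def \<xi>_def)
    have "I x - Dx H x = r1 x * \<theta> x + r2 x * \<xi> x - \<alpha> * (Dx Z x * \<xi> x + Z x * Dx \<xi> x) * \<theta> x
        - \<alpha> / 2 * ((\<theta> x)\<^sup>2 * (Dx U x - Dx \<xi> x))
        - \<beta> * (Dx U x * \<xi> x + U x * Dx \<xi> x - \<xi> x * Dx \<xi> x) * \<xi> x + \<gamma> * (Z x * \<theta> x - (\<theta> x)\<^sup>2 / 2) * Dx \<xi> x"
      unfolding I_def elim(10-14) \<eta> u by (simp add: field_simps power2_eq_square)
    also have "\<dots> \<le> W x"
      unfolding W_def
      using energy_density_bound[of "Z x" M "Dx Z x" "U x" "Dx U x" "Dx \<xi> x" "r1 x" c "r2 x" "\<theta> x" "\<xi> x" \<alpha> \<beta> \<gamma>] elim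
      by (simp add: power2_eq_square)
    finally show ?case by simp
  qed
  then have "(LINT x|unit_measure. I x) \<le> (LINT x|unit_measure. Dx H x + W x)"
    by (intro integral_unit_mono Ieb ess_bounded_add eb Web)
  also have "\<dots> = (LINT x|unit_measure. W x)"
    using H0 by (simp add: ess_bounded_integrable eb Web)
  also have "\<dots> = c\<^sup>2 + energy_rate \<alpha> \<beta> \<gamma> M * (L2_inner \<theta> \<theta> + a_form \<xi> \<xi>)"
    unfolding W_def a_form_def L2_inner_def using emeasure_unit_measure_space
    by (simp add: ess_bounded_integrable ess_bounded_intros eb)
  finally show ?thesis
    unfolding I_def L2_inner_def
    by (simp add: ess_bounded_integrable ess_bounded_intros eb)
qed

section \<open>Stability of the semidiscrete problem\<close>

definition fe_curves :: "real \<Rightarrow> mesh \<Rightarrow> (real \<Rightarrow> real \<Rightarrow> real) \<Rightarrow> (real \<Rightarrow> real \<Rightarrow> real) \<Rightarrow> bool" where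
  "fe_curves T m \<eta> u \<longleftrightarrow>
    (\<forall>t\<in>{0..T}. \<eta> t \<in> S_h m \<and> u t \<in> S_h0 m) \<and> t_differentiable T \<eta> \<and> t_differentiable T u"

text \<open>
  The Galerkin equations at time \<open>t\<close> with right-hand sides \<open>r1\<close>, \<open>r2\<close>: zero for the discrete solution,
  the residuals for the interpolants.
\<close>

definition galerkin ::
  "real \<Rightarrow> mesh \<Rightarrow> real \<Rightarrow> real \<Rightarrow> real \<Rightarrow> (real \<Rightarrow> real) \<Rightarrow> (real \<Rightarrow> real) \<Rightarrow>
    (real \<Rightarrow> real \<Rightarrow> real) \<Rightarrow> (real \<Rightarrow> real \<Rightarrow> real) \<Rightarrow> real \<Rightarrow> bool" where
  "galerkin T m \<alpha> \<beta> \<gamma> r1 r2 \<eta> u t \<longleftrightarrow>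
    (\<forall>\<phi>\<in>S_h m. L2_inner (dt T \<eta> t) \<phi> + L2_inner (Dx (flux1 \<alpha> (\<eta> t) (u t))) \<phi> = L2_inner r1 \<phi>) \<and>
    (\<forall>\<psi>\<in>S_h0 m. a_form (dt T u t) \<psi> + L2_inner (Dx (flux2 \<beta> \<gamma> (\<eta> t) (u t))) \<psi> = L2_inner r2 \<psi>)"

definition W1inf_bound :: "real \<Rightarrow> (real \<Rightarrow> real) \<Rightarrow> bool" where
  "W1inf_bound M f \<longleftrightarrow> (AE x in unit_measure. \<bar>f x\<bar> \<le> M) \<and> (AE x in unit_measure. \<bar>Dx f x\<bar> \<le> M)"

definition energy :: "(real \<Rightarrow> real) \<Rightarrow> (real \<Rightarrow> real) \<Rightarrow> real" where
  "energy \<theta> \<xi> = L2_inner \<theta> \<theta> + a_form \<xi> \<xi>"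

definition error_energy ::
  "(real \<Rightarrow> real \<Rightarrow> real) \<Rightarrow> (real \<Rightarrow> real \<Rightarrow> real) \<Rightarrow> (real \<Rightarrow> real \<Rightarrow> real) \<Rightarrow> (real \<Rightarrow> real \<Rightarrow> real) \<Rightarrow> real \<Rightarrow> real" where
  "error_energy Z U \<eta> u t = energy (\<lambda>x. Z t x - \<eta> t x) (\<lambda>x. U t x - u t x)"

lemma L2_inner_zero_left: "L2_inner (\<lambda>_. 0) h = 0"
  by (simp add: L2_inner_def)

lemma galerkinD:
  assumes "galerkin T m \<alpha> \<beta> \<gamma> r1 r2 \<eta> u t"
  shows "\<phi> \<in> S_h m \<Longrightarrow> L2_inner (dt T \<eta> t) \<phi> = L2_inner r1 \<phi> - L2_inner (Dx (flux1 \<alpha> (\<eta> t) (u t))) \<phi>"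
    and "\<psi> \<in> S_h0 m \<Longrightarrow> a_form (dt T u t) \<psi> = L2_inner r2 \<psi> - L2_inner (Dx (flux2 \<beta> \<gamma> (\<eta> t) (u t))) \<psi>"
  using assms unfolding galerkin_def by (auto simp: eq_diff_eq)

lemma energy_nonneg: "0 \<le> energy \<theta> \<xi>"
  by (simp add: energy_def L2_inner_nonneg a_form_nonneg)

lemma energy_rate_ge_1: "0 \<le> M \<Longrightarrow> 1 \<le> energy_rate \<alpha> \<beta> \<gamma> M"
proof -
  assume M: "0 \<le> M"
  have "1 * 1 \<le> (1 + \<bar>\<alpha>\<bar> + \<bar>\<beta>\<bar> + \<bar>\<gamma>\<bar>) * (M + 1)" using M by (intro mult_mono) auto
  moreover have "energy_rate \<alpha> \<beta> \<gamma> M = 2 * ((1 + \<bar>\<alpha>\<bar> + \<bar>\<beta>\<bar> + \<bar>\<gamma>\<bar>) * (M + 1))"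
    by (simp add: energy_rate_def)
  ultimately show ?thesis by linarith
qed

text \<open>
  The energy contains \<open>1/3 \<parallel>\<xi>\<^sub>x\<parallel>\<^sup>2\<close>, so \<open>\<parallel>\<xi>\<^sub>x\<parallel>\<^sup>2\<close> is at most the smallest mesh width; the inverse estimate
  makes this a pointwise bound.
\<close>

lemma small_energy_Dx_bound:
  assumes m: "is_mesh m" and \<xi>: "\<xi> \<in> S_h m" and E: "energy \<theta> \<xi> \<le> min_mesh_size m / 3"
  shows "AE x in unit_measure. \<bar>Dx \<xi> x\<bar> \<le> 1"
proof -
  note ae = Dx_AE_piecewise_deriv[OF S_h_piecewise_deriv[OF m \<xi>]]
  have pos: "0 < min_mesh_size m" by (rule min_mesh_size_pos[OF m])
  have "1 / 3 * L2_inner (Dx \<xi>) (Dx \<xi>) \<le> min_mesh_size m / 3"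
    using E L2_inner_nonneg[of \<theta>] L2_inner_nonneg[of \<xi>] unfolding energy_def a_form_def by linarith
  moreover have "L2_inner (Dx \<xi>) (Dx \<xi>) = L2_inner (interp_deriv m \<xi>) (interp_deriv m \<xi>)"
    by (intro L2_inner_cong_AE interp_deriv_ess_bounded m ae)
  ultimately have le: "L2_inner (interp_deriv m \<xi>) (interp_deriv m \<xi>) \<le> min_mesh_size m" by simp
  have "\<bar>interp_deriv m \<xi> x\<bar> \<le> 1" if "x \<in> {0<..<1} - nodes m" for x
  proof -
    have "(interp_deriv m \<xi> x)\<^sup>2 * min_mesh_size m \<le> 1 * min_mesh_size m"
      using interp_deriv_inverse_estimate[OF m that, of \<xi>] le by simp
    then have "(interp_deriv m \<xi> x)\<^sup>2 \<le> 1" using pos by simp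
    then show ?thesis by (simp add: abs_square_le_1)
  qed
  then have "AE x in unit_measure. \<bar>interp_deriv m \<xi> x\<bar> \<le> 1"
    by (intro AE_unit_measure_finite_exception[OF finite_nodes])
  with ae show ?thesis by eventually_elim simp
qed

lemma a_form_curve_derivative:
  assumes "is_mesh m" "0 < T" "t_differentiable T w" "\<And>t. t \<in> {0..T} \<Longrightarrow> w t \<in> S_h m" "t \<in> {0..T}"
  shows "((\<lambda>t. a_form (w t) (w t)) has_real_derivative 2 * a_form (dt T w t) (w t)) (at t within {0..T})"
  using assms(1) by (intro inner_form_curve_derivative[OF assms(1,2) a_form_inner_form_S_h _ assms(3-5)]
      a_form_cong S_h_piecewise_C1) auto

lemma L2_inner_curve_derivative:
  assumes "is_mesh m" "0 < T" "t_differentiable T w" "\<And>t. t \<in> {0..T} \<Longrightarrow> w t \<in> S_h m" "t \<in> {0..T}"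
  shows "((\<lambda>t. L2_inner (w t) (w t)) has_real_derivative 2 * L2_inner (dt T w t) (w t)) (at t within {0..T})"
  using assms(1) by (intro inner_form_curve_derivative[OF assms(1,2) L2_inner_form_S_h _ assms(3-5)]
      L2_inner_cong) auto

text \<open>
  The discrete equations for \<open>(\<eta>, u)\<close> are assumed only at times of small error energy. So the lemma
  applies to a solution of the truncated equation, and it also shows that this energy stays small.
\<close>

lemma stability:
  assumes m: "is_mesh m" and T: "0 < T" and ZU: "fe_curves T m Z U" and hu: "fe_curves T m \<eta> u"
    and M: "\<And>t. t \<in> {0..T} \<Longrightarrow> W1inf_bound M (Z t) \<and> W1inf_bound M (U t)" "0 \<le> M"
    and res: "\<And>t. t \<in> {0..T} \<Longrightarrow> galerkin T m \<alpha> \<beta> \<gamma> (r1 t) (r2 t) Z U t"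
    and r: "\<And>t. t \<in> {0..T} \<Longrightarrow> ess_bounded (r1 t) \<and> ess_bounded (r2 t)"
    and rb: "\<And>t. t \<in> {0..T} \<Longrightarrow> (AE x in unit_measure. \<bar>r1 t x\<bar> \<le> c) \<and> (AE x in unit_measure. \<bar>r2 t x\<bar> \<le> c)"
    and eq: "\<And>t. t \<in> {0..T} \<Longrightarrow> error_energy Z U \<eta> u t \<le> min_mesh_size m / 3 \<Longrightarrow>
      galerkin T m \<alpha> \<beta> \<gamma> (\<lambda>_. 0) (\<lambda>_. 0) \<eta> u t"
    and small: "(error_energy Z U \<eta> u 0 + c\<^sup>2) * exp (2 * energy_rate \<alpha> \<beta> \<gamma> M * T) < min_mesh_size m / 3"
    and t: "t \<in> {0..T}"
  shows "error_energy Z U \<eta> u t + c\<^sup>2 \<le>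
      (error_energy Z U \<eta> u 0 + c\<^sup>2) * exp (2 * energy_rate \<alpha> \<beta> \<gamma> M * t)" (is ?thesis1)
    and "error_energy Z U \<eta> u t < min_mesh_size m / 3" (is ?thesis2)
proof -
  define \<theta> where "\<theta> = (\<lambda>t x. Z t x - \<eta> t x)"
  define \<xi> where "\<xi> = (\<lambda>t x. U t x - u t x)"
  let ?\<kappa> = "energy_rate \<alpha> \<beta> \<gamma> M"
  note \<kappa> = energy_rate_ge_1[OF M(2), of \<alpha> \<beta> \<gamma>]
  have S: "Z t \<in> S_h m" "\<eta> t \<in> S_h m" "U t \<in> S_h0 m" "u t \<in> S_h0 m" if "t \<in> {0..T}" for t
    using ZU hu that by (auto simp: fe_curves_def)
  have tdif: "t_differentiable T Z" "t_differentiable T U" "t_differentiable T \<eta>" "t_differentiable T u"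
    using ZU hu by (auto simp: fe_curves_def)
  have \<theta>S: "\<theta> t \<in> S_h m" and \<xi>S: "\<xi> t \<in> S_h0 m" if "t \<in> {0..T}" for t
    using S_h_lincomb[OF m S(1,2)[OF that], of 1 "-1"] S_h0_lincomb[OF m S(3,4)[OF that], of 1 "-1"]
    by (auto simp: \<theta>_def \<xi>_def)
  have td: "t_differentiable T \<theta>" "t_differentiable T \<xi>"
    unfolding \<theta>_def \<xi>_def by (intro t_differentiable_diff tdif)+
  have E: "error_energy Z U \<eta> u = (\<lambda>t. L2_inner (\<theta> t) (\<theta> t) + a_form (\<xi> t) (\<xi> t))"
    by (auto simp: error_energy_def energy_def \<theta>_def \<xi>_def)
  define E' where "E' t = 2 * L2_inner (dt T \<theta> t) (\<theta> t) + 2 * a_form (dt T \<xi> t) (\<xi> t)" for t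
  have deriv: "(error_energy Z U \<eta> u has_real_derivative E' t) (at t within {0..T})" if "t \<in> {0..T}" for t
    unfolding E E'_def
    using \<theta>S S_h0_subset[OF \<xi>S] that
    by (intro DERIV_add L2_inner_curve_derivative[OF m T td(1)] a_form_curve_derivative[OF m T td(2)]) auto
  have ineq: "E' t \<le> (2 * ?\<kappa>) * (error_energy Z U \<eta> u t + c\<^sup>2)"
    if t: "t \<in> {0..T}" and small: "error_energy Z U \<eta> u t \<le> min_mesh_size m / 3" for t
  proof -
    note pw = S_h_piecewise_C1[OF m]
    note dS = dt_in_S_h[OF m T tdif(1) S(1) t] dt_in_S_h[OF m T tdif(3) S(2) t]
    note dS0 = dt_in_S_h0[OF m T tdif(2) S(3) t] dt_in_S_h0[OF m T tdif(4) S(4) t]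
    note e = piecewise_C1_ess_bounded(1)[OF pw]
    have 1: "L2_inner (dt T \<theta> t) (\<theta> t) =
        L2_inner (r1 t) (\<theta> t) - L2_inner (Dx (flux1 \<alpha> (Z t) (U t))) (\<theta> t) + L2_inner (Dx (flux1 \<alpha> (\<eta> t) (u t))) (\<theta> t)"
    proof -
      have "L2_inner (dt T \<theta> t) (\<theta> t) = L2_inner (\<lambda>x. dt T Z t x - dt T \<eta> t x) (\<theta> t)"
        unfolding \<theta>_def using t_differentiable_diff(2)[OF tdif(1,3) T t] by (intro L2_inner_cong) auto
      also have "\<dots> = L2_inner (dt T Z t) (\<theta> t) - L2_inner (dt T \<eta> t) (\<theta> t)"
        by (intro L2_inner_diff_left e dS \<theta>S t)
      finally show ?thesis
        using galerkinD(1)[OF res[OF t] \<theta>S[OF t]] galerkinD(1)[OF eq[OF t small] \<theta>S[OF t]]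
        by (simp add: L2_inner_zero_left)
    qed
    have 2: "a_form (dt T \<xi> t) (\<xi> t) =
        L2_inner (r2 t) (\<xi> t) - L2_inner (Dx (flux2 \<beta> \<gamma> (Z t) (U t))) (\<xi> t) + L2_inner (Dx (flux2 \<beta> \<gamma> (\<eta> t) (u t))) (\<xi> t)"
    proof -
      have "a_form (dt T \<xi> t) (\<xi> t) = a_form (\<lambda>x. 1 * dt T U t x + (- 1) * dt T u t x) (\<xi> t)"
        unfolding \<xi>_def using t_differentiable_diff(2)[OF tdif(2,4) T t]
        by (intro a_form_cong pw S_h_lincomb[OF m] S_h0_subset[OF dS0(1)] S_h0_subset[OF dS0(2)]
            S_h0_subset[OF \<xi>S[OF t, unfolded \<xi>_def]]) auto
      also have "\<dots> = a_form (dt T U t) (\<xi> t) - a_form (dt T u t) (\<xi> t)"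
        by (subst a_form_lincomb) (auto intro!: pw S_h0_subset dS0 \<xi>S t)
      finally show ?thesis
        using galerkinD(2)[OF res[OF t] \<xi>S[OF t]] galerkinD(2)[OF eq[OF t small] \<xi>S[OF t]]
        by (simp add: L2_inner_zero_left)
    qed
    have b: "AE x in unit_measure. \<bar>Dx (\<xi> t) x\<bar> \<le> 1"
      using small unfolding error_energy_def \<xi>_def
      by (intro small_energy_Dx_bound[OF m _ small[unfolded error_energy_def]])
        (use S_h0_subset[OF \<xi>S[OF t]] in \<open>simp add: \<xi>_def\<close>)
    have "L2_inner (dt T \<theta> t) (\<theta> t) + a_form (dt T \<xi> t) (\<xi> t) \<le>
        c\<^sup>2 + ?\<kappa> * (L2_inner (\<theta> t) (\<theta> t) + a_form (\<xi> t) (\<xi> t))"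
      unfolding 1 2
      using M(1)[OF t] r[OF t] rb[OF t] S(3,4)[OF t] b
      by (intro energy_production_bound[of "Z t" "U t" "\<eta> t" "u t"] pw S_h0_subset S t)
        (auto simp: S_h0_def W1inf_bound_def \<theta>_def \<xi>_def)
    moreover have "c\<^sup>2 \<le> ?\<kappa> * c\<^sup>2" using \<kappa> mult_right_mono[of 1 ?\<kappa> "c\<^sup>2"] by simp
    ultimately show ?thesis unfolding E E'_def by (simp add: algebra_simps)
  qed
  have small': "(error_energy Z U \<eta> u 0 + c\<^sup>2) * exp (2 * ?\<kappa> * T) < min_mesh_size m / 3" using small .
  have K: "0 \<le> 2 * ?\<kappa>" using \<kappa> by simp
  have E0: "0 \<le> error_energy Z U \<eta> u 0" unfolding error_energy_def by (rule energy_nonneg)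
  show ?thesis1 ?thesis2
    using Gronwall_continuation[of T "error_energy Z U \<eta> u" E' "2 * ?\<kappa>" "c\<^sup>2" "min_mesh_size m / 3", OF deriv K _ E0 ineq small' t]
    by auto
qed

subsection \<open>Uniqueness\<close>

text \<open>
  Nodal values are continuous on the compact interval \<open>[0,T]\<close>; the constant depends on the mesh.
\<close>

lemma fe_curve_W1inf_bounded:
  assumes m: "is_mesh m" and w: "t_differentiable T w" "\<And>t. t \<in> {0..T} \<Longrightarrow> w t \<in> S_h m"
  shows "\<exists>M\<ge>0. \<forall>t\<in>{0..T}. W1inf_bound M (w t)"
proof -
  have "\<exists>B. \<forall>t\<in>{0..T}. \<bar>w t y\<bar> \<le> B" if y: "y \<in> nodes m" for y
  proof -
    have "y \<in> {0..1}" using nodes_subset[OF m] y by auto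
    then have "continuous_on {0..T} (\<lambda>t. w t y)"
      using t_differentiable_has_derivative[OF w(1)] by (intro DERIV_continuous_on)
    then have "bounded ((\<lambda>t. w t y) ` {0..T})"
      by (intro compact_imp_bounded compact_continuous_image) auto
    then show ?thesis unfolding bounded_iff by (metis imageI real_norm_def)
  qed
  then obtain B where B: "\<And>t y. y \<in> nodes m \<Longrightarrow> t \<in> {0..T} \<Longrightarrow> \<bar>w t y\<bar> \<le> B y" by metis
  have pw: "piecewise_C1 (hat m y)" for y by (rule S_h_piecewise_C1[OF m hat_in_S_h[OF m]])
  have "\<exists>H. (AE x in unit_measure. \<bar>hat m y x\<bar> \<le> H) \<and> (AE x in unit_measure. \<bar>Dx (hat m y) x\<bar> \<le> H)" for y
  proof -
    obtain H1 H2 where "AE x in unit_measure. \<bar>hat m y x\<bar> \<le> H1" "AE x in unit_measure. \<bar>Dx (hat m y) x\<bar> \<le> H2"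
      using piecewise_C1_ess_bounded[OF pw[of y]] unfolding ess_bounded_def by blast
    then have "AE x in unit_measure. \<bar>hat m y x\<bar> \<le> max H1 H2" "AE x in unit_measure. \<bar>Dx (hat m y) x\<bar> \<le> max H1 H2"
      by (auto elim: eventually_mono)
    then show ?thesis by blast
  qed
  then obtain H where H: "\<And>y. AE x in unit_measure. \<bar>hat m y x\<bar> \<le> H y"
    "\<And>y. AE x in unit_measure. \<bar>Dx (hat m y) x\<bar> \<le> H y" by metis
  have H1: "AE x in unit_measure. \<forall>y\<in>nodes m. \<bar>hat m y x\<bar> \<le> H y"
    and H2: "AE x in unit_measure. \<forall>y\<in>nodes m. \<bar>Dx (hat m y) x\<bar> \<le> H y"
    using H by (auto intro!: AE_finite_allI finite_nodes)
  define M where "M = (\<Sum>y\<in>nodes m. \<bar>B y\<bar> * \<bar>H y\<bar>)"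
  have bound: "\<bar>\<Sum>y\<in>nodes m. w t y * g y\<bar> \<le> M" if "t \<in> {0..T}" "\<forall>y\<in>nodes m. \<bar>g y\<bar> \<le> H y" for t and g :: "real \<Rightarrow> real"
    unfolding M_def
  proof (rule order_trans[OF sum_abs sum_mono])
    fix y assume y: "y \<in> nodes m"
    have "\<bar>w t y\<bar> \<le> \<bar>B y\<bar>" "\<bar>g y\<bar> \<le> \<bar>H y\<bar>"
      using B[OF y that(1)] that(2) y by (auto intro: order_trans[OF _ abs_ge_self])
    then show "\<bar>w t y * g y\<bar> \<le> \<bar>B y\<bar> * \<bar>H y\<bar>" unfolding abs_mult by (intro mult_mono) auto
  qed
  have "W1inf_bound M (w t)" if t: "t \<in> {0..T}" for t
  proof -
    note ps = Dx_sum[where I = "nodes m" and f = "hat m" and c = "w t", OF finite_nodes pw]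
    have eq: "w t x = (\<Sum>y\<in>nodes m. w t y * hat m y x)" if "x \<in> {0..1}" for x
      using S_h_eq_interp[OF m w(2)[OF t] that] interp_eq_hat_sum[OF m, of "w t" x] by simp
    have "AE x in unit_measure. w t x = (\<Sum>y\<in>nodes m. w t y * hat m y x)"
      using eq by (intro AE_unit_measureI) auto
    then have 1: "AE x in unit_measure. \<bar>w t x\<bar> \<le> M"
      using H1
    proof eventually_elim
      case (elim x)
      show ?case unfolding elim(1) using bound[OF t elim(2)] .
    qed
    have "AE x in unit_measure. Dx (w t) x = Dx (\<lambda>x. \<Sum>y\<in>nodes m. w t y * hat m y x) x"
      by (rule Dx_cong(2)[OF ps(1)]) (use eq in auto)
    then have 2: "AE x in unit_measure. \<bar>Dx (w t) x\<bar> \<le> M"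
      using ps(2) H2
    proof eventually_elim
      case (elim x)
      show ?case unfolding elim(1,2) using bound[OF t elim(3)] .
    qed
    from 1 2 show ?thesis by (simp add: W1inf_bound_def)
  qed
  moreover have "0 \<le> M" unfolding M_def by (intro sum_nonneg) auto
  ultimately show ?thesis by blast
qed

lemma W1inf_bound_mono: "W1inf_bound M f \<Longrightarrow> M \<le> M' \<Longrightarrow> W1inf_bound M' f"
  unfolding W1inf_bound_def by (auto elim: eventually_mono)

lemma energy_zero_if_zero:
  assumes m: "is_mesh m" and "\<xi> \<in> S_h m" "\<And>x. x \<in> {0..1} \<Longrightarrow> \<theta> x = 0" "\<And>x. x \<in> {0..1} \<Longrightarrow> \<xi> x = 0"
  shows "energy \<theta> \<xi> = 0"
proof -
  have "L2_inner \<theta> \<theta> = L2_inner (\<lambda>_. 0) (\<lambda>_. 0)" using assms by (intro L2_inner_cong) auto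
  moreover have z: "(\<lambda>_. 0) \<in> S_h m"
    using L2_inner_form_S_h[OF m] by (simp add: inner_form_on_def)
  moreover have "a_form \<xi> \<xi> = a_form (\<lambda>_. 0) (\<lambda>_. 0)"
    using assms z by (intro a_form_cong S_h_piecewise_C1[OF m]) auto
  ultimately show ?thesis
    using inner_form_zero_left[OF a_form_inner_form_S_h[OF m] z] by (simp add: energy_def L2_inner_def)
qed

text \<open>
  One of the two solutions takes the place of the interpolants in the stability estimate; residuals
  and initial energy are zero, hence so is the energy.
\<close>

lemma galerkin_solution_unique:
  assumes m: "is_mesh m" and T: "0 < T" and c: "fe_curves T m Z U" "fe_curves T m \<eta> u"
    and g: "\<And>t. t \<in> {0..T} \<Longrightarrow> galerkin T m \<alpha> \<beta> \<gamma> (\<lambda>_. 0) (\<lambda>_. 0) Z U t"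
      "\<And>t. t \<in> {0..T} \<Longrightarrow> galerkin T m \<alpha> \<beta> \<gamma> (\<lambda>_. 0) (\<lambda>_. 0) \<eta> u t"
    and init: "\<And>x. x \<in> {0..1} \<Longrightarrow> Z 0 x = \<eta> 0 x \<and> U 0 x = u 0 x"
    and t: "t \<in> {0..T}" and x: "x \<in> {0..1}"
  shows "Z t x = \<eta> t x \<and> U t x = u t x"
proof -
  obtain M1 where M1: "0 \<le> M1" "\<And>t. t \<in> {0..T} \<Longrightarrow> W1inf_bound M1 (Z t)"
    using fe_curve_W1inf_bounded[OF m, of T Z] c by (auto simp: fe_curves_def)
  obtain M2 where M2: "0 \<le> M2" "\<And>t. t \<in> {0..T} \<Longrightarrow> W1inf_bound M2 (U t)"
    using fe_curve_W1inf_bounded[OF m, of T U] c S_h0_subset by (auto simp: fe_curves_def)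
  define M where "M = max M1 M2"
  have dS: "(\<lambda>x. Z t x - \<eta> t x) \<in> S_h m" "(\<lambda>x. U t x - u t x) \<in> S_h0 m" if "t \<in> {0..T}" for t
    using c that S_h_lincomb[OF m, of "Z t" "\<eta> t" 1 "-1"] S_h0_lincomb[OF m, of "U t" "u t" 1 "-1"]
    by (auto simp: fe_curves_def)
  have "0 \<in> {0..T}" using T by simp
  then have E0: "error_energy Z U \<eta> u 0 = 0"
    unfolding error_energy_def using init dS
    by (intro energy_zero_if_zero[OF m] S_h0_subset) auto
  have "error_energy Z U \<eta> u t + 0\<^sup>2 \<le>
      (error_energy Z U \<eta> u 0 + 0\<^sup>2) * exp (2 * energy_rate \<alpha> \<beta> \<gamma> M * t)"
  proof (rule stability(1)[OF m T c _ _ g(1)])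
    show "W1inf_bound M (Z t) \<and> W1inf_bound M (U t)" if "t \<in> {0..T}" for t
      using M1 M2 that W1inf_bound_mono unfolding M_def by (meson max.cobounded1 max.cobounded2)
    show "0 \<le> M" using M1 by (simp add: M_def)
    show "(error_energy Z U \<eta> u 0 + 0\<^sup>2) * exp (2 * energy_rate \<alpha> \<beta> \<gamma> M * T) < min_mesh_size m / 3"
      using E0 min_mesh_size_pos[OF m] by simp
  qed (use g(2) t in \<open>auto simp: ess_bounded_const\<close>)
  then have "error_energy Z U \<eta> u t \<le> 0" using E0 by simp
  then have z: "L2_inner (\<lambda>x. Z t x - \<eta> t x) (\<lambda>x. Z t x - \<eta> t x) = 0"
    "L2_inner (\<lambda>x. U t x - u t x) (\<lambda>x. U t x - u t x) = 0"
    using L2_inner_nonneg[of "\<lambda>x. Z t x - \<eta> t x"] L2_inner_nonneg[of "\<lambda>x. U t x - u t x"]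
      L2_inner_nonneg[of "Dx (\<lambda>x. U t x - u t x)"]
    unfolding error_energy_def energy_def a_form_def by linarith+
  show ?thesis
    using L2_definite[OF S_h_continuous[OF m dS(1)[OF t]] z(1) x]
      L2_definite[OF S_h_continuous[OF m S_h0_subset[OF dS(2)[OF t]]] z(2) x] by simp
qed

subsection \<open>Existence\<close>

lemma L2_inner_form_ess_bounded: "inner_form_on {f. ess_bounded f} L2_inner"
  unfolding inner_form_on_def
  by (auto simp: L2_inner_add_left L2_inner_cmult_left L2_inner_nonneg ess_bounded_intros
      intro: L2_inner_commute)

lemma L2_inner_sum_left:
  assumes "finite I" "\<And>i. i \<in> I \<Longrightarrow> ess_bounded (f i)" "ess_bounded h"
  shows "L2_inner (\<lambda>x. \<Sum>i\<in>I. c i * f i x) h = (\<Sum>i\<in>I. c i * L2_inner (f i) h)"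
    and "ess_bounded (\<lambda>x. \<Sum>i\<in>I. c i * f i x)"
  using inner_form_sum[OF L2_inner_form_ess_bounded, of I f h c] assms by auto

lemma L2_inner_Dx_sum:
  assumes "finite I" "\<And>i. i \<in> I \<Longrightarrow> piecewise_C1 (f i)" "ess_bounded h"
  shows "L2_inner (Dx (\<lambda>x. \<Sum>i\<in>I. c i * f i x)) h = (\<Sum>i\<in>I. c i * L2_inner (Dx (f i)) h)"
proof -
  have e: "ess_bounded (Dx (f i))" if "i \<in> I" for i using piecewise_C1_ess_bounded(2)[OF assms(2)[OF that]] .
  have "L2_inner (Dx (\<lambda>x. \<Sum>i\<in>I. c i * f i x)) h = L2_inner (\<lambda>x. \<Sum>i\<in>I. c i * Dx (f i) x) h"
    by (rule L2_inner_cong_AE[OF L2_inner_sum_left(2)[OF assms(1) e assms(3)] assms(3) Dx_sum(2)[OF assms(1,2)]]) auto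
  also have "\<dots> = (\<Sum>i\<in>I. c i * L2_inner (Dx (f i)) h)" by (rule L2_inner_sum_left(1)[OF assms(1) e assms(3)])
  finally show ?thesis .
qed

lemma L2_inner_Dx_product_sum:
  fixes f g :: "nat \<Rightarrow> real \<Rightarrow> real"
  assumes "\<And>k. k < n \<Longrightarrow> piecewise_C1 (f k)" "\<And>k. k < n \<Longrightarrow> piecewise_C1 (g k)" "ess_bounded h"
  shows "L2_inner (Dx (\<lambda>x. (\<Sum>k<n. c k * f k x) * (\<Sum>l<n. c l * g l x))) h =
    (\<Sum>k<n. \<Sum>l<n. (c k * c l) * L2_inner (Dx (\<lambda>x. f k x * g l x)) h)"
proof -
  have "(\<lambda>x. (\<Sum>k<n. c k * f k x) * (\<Sum>l<n. c l * g l x)) =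
      (\<lambda>x. \<Sum>kl\<in>{..<n} \<times> {..<n}. (c (fst kl) * c (snd kl)) * (f (fst kl) x * g (snd kl) x))"
    by (auto simp: sum_product sum.cartesian_product mult_ac split_def)
  then have "L2_inner (Dx (\<lambda>x. (\<Sum>k<n. c k * f k x) * (\<Sum>l<n. c l * g l x))) h =
      (\<Sum>kl\<in>{..<n} \<times> {..<n}. (c (fst kl) * c (snd kl)) * L2_inner (Dx (\<lambda>x. f (fst kl) x * g (snd kl) x)) h)"
    using assms by (simp only:) (intro L2_inner_Dx_sum Dx_mult(1); auto)
  then show ?thesis by (simp add: sum.cartesian_product split_def)
qed

lemma L2_inner_Dx_flux1:
  assumes "piecewise_C1 \<eta>" "piecewise_C1 u" "ess_bounded h"
  shows "L2_inner (Dx (flux1 \<alpha> \<eta> u)) h = L2_inner (Dx u) h + \<alpha> * L2_inner (Dx (\<lambda>x. \<eta> x * u x)) h"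
proof -
  note p = Dx_mult(1)[OF assms(1,2)]
  note c = Dx_cmult[OF p, of \<alpha>]
  note a = Dx_add[OF assms(2) c(1)]
  have "AE x in unit_measure. Dx (flux1 \<alpha> \<eta> u) x = Dx u x + \<alpha> * Dx (\<lambda>x. \<eta> x * u x) x"
    using a(2) c(2) unfolding flux1_def[abs_def] by eventually_elim simp
  then have "L2_inner (Dx (flux1 \<alpha> \<eta> u)) h = L2_inner (\<lambda>x. Dx u x + \<alpha> * Dx (\<lambda>x. \<eta> x * u x) x) h"
    by (intro L2_inner_cong_AE ess_bounded_add ess_bounded_cmult piecewise_C1_ess_bounded(2) p assms) auto
  also have "\<dots> = L2_inner (Dx u) h + \<alpha> * L2_inner (Dx (\<lambda>x. \<eta> x * u x)) h"
    by (simp add: L2_inner_add_left L2_inner_cmult_left ess_bounded_cmult piecewise_C1_ess_bounded(2) p assms)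
  finally show ?thesis .
qed

lemma L2_inner_Dx_flux2:
  assumes "piecewise_C1 \<eta>" "piecewise_C1 u" "ess_bounded h"
  shows "L2_inner (Dx (flux2 \<beta> \<gamma> \<eta> u)) h = L2_inner (Dx \<eta>) h +
    (\<beta> / 2 * L2_inner (Dx (\<lambda>x. u x * u x)) h + \<gamma> / 2 * L2_inner (Dx (\<lambda>x. \<eta> x * \<eta> x)) h)"
proof -
  note p = Dx_mult(1)[OF assms(2,2)] Dx_mult(1)[OF assms(1,1)]
  note c = Dx_cmult[OF p(1), of "\<beta> / 2"] and d = Dx_cmult[OF p(2), of "\<gamma> / 2"]
  note s = Dx_add[OF c(1) d(1)]
  note a = Dx_add[OF assms(1) s(1)]
  have "AE x in unit_measure. Dx (flux2 \<beta> \<gamma> \<eta> u) x =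
      Dx \<eta> x + (\<beta> / 2 * Dx (\<lambda>x. u x * u x) x + \<gamma> / 2 * Dx (\<lambda>x. \<eta> x * \<eta> x) x)"
    using a(2) s(2) c(2) d(2) unfolding flux2_def[abs_def] by eventually_elim simp
  then have "L2_inner (Dx (flux2 \<beta> \<gamma> \<eta> u)) h =
      L2_inner (\<lambda>x. Dx \<eta> x + (\<beta> / 2 * Dx (\<lambda>x. u x * u x) x + \<gamma> / 2 * Dx (\<lambda>x. \<eta> x * \<eta> x) x)) h"
    by (intro L2_inner_cong_AE ess_bounded_add ess_bounded_cmult piecewise_C1_ess_bounded(2) p assms) auto
  also have "\<dots> = L2_inner (Dx \<eta>) h +
    (\<beta> / 2 * L2_inner (Dx (\<lambda>x. u x * u x)) h + \<gamma> / 2 * L2_inner (Dx (\<lambda>x. \<eta> x * \<eta> x)) h)"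
    by (simp only: L2_inner_add_left L2_inner_cmult_left ess_bounded_add ess_bounded_cmult
        piecewise_C1_ess_bounded(2) p assms)
  finally show ?thesis .
qed

lemma sum_lessThan_add: "(\<Sum>k<a + b. h k) = (\<Sum>k<a. h k) + (\<Sum>j<b. h (a + j))" for h :: "nat \<Rightarrow> real"
  by (induction b) (simp_all add: add.assoc)

lemma orthonormal_sum_norm:
  assumes B: "inner_form_on V B" and e: "\<And>k. k < n \<Longrightarrow> e k \<in> V" "orthonormal B e n" and f: "f \<in> V"
  shows "B (\<lambda>x. \<Sum>k<n. c k * e k x) (\<lambda>x. \<Sum>k<n. c k * e k x) = (\<Sum>k<n. (c k)\<^sup>2)"
proof -
  let ?s = "\<lambda>x. \<Sum>k<n. c k * e k x"
  have sV: "?s \<in> V" by (rule inner_form_sum(1)[OF B _ _ f]) (use e in auto)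
  have "B (e k) ?s = c k" if k: "k < n" for k
  proof -
    have "B (e k) ?s = B ?s (e k)" by (rule inner_form_onD(2)[OF B e(1)[OF k] sV])
    also have "\<dots> = (\<Sum>l<n. c l * B (e l) (e k))"
      by (rule inner_form_sum(2)[OF B _ _ e(1)[OF k]]) (use e in auto)
    also have "\<dots> = (\<Sum>l<n. if l = k then c k else 0)"
      using e(2) k by (intro sum.cong) (auto simp: orthonormal_def)
    finally show ?thesis using k by simp
  qed
  moreover have "B ?s ?s = (\<Sum>k<n. c k * B (e k) ?s)"
    by (rule inner_form_sum(2)[OF B _ _ sV]) (use e in auto)
  ultimately show ?thesis by (simp add: power2_eq_square)
qed

text \<open>
  Expand \<open>0 \<le> B (2 f - g) (2 f - g)\<close>.
\<close>

lemma inner_form_parallelogram: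
  assumes B: "inner_form_on V B" and f: "f \<in> V" and g: "g \<in> V"
  shows "B g g \<le> 2 * B f f + 2 * B (\<lambda>x. f x - g x) (\<lambda>x. f x - g x)"
proof -
  have lin: "B (\<lambda>x. a * f x + b * g x) (\<lambda>x. a * f x + b * g x) = a * a * B f f + 2 * a * b * B f g + b * b * B g g" for a b
  proof -
    let ?d = "\<lambda>x. a * f x + b * g x"
    have d: "?d \<in> V" by (rule inner_form_onD(1)[OF B f g])
    have "B ?d ?d = a * B f ?d + b * B g ?d" by (rule inner_form_onD(4)[OF B f g d])
    also have "B f ?d = a * B f f + b * B g f"
      using inner_form_onD(2)[OF B f d] inner_form_onD(4)[OF B f g f] by simp
    also have "B g ?d = a * B f g + b * B g g"
      using inner_form_onD(2)[OF B g d] inner_form_onD(4)[OF B f g g] by simp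
    finally show ?thesis using inner_form_onD(2)[OF B f g] by (simp add: algebra_simps)
  qed
  have "0 \<le> B (\<lambda>x. 2 * f x + (- 1) * g x) (\<lambda>x. 2 * f x + (- 1) * g x)"
    using inner_form_onD(1)[OF B f g] inner_form_onD(3)[OF B] by blast
  then show ?thesis using lin[of 2 "-1"] lin[of 1 "-1"] by simp
qed


text \<open>
  Truncate the coefficients with respect to orthonormal bases at a level \<open>R\<close> that dominates the norm
  of every pair whose error energy relative to \<open>(Z, U)\<close> is at most the threshold of the stability
  estimate. Whenever the error energy is at most that threshold, the truncation is inactive and the Galerkin
  equations hold; by stability this is the case at all times.
\<close>

lemma galerkin_solution_exists:
  assumes m: "is_mesh m" and T: "0 < T" and ZU: "fe_curves T m Z U"
    and M: "\<And>t. t \<in> {0..T} \<Longrightarrow> W1inf_bound M (Z t) \<and> W1inf_bound M (U t)" "0 \<le> M"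
    and res: "\<And>t. t \<in> {0..T} \<Longrightarrow> galerkin T m \<alpha> \<beta> \<gamma> (r1 t) (r2 t) Z U t"
    and r: "\<And>t. t \<in> {0..T} \<Longrightarrow> ess_bounded (r1 t) \<and> ess_bounded (r2 t)"
    and rb: "\<And>t. t \<in> {0..T} \<Longrightarrow> (AE x in unit_measure. \<bar>r1 t x\<bar> \<le> c) \<and> (AE x in unit_measure. \<bar>r2 t x\<bar> \<le> c)"
    and init: "\<eta>0 \<in> S_h m" "u0 \<in> S_h0 m"
    and E0: "E0 = energy (\<lambda>x. Z 0 x - \<eta>0 x) (\<lambda>x. U 0 x - u0 x)"
    and small: "(E0 + c\<^sup>2) * exp (2 * energy_rate \<alpha> \<beta> \<gamma> M * T) < min_mesh_size m / 3"
  shows "\<exists>\<eta> u. fe_curves T m \<eta> u \<and> (\<forall>x\<in>{0..1}. \<eta> 0 x = \<eta>0 x \<and> u 0 x = u0 x) \<and>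
    (\<forall>t\<in>{0..T}. galerkin T m \<alpha> \<beta> \<gamma> (\<lambda>_. 0) (\<lambda>_. 0) \<eta> u t \<and>
      error_energy Z U \<eta> u t + c\<^sup>2 \<le> (E0 + c\<^sup>2) * exp (2 * energy_rate \<alpha> \<beta> \<gamma> M * t))"
proof -
  obtain n1 e where eS: "\<And>i. i < n1 \<Longrightarrow> e i \<in> S_h m" and eo: "orthonormal L2_inner e n1"
    and esp: "\<And>\<phi> x. \<phi> \<in> S_h m \<Longrightarrow> x \<in> {0..1} \<Longrightarrow> \<phi> x = (\<Sum>k<n1. L2_inner \<phi> (e k) * e k x)"
    using S_h_orthonormal_basis[OF m] by blast
  obtain n2 f where fS: "\<And>i. i < n2 \<Longrightarrow> f i \<in> S_h0 m" and fo: "orthonormal a_form f n2"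
    and fsp: "\<And>\<psi> x. \<psi> \<in> S_h0 m \<Longrightarrow> x \<in> {0..1} \<Longrightarrow> \<psi> x = (\<Sum>k<n2. a_form \<psi> (f k) * f k x)"
    using S_h0_orthonormal_basis[OF m] by blast
  note pw = S_h_piecewise_C1[OF m]
  note eb = piecewise_C1_ess_bounded(1)[OF pw]
  have zS: "(\<lambda>_. 0) \<in> S_h m" "(\<lambda>_. 0) \<in> S_h0 m"
    using L2_inner_form_S_h[OF m] a_form_inner_form_S_h0[OF m] by (auto simp: inner_form_on_def)
  \<comment> \<open>The pairs \<open>(p k, q k)\<close> form an orthonormal basis of the product of the two spaces for the energy
    inner product.\<close>
  define n where "n = n1 + n2"
  define p where "p k = (if k < n1 then e k else (\<lambda>_. 0))" for k
  define q where "q k = (if k < n1 then (\<lambda>_. 0) else f (k - n1))" for k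
  have pS: "p k \<in> S_h m" and qS: "q k \<in> S_h0 m" if "k < n" for k
    using that eS fS zS by (auto simp: p_def q_def n_def)
  note qS' = S_h0_subset[OF qS]
  define N where "N c i = L2_inner (Dx (flux1 \<alpha> (\<lambda>x. \<Sum>k<n. c k * p k x) (\<lambda>x. \<Sum>k<n. c k * q k x))) (p i)
    + L2_inner (Dx (flux2 \<beta> \<gamma> (\<lambda>x. \<Sum>k<n. c k * p k x) (\<lambda>x. \<Sum>k<n. c k * q k x))) (q i)" for c i
  define A where "A i k = - (L2_inner (Dx (q k)) (p i) + L2_inner (Dx (p k)) (q i))" for i k
  define Q where "Q i k l = - (\<alpha> * L2_inner (Dx (\<lambda>x. p k x * q l x)) (p i) +
    (\<beta> / 2 * L2_inner (Dx (\<lambda>x. q k x * q l x)) (q i) + \<gamma> / 2 * L2_inner (Dx (\<lambda>x. p k x * p l x)) (q i)))" for i k l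
  have N: "(\<Sum>k<n. A i k * c k) + (\<Sum>k<n. \<Sum>l<n. Q i k l * (c k * c l)) = - N c i" if i: "i < n" for c i
  proof -
    have sums: "piecewise_C1 (\<lambda>x. \<Sum>k<n. c k * p k x)" "piecewise_C1 (\<lambda>x. \<Sum>k<n. c k * q k x)"
      by (intro pw S_h_sum[OF m] pS qS'; simp)+
    have lin: "L2_inner (Dx (\<lambda>x. \<Sum>k<n. c k * q k x)) (p i) = (\<Sum>k<n. c k * L2_inner (Dx (q k)) (p i))"
      "L2_inner (Dx (\<lambda>x. \<Sum>k<n. c k * p k x)) (q i) = (\<Sum>k<n. c k * L2_inner (Dx (p k)) (q i))"
      by (rule L2_inner_Dx_sum; use pw pS qS' eb i in auto)+
    have "N c i = ((\<Sum>k<n. c k * L2_inner (Dx (q k)) (p i)) +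
          \<alpha> * (\<Sum>k<n. \<Sum>l<n. (c k * c l) * L2_inner (Dx (\<lambda>x. p k x * q l x)) (p i))) +
        ((\<Sum>k<n. c k * L2_inner (Dx (p k)) (q i)) +
          (\<beta> / 2 * (\<Sum>k<n. \<Sum>l<n. (c k * c l) * L2_inner (Dx (\<lambda>x. q k x * q l x)) (q i)) +
          \<gamma> / 2 * (\<Sum>k<n. \<Sum>l<n. (c k * c l) * L2_inner (Dx (\<lambda>x. p k x * p l x)) (q i))))"
      unfolding N_def L2_inner_Dx_flux1[OF sums eb[OF pS[OF i]]] L2_inner_Dx_flux2[OF sums eb[OF qS'[OF i]]]
      by (simp add: lin L2_inner_Dx_product_sum pw pS qS' eb i)
    moreover have "(\<Sum>k<n. A i k * c k) =
        - (\<Sum>k<n. c k * L2_inner (Dx (q k)) (p i)) - (\<Sum>k<n. c k * L2_inner (Dx (p k)) (q i))"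
      unfolding sum_negf[symmetric] sum_subtractf[symmetric]
      by (intro sum.cong refl) (simp add: A_def algebra_simps)
    moreover have "(\<Sum>k<n. \<Sum>l<n. Q i k l * (c k * c l)) =
        - (\<alpha> * (\<Sum>k<n. \<Sum>l<n. (c k * c l) * L2_inner (Dx (\<lambda>x. p k x * q l x)) (p i)))
        - (\<beta> / 2 * (\<Sum>k<n. \<Sum>l<n. (c k * c l) * L2_inner (Dx (\<lambda>x. q k x * q l x)) (q i)))
        - (\<gamma> / 2 * (\<Sum>k<n. \<Sum>l<n. (c k * c l) * L2_inner (Dx (\<lambda>x. p k x * p l x)) (q i)))"
      unfolding sum_distrib_left sum_negf[symmetric] sum_subtractf[symmetric]
      by (intro sum.cong refl) (simp add: Q_def algebra_simps)
    ultimately show ?thesis by linarith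
  qed
  \<comment> \<open>By the parallelogram inequality; \<open>(Z, U)\<close> has energy at most \<open>M\<^sup>2 + M\<^sup>2 + M\<^sup>2/3\<close>, and twice this is
    \<open>14/3 M\<^sup>2\<close>.\<close>
  define R where "R = sqrt (2 * (min_mesh_size m / 3) + 14 / 3 * M\<^sup>2)"
  have R2: "R\<^sup>2 = 2 * (min_mesh_size m / 3) + 14 / 3 * M\<^sup>2" and R: "0 \<le> R"
    using min_mesh_size_pos[OF m] by (auto simp: R_def)
  obtain y where y0: "\<And>k. k < n \<Longrightarrow> y 0 k = (if k < n1 then L2_inner \<eta>0 (e k) else a_form u0 (f (k - n1)))"
    and yd: "\<And>i t. i < n \<Longrightarrow> t \<in> {0..T} \<Longrightarrow> ((\<lambda>t. y t i) has_real_derivative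
      (\<Sum>k<n. A i k * trunc R (y t k)) + (\<Sum>k<n. \<Sum>l<n. Q i k l * (trunc R (y t k) * trunc R (y t l))))
      (at t within {0..T})"
    using truncated_quadratic_ode[OF T R, of n "\<lambda>k. if k < n1 then L2_inner \<eta>0 (e k) else a_form u0 (f (k - n1))" A Q]
    by blast
  define D where "D t i = - N (\<lambda>k. trunc R (y t k)) i" for t i
  have yD: "((\<lambda>t. y t i) has_real_derivative D t i) (at t within {0..T})" if "i < n" "t \<in> {0..T}" for i t
    using yd[OF that] N[OF that(1), of "\<lambda>k. trunc R (y t k)"] by (simp add: D_def)
  define \<eta> where "\<eta> t x = (\<Sum>k<n. y t k * p k x)" for t x
  define u where "u t x = (\<Sum>k<n. y t k * q k x)" for t x
  have \<eta>S: "\<eta> t \<in> S_h m" for t unfolding \<eta>_def[abs_def] by (intro S_h_sum[OF m] pS) simp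
  have uS: "u t \<in> S_h0 m" for t
    unfolding u_def[abs_def] using inner_form_sum(1)[OF a_form_inner_form_S_h0[OF m] _ _ zS(2), of "{..<n}" q] qS by simp
  have d\<eta>: "((\<lambda>t. \<eta> t x) has_real_derivative (\<Sum>k<n. D t k * p k x)) (at t within {0..T})" if "t \<in> {0..T}" for t x
    unfolding \<eta>_def using that by (intro DERIV_sum DERIV_cmult_right yD) auto
  have du: "((\<lambda>t. u t x) has_real_derivative (\<Sum>k<n. D t k * q k x)) (at t within {0..T})" if "t \<in> {0..T}" for t x
    unfolding u_def using that by (intro DERIV_sum DERIV_cmult_right yD) auto
  have hu: "fe_curves T m \<eta> u"
    unfolding fe_curves_def
    using \<eta>S uS t_differentiableI[of T \<eta> "\<lambda>t x. \<Sum>k<n. D t k * p k x"]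
      t_differentiableI[of T u "\<lambda>t x. \<Sum>k<n. D t k * q k x"] d\<eta> du by blast
  have split_p: "(\<Sum>k<n. c k * p k x) = (\<Sum>k<n1. c k * e k x)"
    and split_q: "(\<Sum>k<n. c k * q k x) = (\<Sum>j<n2. c (n1 + j) * f j x)" for c x
    by (simp_all add: n_def sum_lessThan_add p_def q_def)
  have dt\<eta>: "dt T \<eta> t = (\<lambda>x. \<Sum>k<n1. D t k * e k x)" and dtu: "dt T u t = (\<lambda>x. \<Sum>j<n2. D t (n1 + j) * f j x)"
    if t: "t \<in> {0..T}" for t
    using has_derivative_imp_dt[OF T t d\<eta>[OF t]] has_derivative_imp_dt[OF T t du[OF t]]
    by (auto simp: split_p split_q)
  have gal: "galerkin T m \<alpha> \<beta> \<gamma> (\<lambda>_. 0) (\<lambda>_. 0) \<eta> u t"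
    if t: "t \<in> {0..T}" and le: "error_energy Z U \<eta> u t \<le> min_mesh_size m / 3" for t
  proof -
    have ZS: "Z t \<in> S_h m" "U t \<in> S_h0 m" using ZU t by (auto simp: fe_curves_def)
    have "L2_inner (\<eta> t) (\<eta> t) \<le> 2 * L2_inner (Z t) (Z t) + 2 * L2_inner (\<lambda>x. Z t x - \<eta> t x) (\<lambda>x. Z t x - \<eta> t x)"
      by (rule inner_form_parallelogram[OF L2_inner_form_S_h[OF m] ZS(1) \<eta>S])
    moreover have "a_form (u t) (u t) \<le> 2 * a_form (U t) (U t) + 2 * a_form (\<lambda>x. U t x - u t x) (\<lambda>x. U t x - u t x)"
      by (rule inner_form_parallelogram[OF a_form_inner_form_S_h0[OF m] ZS(2) uS])
    moreover have "L2_inner (Z t) (Z t) \<le> M\<^sup>2" "L2_inner (U t) (U t) \<le> M\<^sup>2" "L2_inner (Dx (U t)) (Dx (U t)) \<le> M\<^sup>2"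
      using M(1)[OF t] piecewise_C1_ess_bounded[OF pw[OF ZS(1)]] piecewise_C1_ess_bounded[OF pw[OF S_h0_subset[OF ZS(2)]]]
      by (auto intro!: L2_inner_le_bound simp: W1inf_bound_def)
    ultimately have bound: "L2_inner (\<eta> t) (\<eta> t) + a_form (u t) (u t) \<le> R\<^sup>2"
      using le unfolding R2 error_energy_def energy_def a_form_def[of "U t" "U t"] by (simp add: field_simps)
    have "L2_inner (\<eta> t) (\<eta> t) = (\<Sum>k<n1. (y t k)\<^sup>2)"
      unfolding \<eta>_def[abs_def] split_p
      by (rule orthonormal_sum_norm[OF L2_inner_form_S_h[OF m] eS eo zS(1)])
    moreover have "a_form (u t) (u t) = (\<Sum>j<n2. (y t (n1 + j))\<^sup>2)"
      unfolding u_def[abs_def] split_q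
      by (rule orthonormal_sum_norm[OF a_form_inner_form_S_h0[OF m] fS fo zS(2)])
    ultimately have sumle: "(\<Sum>k<n. (y t k)\<^sup>2) \<le> R\<^sup>2"
      using bound by (simp add: n_def sum_lessThan_add)
    have "\<bar>y t k\<bar> \<le> R" if "k < n" for k
    proof -
      have "(y t k)\<^sup>2 \<le> (\<Sum>k<n. (y t k)\<^sup>2)" using that by (intro member_le_sum) auto
      then have "(y t k)\<^sup>2 \<le> R\<^sup>2" using sumle by linarith
      then show ?thesis using R by (metis abs_of_nonneg abs_le_square_iff)
    qed
    then have tr: "trunc R (y t k) = y t k" if "k < n" for k using trunc_simps(1) that by blast
    have DN: "D t i = - (L2_inner (Dx (flux1 \<alpha> (\<eta> t) (u t))) (p i) + L2_inner (Dx (flux2 \<beta> \<gamma> (\<eta> t) (u t))) (q i))" for i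
      unfolding D_def N_def \<eta>_def[abs_def] u_def[abs_def] using tr by simp
    define F1 where "F1 = Dx (flux1 \<alpha> (\<eta> t) (u t))"
    define F2 where "F2 = Dx (flux2 \<beta> \<gamma> (\<eta> t) (u t))"
    have F: "ess_bounded F1" "ess_bounded F2"
      unfolding F1_def F2_def
      by (intro piecewise_C1_ess_bounded(2) Dx_flux1(1) Dx_flux2(1) pw \<eta>S S_h0_subset[OF uS])+
    have D1: "D t k = - L2_inner (e k) F1" if "k < n1" for k
      using DN[of k] that by (simp add: p_def q_def F1_def L2_inner_zero_left L2_inner_commute[of _ "\<lambda>_. 0"] L2_inner_commute[of "e k"])
    have D2: "D t (n1 + j) = - L2_inner (f j) F2" if "j < n2" for j
      using DN[of "n1 + j"] that
      by (simp add: p_def q_def F2_def L2_inner_zero_left L2_inner_commute[of _ "\<lambda>_. 0"] L2_inner_commute[of "f j"])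
    show ?thesis
      unfolding galerkin_def F1_def[symmetric] F2_def[symmetric] L2_inner_zero_left
    proof (intro conjI ballI)
      fix \<phi> assume \<phi>: "\<phi> \<in> S_h m"
      have "L2_inner (dt T \<eta> t) \<phi> = (\<Sum>k<n1. D t k * L2_inner (e k) \<phi>)"
        unfolding dt\<eta>[OF t] by (rule L2_inner_sum_left(1)) (auto intro!: eb eS \<phi>)
      moreover have "L2_inner F1 \<phi> = L2_inner (\<lambda>x. \<Sum>k<n1. L2_inner \<phi> (e k) * e k x) F1"
        unfolding L2_inner_commute[of F1] using esp[OF \<phi>] by (intro L2_inner_cong) auto
      moreover have "\<dots> = (\<Sum>k<n1. L2_inner \<phi> (e k) * L2_inner (e k) F1)"
        by (rule L2_inner_sum_left(1)) (auto intro!: eb eS F)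
      ultimately show "L2_inner (dt T \<eta> t) \<phi> + L2_inner F1 \<phi> = 0"
        by (simp add: D1 sum_negf L2_inner_commute[of \<phi>] mult.commute)
    next
      fix \<psi> assume \<psi>: "\<psi> \<in> S_h0 m"
      have "a_form (dt T u t) \<psi> = (\<Sum>k<n2. D t (n1 + k) * a_form (f k) \<psi>)"
        unfolding dtu[OF t]
        by (rule inner_form_sum(2)[OF a_form_inner_form_S_h0[OF m]]) (auto intro!: fS \<psi>)
      moreover have "L2_inner F2 \<psi> = L2_inner (\<lambda>x. \<Sum>k<n2. a_form \<psi> (f k) * f k x) F2"
        unfolding L2_inner_commute[of F2] using fsp[OF \<psi>] by (intro L2_inner_cong) auto
      moreover have "\<dots> = (\<Sum>k<n2. a_form \<psi> (f k) * L2_inner (f k) F2)"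
        by (rule L2_inner_sum_left(1)) (auto intro!: eb S_h0_subset fS F)
      ultimately show "a_form (dt T u t) \<psi> + L2_inner F2 \<psi> = 0"
        by (simp add: D2 sum_negf a_form_commute[of \<psi>] mult.commute)
    qed
  qed
  have init': "\<eta> 0 x = \<eta>0 x" "u 0 x = u0 x" if "x \<in> {0..1}" for x
    unfolding \<eta>_def u_def split_p split_q using esp[OF init(1) that] fsp[OF init(2) that] y0
    by (simp_all add: n_def)
  have T0: "0 \<in> {0..T}" using T by simp
  have "Z 0 \<in> S_h m" "U 0 \<in> S_h0 m" using ZU T0 by (auto simp: fe_curves_def)
  then have d0: "(\<lambda>x. U 0 x - u0 x) \<in> S_h m"
    using S_h_lincomb[OF m S_h0_subset S_h0_subset[OF init(2)], of "U 0" 1 "-1"] by simp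
  have "error_energy Z U \<eta> u 0 = E0"
    unfolding error_energy_def energy_def E0
    using init' by (intro arg_cong2[where f = "(+)"] L2_inner_cong a_form_cong pw d0) auto
  then have sm: "(error_energy Z U \<eta> u 0 + c\<^sup>2) * exp (2 * energy_rate \<alpha> \<beta> \<gamma> M * T) < min_mesh_size m / 3"
    and E0': "error_energy Z U \<eta> u 0 = E0"
    using small by simp_all
  have st: "error_energy Z U \<eta> u t + c\<^sup>2 \<le>
      (error_energy Z U \<eta> u 0 + c\<^sup>2) * exp (2 * energy_rate \<alpha> \<beta> \<gamma> M * t)"
    "error_energy Z U \<eta> u t < min_mesh_size m / 3" if "t \<in> {0..T}" for t
    by (rule stability[OF m T ZU hu M res r rb gal sm that]; assumption)+
  have "galerkin T m \<alpha> \<beta> \<gamma> (\<lambda>_. 0) (\<lambda>_. 0) \<eta> u t" if "t \<in> {0..T}" for t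
    using gal[OF that] st(2)[OF that] by (simp add: less_imp_le)
  moreover have "error_energy Z U \<eta> u t + c\<^sup>2 \<le> (E0 + c\<^sup>2) * exp (2 * energy_rate \<alpha> \<beta> \<gamma> M * t)"
    if "t \<in> {0..T}" for t
    using st(1)[OF that] E0' by simp
  ultimately show ?thesis using hu init' by blast
qed

section \<open>Consistency of the interpolants\<close>

lemma x_differentiable_has_derivative:
  assumes "x_differentiable T v" "t \<in> {0..T}" "x \<in> {0..1}"
  shows "(v t has_real_derivative dx v t x) (at x within {0..1})"
  using assms unfolding x_differentiable_def dx_def
  by (simp add: has_real_derivative_iff_has_vector_derivative flip: vector_derivative_works)

lemma has_derivative_imp_dx:
  assumes "x \<in> {0..1}" "(v t has_real_derivative D) (at x within {0..1})"
  shows "dx v t x = D"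
  using vector_derivative_within_cbox[of 0 1 x "v t" D] assms unfolding dx_def
  by (simp add: has_real_derivative_iff_has_vector_derivative)

lemma jointly_continuous_bounded:
  assumes "jointly_continuous T v" shows "\<exists>B. \<forall>t\<in>{0..T}. \<forall>x\<in>{0..1}. \<bar>v t x\<bar> \<le> B"
proof -
  have "bounded ((\<lambda>(t, x). v t x) ` ({0..T} \<times> {0..1}))"
    using assms unfolding jointly_continuous_def
    by (intro compact_imp_bounded compact_continuous_image compact_Times) auto
  then show ?thesis unfolding bounded_iff by (auto 0 3)
qed

lemma jointly_continuous_slice:
  assumes "jointly_continuous T v" "t \<in> {0..T}" shows "continuous_on {0..1} (v t)"
proof -
  have "continuous_on {0..1} ((\<lambda>(t, x). v t x) \<circ> Pair t)"
    using assms unfolding jointly_continuous_def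
    by (intro continuous_on_compose continuous_intros) (auto elim: continuous_on_subset)
  then show ?thesis by (simp add: comp_def)
qed

lemma bounded_deriv_imp_Lipschitz:
  assumes d: "\<And>x. x \<in> {0..1} \<Longrightarrow> (v has_real_derivative g x) (at x within {0..1})"
    and b: "\<And>x. x \<in> {0..1} \<Longrightarrow> \<bar>g x\<bar> \<le> L"
  shows "L-lipschitz_on {0..1} v"
proof (rule lipschitz_onI)
  show "0 \<le> L" using b[of 0] by (auto intro: order_trans[OF abs_ge_zero])
  have *: "\<bar>v y - v x\<bar> \<le> L * (y - x)" if xy: "x \<in> {0..1}" "y \<in> {0..1}" "x < y" for x y
  proof -
    obtain z where z: "z \<in> {x<..<y}" "v y - v x = g z * (y - x)"
      using mvt_unit_interval[OF d, of x y] xy by auto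
    have "\<bar>g z\<bar> \<le> L" using b[of z] z xy by auto
    then have "\<bar>g z\<bar> * (y - x) \<le> L * (y - x)" using xy by (intro mult_right_mono) auto
    then show ?thesis using z xy by (simp add: abs_mult)
  qed
  fix x y :: real assume "x \<in> {0..1}" "y \<in> {0..1}"
  then show "dist (v x) (v y) \<le> L * dist x y"
    using *[of x y] *[of y x] by (cases x y rule: linorder_cases) (auto simp: dist_real_def abs_minus_commute)
qed

lemma deriv_le_if_Lipschitz_at:
  fixes g :: "real \<Rightarrow> real"
  assumes T: "0 < T" and t: "t \<in> {0..T}" and d: "(g has_real_derivative D) (at t within {0..T})"
    and l: "\<And>s. s \<in> {0..T} \<Longrightarrow> \<bar>g s - g t\<bar> \<le> K * \<bar>s - t\<bar>"
  shows "\<bar>D\<bar> \<le> K"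
proof -
  have "((\<lambda>s. (g s - g t) / (s - t)) \<longlongrightarrow> D) (at t within {0..T})"
    using d by (simp add: has_field_derivative_iff)
  moreover have "\<not> trivial_limit (at t within {0..T})"
    using T t islimpt_Icc[of 0 T t] by (simp add: trivial_limit_within)
  moreover have "\<forall>\<^sub>F s in at t within {0..T}. norm ((g s - g t) / (s - t)) \<le> K"
    unfolding eventually_at_topological
  proof (intro exI[of _ UNIV] conjI ballI impI)
    fix s assume "s \<in> UNIV" "s \<noteq> t" "s \<in> {0..T}"
    then show "norm ((g s - g t) / (s - t)) \<le> K" using l[of s] by (simp add: abs_divide divide_le_eq)
  qed auto
  ultimately have "norm D \<le> K" by (intro Lim_norm_ubound)
  then show ?thesis by simp
qed

lemma mvt_time:
  fixes g :: "real \<Rightarrow> real"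
  assumes d: "\<And>t. t \<in> {0..T} \<Longrightarrow> (g has_real_derivative g' t) (at t within {0..T})"
    and b: "\<And>t. t \<in> {0..T} \<Longrightarrow> \<bar>g' t\<bar> \<le> B" and st: "s \<in> {0..T}" "t \<in> {0..T}"
  shows "\<bar>g s - g t\<bar> \<le> B * \<bar>s - t\<bar>"
proof -
  have "norm (g s - g t) \<le> B * norm (s - t)"
    by (rule field_differentiable_bound[of "{0..T}" g g' B]) (use d b st in auto)
  then show ?thesis by simp
qed

text \<open>
  A time increment \<open>w\<close> of \<open>u\<close> vanishes at both ends, so \<open>w\<^sub>x\<close> has a zero and is bounded by the
  supremum of \<open>\<bar>w\<^sub>x\<^sub>x\<bar>\<close>. Dividing by the length of the time step gives the claim.
\<close>

lemma dt_Lipschitz_from_second_derivative: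
  assumes T: "0 < T" and u: "x_differentiable T u" "x_differentiable T (dx u)" "t_differentiable T u"
      "t_differentiable T (dx (dx u))"
    and bc: "\<And>t. t \<in> {0..T} \<Longrightarrow> u t 0 = 0 \<and> u t 1 = 0"
    and B: "\<And>t x. t \<in> {0..T} \<Longrightarrow> x \<in> {0..1} \<Longrightarrow> \<bar>dt T (dx (dx u)) t x\<bar> \<le> B"
    and t: "t \<in> {0..T}"
  shows "B-lipschitz_on {0..1} (dt T u t)"
proof (rule lipschitz_onI)
  show "0 \<le> B" using B[of 0 0] T by (auto intro: order_trans[OF abs_ge_zero])
  fix x y :: real assume xy: "x \<in> {0..1}" "y \<in> {0..1}"
  have inc: "\<bar>(u s x - u s y) - (u t x - u t y)\<bar> \<le> B * \<bar>x - y\<bar> * \<bar>s - t\<bar>" if s: "s \<in> {0..T}" for s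
  proof -
    define w where "w x = u s x - u t x" for x
    define w1 where "w1 x = dx u s x - dx u t x" for x
    define K where "K = B * \<bar>s - t\<bar>"
    have d0: "(w has_real_derivative w1 x) (at x within {0..1})" if "x \<in> {0..1}" for x
      unfolding w_def w1_def
      by (rule DERIV_diff[OF x_differentiable_has_derivative[OF u(1) s that]
            x_differentiable_has_derivative[OF u(1) t that]])
    have d1: "(w1 has_real_derivative dx (dx u) s x - dx (dx u) t x) (at x within {0..1})" if "x \<in> {0..1}" for x
      unfolding w1_def
      by (rule DERIV_diff[OF x_differentiable_has_derivative[OF u(2) s that]
            x_differentiable_has_derivative[OF u(2) t that]])
    have "\<bar>dx (dx u) s x - dx (dx u) t x\<bar> \<le> K" if "x \<in> {0..1}" for x
      unfolding K_def using that B s t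
      by (intro mvt_time[of T "\<lambda>s. dx (dx u) s x" "\<lambda>s. dt T (dx (dx u)) s x"]
          t_differentiable_has_derivative[OF u(4)]) auto
    from bounded_deriv_imp_Lipschitz[OF d1 this]
    have L1: "K-lipschitz_on {0..1} w1" by blast
    obtain z where z: "z \<in> {0<..<1}" "w1 z = 0"
      using mvt_unit_interval[OF d0, of 0 1] bc[OF s] bc[OF t] by (auto simp: w_def)
    have "\<bar>w1 x\<bar> \<le> K" if "x \<in> {0..1}" for x
    proof -
      have "\<bar>w1 x - w1 z\<bar> \<le> K * \<bar>x - z\<bar>"
        using lipschitz_onD[OF L1 that, of z] z by (auto simp: dist_real_def)
      also have "\<dots> \<le> K * 1"
        using lipschitz_on_nonneg[OF L1] that z by (intro mult_left_mono) auto
      finally show ?thesis using z by simp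
    qed
    from bounded_deriv_imp_Lipschitz[OF d0 this]
    have "K-lipschitz_on {0..1} w" by blast
    from lipschitz_onD[OF this xy] show ?thesis
      by (simp add: w_def K_def dist_real_def algebra_simps)
  qed
  have "((\<lambda>s. u s x - u s y) has_real_derivative dt T u t x - dt T u t y) (at t within {0..T})"
    by (rule DERIV_diff[OF t_differentiable_has_derivative[OF u(3) t xy(1)]
          t_differentiable_has_derivative[OF u(3) t xy(2)]])
  from deriv_le_if_Lipschitz_at[OF T t this, of "B * \<bar>x - y\<bar>"] inc
  show "dist (dt T u t x) (dt T u t y) \<le> B * dist x y" by (simp add: dist_real_def)
qed

lemma interp_deriv_sum:
  "interp_deriv m (\<lambda>x. \<Sum>i\<in>I. c i * f i x) x = (\<Sum>i\<in>I. c i * interp_deriv m (f i) x)"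
proof -
  obtain N X where m: "m = (N, X)" by (cases m)
  have "interp_deriv m (\<lambda>x. \<Sum>i\<in>I. c i * f i x) x =
      (\<Sum>j=1..N. \<Sum>i\<in>I. c i * (slope X (f i) j * indicator {X j<..<X (j + 1)} x))"
    unfolding m interp_deriv_def prod.case slope_sum sum_distrib_right
    by (intro sum.cong refl) (rule mult.assoc)
  also have "\<dots> = (\<Sum>i\<in>I. \<Sum>j=1..N. c i * (slope X (f i) j * indicator {X j<..<X (j + 1)} x))"
    by (rule sum.swap)
  also have "\<dots> = (\<Sum>i\<in>I. c i * interp_deriv m (f i) x)"
    unfolding m interp_deriv_def prod.case sum_distrib_left ..
  finally show ?thesis .
qed

lemma interp_deriv_eq_hat_sum:
  assumes "is_mesh m" shows "interp_deriv m v x = (\<Sum>y\<in>nodes m. v y * interp_deriv m (indicator {y}) x)"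
proof -
  have "interp_deriv m v = interp_deriv m (\<lambda>x. \<Sum>y\<in>nodes m. v y * indicator {y} x)"
    by (rule interp_cong(2)[OF assms]) (simp add: indicator_def finite_nodes if_distrib cong: if_cong)
  then show ?thesis by (simp add: interp_deriv_sum)
qed

lemma L2_inner_eq_integral:
  assumes "continuous_on {0..1} f" "continuous_on {0..1} g"
  shows "L2_inner f g = integral {0..1} (\<lambda>x. f x * g x)"
proof -
  have "ess_bounded (\<lambda>x. f x * g x)"
    by (intro ess_bounded_mult ess_bounded_continuous assms)
  then show ?thesis
    unfolding L2_inner_def
    by (subst lebesgue_integral_eq_integral) (auto intro: ess_bounded_integrable simp: integral_open_interval_real)
qed

text \<open>
  Orthogonality and integration by parts give \<open>((I u)\<^sub>x, \<psi>\<^sub>x) = (u\<^sub>x, \<psi>\<^sub>x) = - (u\<^sub>x\<^sub>x, \<psi>)\<close> at every time for the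
  interpolant \<open>I u\<close>. The time derivative is taken of the two outer expressions, so that the only mixed
  derivative that occurs is \<open>u\<^sub>x\<^sub>x\<^sub>t\<close>.
\<close>

lemma a_form_interp_dt:
  assumes m: "is_mesh m" and T: "0 < T"
    and u: "x_differentiable T u" "x_differentiable T (dx u)" "t_differentiable T u"
      "t_differentiable T (dx (dx u))" "jointly_continuous T (dx u)" "jointly_continuous T (dx (dx u))"
      "jointly_continuous T (dt T (dx (dx u)))"
    and \<psi>: "\<psi> \<in> S_h0 m" and t: "t \<in> {0..T}"
  shows "a_form (interp m (dt T u t)) \<psi> =
    L2_inner (interp m (dt T u t)) \<psi> - 1 / 3 * L2_inner (dt T (dx (dx u)) t) \<psi>"
proof -
  note \<psi>d = S_h_piecewise_deriv[OF m S_h0_subset[OF \<psi>]]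
  note \<psi>c = S_h_continuous[OF m S_h0_subset[OF \<psi>]]
  define J where "J s = L2_inner (interp_deriv m (u s)) (interp_deriv m \<psi>)" for s
  have J1: "J s = - integral {0..1} (\<lambda>x. dx (dx u) s x * \<psi> x)" if s: "s \<in> {0..T}" for s
  proof -
    have du: "has_piecewise_deriv (u s) (dx u s)"
      by (rule has_piecewise_deriv_C1) (auto intro!: x_differentiable_has_derivative u s jointly_continuous_slice)
    have ddu: "has_piecewise_deriv (dx u s) (dx (dx u) s)"
      by (rule has_piecewise_deriv_C1) (auto intro!: x_differentiable_has_derivative u s jointly_continuous_slice)
    have "J s = L2_inner (dx u s) (interp_deriv m \<psi>)"
      unfolding J_def by (rule interp_orthogonality[OF m du, symmetric])
    moreover have "(LINT x|unit_measure. dx (dx u) s x * \<psi> x + dx u s x * interp_deriv m \<psi> x) = 0"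
      using integral_piecewise_deriv[OF has_piecewise_deriv_mult[OF ddu \<psi>d]] \<psi> by (simp add: S_h0_def)
    then have "L2_inner (dx (dx u) s) \<psi> + L2_inner (dx u s) (interp_deriv m \<psi>) = 0"
      unfolding L2_inner_def
      using has_piecewise_deriv_ess_bounded[OF ddu] has_piecewise_deriv_ess_bounded[OF \<psi>d]
      by (subst (asm) Bochner_Integration.integral_add) (auto intro!: ess_bounded_integrable ess_bounded_mult)
    moreover have "L2_inner (dx (dx u) s) \<psi> = integral {0..1} (\<lambda>x. dx (dx u) s x * \<psi> x)"
      by (intro L2_inner_eq_integral jointly_continuous_slice[OF u(6) s] \<psi>c)
    ultimately show ?thesis by simp
  qed
  have J2: "(J has_real_derivative L2_inner (interp_deriv m (dt T u t)) (interp_deriv m \<psi>)) (at t within {0..T})"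
  proof -
    have exp: "L2_inner (interp_deriv m v) (interp_deriv m \<psi>) =
        (\<Sum>y\<in>nodes m. v y * L2_inner (interp_deriv m (indicator {y})) (interp_deriv m \<psi>))" for v
      unfolding interp_deriv_eq_hat_sum[OF m, of v, abs_def]
      by (rule L2_inner_sum_left(1)[OF finite_nodes]) (auto intro: interp_deriv_ess_bounded[OF m])
    have "J = (\<lambda>s. \<Sum>y\<in>nodes m. u s y * L2_inner (interp_deriv m (indicator {y})) (interp_deriv m \<psi>))"
      unfolding J_def by (rule ext) (rule exp)
    moreover have "((\<lambda>s. \<Sum>y\<in>nodes m. u s y * L2_inner (interp_deriv m (indicator {y})) (interp_deriv m \<psi>))
        has_real_derivative (\<Sum>y\<in>nodes m. dt T u t y * L2_inner (interp_deriv m (indicator {y})) (interp_deriv m \<psi>)))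
        (at t within {0..T})"
      using nodes_subset[OF m] t
      by (intro DERIV_sum DERIV_cmult_right t_differentiable_has_derivative[OF u(3)]) auto
    ultimately show ?thesis using exp[of "dt T u t"] by simp
  qed
  have "((\<lambda>s. integral (cbox 0 1) (\<lambda>x. dx (dx u) s x * \<psi> x)) has_real_derivative
      integral (cbox 0 1) (\<lambda>x. dt T (dx (dx u)) t x * \<psi> x)) (at t within {0..T})"
  proof (rule leibniz_rule_field_derivative)
    show "((\<lambda>s. dx (dx u) s x * \<psi> x) has_real_derivative dt T (dx (dx u)) s x * \<psi> x) (at s within {0..T})"
      if "s \<in> {0..T}" "x \<in> cbox 0 1" for s x
      using that by (intro DERIV_cmult_right t_differentiable_has_derivative u) auto
    show "(\<lambda>x. dx (dx u) s x * \<psi> x) integrable_on cbox 0 1" if "s \<in> {0..T}" for s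
      using jointly_continuous_slice[OF u(6) that] \<psi>c
      by (intro integrable_continuous continuous_intros) auto
    have "continuous_on ({0..T} \<times> {0..1}) (\<lambda>p. \<psi> (snd p))"
      by (rule continuous_on_compose2[OF \<psi>c]) (auto intro: continuous_intros)
    then show "continuous_on ({0..T} \<times> cbox 0 1) (\<lambda>(s, x). dt T (dx (dx u)) s x * \<psi> x)"
      using u(7) unfolding jointly_continuous_def split_def cbox_interval by (rule continuous_on_mult[rotated])
  qed (use t in auto)
  then have "((\<lambda>s. - integral {0..1} (\<lambda>x. dx (dx u) s x * \<psi> x)) has_real_derivative
      - integral {0..1} (\<lambda>x. dt T (dx (dx u)) t x * \<psi> x)) (at t within {0..T})"
    by (intro DERIV_minus) simp
  from has_real_derivative_transform[OF t J1 this]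
  have "(J has_real_derivative - integral {0..1} (\<lambda>x. dt T (dx (dx u)) t x * \<psi> x)) (at t within {0..T})" by blast
  from has_derivative_imp_dt[where w = "\<lambda>s _. J s" and x = 0, OF T t this]
    has_derivative_imp_dt[where w = "\<lambda>s _. J s" and x = 0, OF T t J2]
  have key: "L2_inner (interp_deriv m (dt T u t)) (interp_deriv m \<psi>) = - L2_inner (dt T (dx (dx u)) t) \<psi>"
    using L2_inner_eq_integral[OF jointly_continuous_slice[OF u(7) t] \<psi>c] by simp
  have "L2_inner (Dx (interp m (dt T u t))) (Dx \<psi>) = L2_inner (interp_deriv m (dt T u t)) (interp_deriv m \<psi>)"
    by (intro L2_inner_cong_AE interp_deriv_ess_bounded m Dx_AE_piecewise_deriv[OF interp_piecewise_deriv[OF m]]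
        Dx_AE_piecewise_deriv[OF \<psi>d])
  then show ?thesis using key by (simp add: a_form_def)
qed

definition Boussinesq_solution ::
  "real \<Rightarrow> real \<Rightarrow> real \<Rightarrow> real \<Rightarrow> (real \<Rightarrow> real \<Rightarrow> real) \<Rightarrow> (real \<Rightarrow> real \<Rightarrow> real) \<Rightarrow> bool" where
  "Boussinesq_solution T \<alpha> \<beta> \<gamma> \<eta> u \<longleftrightarrow>
    classically_smooth T \<eta> u \<and> (\<forall>t\<in>{0..T}. u t 0 = 0 \<and> u t 1 = 0) \<and>
    (\<forall>t\<in>{0..T}. \<forall>x\<in>{0..1}.
      dt T \<eta> t x + (dx u t x + \<alpha> * (dx \<eta> t x * u t x + \<eta> t x * dx u t x)) = 0 \<and>
      dt T u t x - 1 / 3 * dt T (dx (dx u)) t x +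
        (dx \<eta> t x + \<beta> * (u t x * dx u t x) + \<gamma> * (\<eta> t x * dx \<eta> t x)) = 0)"

definition regularity_bound ::
  "real \<Rightarrow> real \<Rightarrow> (real \<Rightarrow> real \<Rightarrow> real) \<Rightarrow> (real \<Rightarrow> real \<Rightarrow> real) \<Rightarrow> bool" where
  "regularity_bound T L \<eta> u \<longleftrightarrow> (\<forall>t\<in>{0..T}. \<forall>v\<in>{\<eta>, u}.
    L-lipschitz_on {0..1} (v t) \<and> L-lipschitz_on {0..1} (dx v t) \<and> L-lipschitz_on {0..1} (dt T v t) \<and>
    (\<forall>x\<in>{0..1}. \<bar>v t x\<bar> \<le> L \<and> \<bar>dx v t x\<bar> \<le> L))"

lemma lipschitz_on_mult:
  fixes f g :: "real \<Rightarrow> real"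
  assumes "K-lipschitz_on S f" "L-lipschitz_on S g" "\<And>x. x \<in> S \<Longrightarrow> \<bar>f x\<bar> \<le> A" "\<And>x. x \<in> S \<Longrightarrow> \<bar>g x\<bar> \<le> B"
    "0 \<le> A" "0 \<le> B"
  shows "(K * B + A * L)-lipschitz_on S (\<lambda>x. f x * g x)"
proof (rule lipschitz_onI)
  have KL: "0 \<le> K" "0 \<le> L" using assms(1,2) lipschitz_on_nonneg by blast+
  then show "0 \<le> K * B + A * L" using assms by simp
  fix x y assume xy: "x \<in> S" "y \<in> S"
  have "\<bar>f x * g x - f y * g y\<bar> = \<bar>(f x - f y) * g x + f y * (g x - g y)\<bar>" by (simp add: algebra_simps)
  also have "\<dots> \<le> \<bar>f x - f y\<bar> * \<bar>g x\<bar> + \<bar>f y\<bar> * \<bar>g x - g y\<bar>"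
    using abs_triangle_ineq[of "(f x - f y) * g x" "f y * (g x - g y)"] by (simp add: abs_mult)
  also have "\<dots> \<le> (K * \<bar>x - y\<bar>) * B + A * (L * \<bar>x - y\<bar>)"
    using lipschitz_onD[OF assms(1) xy] lipschitz_onD[OF assms(2) xy] assms(3)[OF xy(2)] assms(4)[OF xy(1)] KL assms(5,6)
    by (intro add_mono mult_mono) (auto simp: dist_real_def)
  finally show "dist (f x * g x) (f y * g y) \<le> (K * B + A * L) * dist x y"
    by (simp add: dist_real_def algebra_simps)
qed

text \<open>
  Among the required bounds, that on the Lipschitz constant of \<open>\<eta>\<^sub>t\<close> comes from the first equation, which
  expresses \<open>\<eta>\<^sub>t\<close> through \<open>\<eta>\<close>, \<open>u\<close> and their first derivatives in \<open>x\<close>.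
\<close>

lemma regularity_bound_exists:
  assumes T: "0 < T" and sol: "Boussinesq_solution T \<alpha> \<beta> \<gamma> \<eta> u"
    and W: "\<eta> \<in> C_time T (Winf 2) (Winf_norm 2)"
  shows "\<exists>L\<ge>0. regularity_bound T L \<eta> u"
proof -
  have sm: "classically_smooth T \<eta> u" and bc: "\<And>t. t \<in> {0..T} \<Longrightarrow> u t 0 = 0 \<and> u t 1 = 0"
    and pde: "\<And>t x. t \<in> {0..T} \<Longrightarrow> x \<in> {0..1} \<Longrightarrow>
      dt T \<eta> t x + (dx u t x + \<alpha> * (dx \<eta> t x * u t x + \<eta> t x * dx u t x)) = 0"
    using sol by (auto simp: Boussinesq_solution_def)
  note sm' = sm[unfolded classically_smooth_def]
  have ex: "\<exists>B. \<forall>t\<in>{0..T}. \<forall>x\<in>{0..1}. \<bar>v t x\<bar> \<le> B"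
    if "v \<in> {\<eta>, dx \<eta>, u, dx u, dx (dx u), dt T (dx (dx u))}" for v
    using that sm' by (intro jointly_continuous_bounded) auto
  define b where "b v = (SOME B. \<forall>t\<in>{0..T}. \<forall>x\<in>{0..1}. \<bar>v t x\<bar> \<le> B)" for v :: "real \<Rightarrow> real \<Rightarrow> real"
  have b: "\<bar>v t x\<bar> \<le> b v"
    if "v \<in> {\<eta>, dx \<eta>, u, dx u, dx (dx u), dt T (dx (dx u))}" "t \<in> {0..T}" "x \<in> {0..1}" for v t x
    using someI_ex[OF ex[OF that(1)]] that(2,3) unfolding b_def by blast
  have "\<exists>M\<ge>0. \<forall>t\<in>{0..T}. M-lipschitz_on {0..1} (dx \<eta> t)"
    by (rule C_time_Winf_imp_Lipschitz_deriv[OF W])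
      (use sm' in \<open>blast intro: x_differentiable_has_derivative jointly_continuous_slice\<close>)+
  then obtain M where M: "0 \<le> M" "\<And>t. t \<in> {0..T} \<Longrightarrow> M-lipschitz_on {0..1} (dx \<eta> t)" by blast
  define B where "B = M + \<bar>b \<eta>\<bar> + \<bar>b (dx \<eta>)\<bar> + \<bar>b u\<bar> + \<bar>b (dx u)\<bar> + \<bar>b (dx (dx u))\<bar> + \<bar>b (dt T (dx (dx u)))\<bar>"
  have B0: "0 \<le> B" using M by (simp add: B_def)
  have Bb: "\<bar>v t x\<bar> \<le> B" if "v \<in> {\<eta>, dx \<eta>, u, dx u, dx (dx u), dt T (dx (dx u))}" "t \<in> {0..T}" "x \<in> {0..1}" for v t x
  proof -
    have "b v \<le> B" using that(1) M(1) unfolding B_def by auto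
    then show ?thesis using b[OF that] by linarith
  qed
  define L where "L = B + \<bar>\<alpha>\<bar> * (4 * B\<^sup>2) + B"
  have LB: "B \<le> L" using B0 by (simp add: L_def)
  have lip: "B-lipschitz_on {0..1} (\<eta> t)" "B-lipschitz_on {0..1} (u t)" "B-lipschitz_on {0..1} (dx u t)"
    "B-lipschitz_on {0..1} (dx \<eta> t)" "B-lipschitz_on {0..1} (dt T u t)" if t: "t \<in> {0..T}" for t
  proof -
    show "B-lipschitz_on {0..1} (\<eta> t)"
      using sm' t by (intro bounded_deriv_imp_Lipschitz[of _ "dx \<eta> t"] x_differentiable_has_derivative Bb) auto
    show "B-lipschitz_on {0..1} (u t)"
      using sm' t by (intro bounded_deriv_imp_Lipschitz[of _ "dx u t"] x_differentiable_has_derivative Bb) auto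
    show "B-lipschitz_on {0..1} (dx u t)"
      using sm' t by (intro bounded_deriv_imp_Lipschitz[of _ "dx (dx u) t"] x_differentiable_has_derivative Bb) auto
    show "B-lipschitz_on {0..1} (dx \<eta> t)"
      by (rule lipschitz_on_le[OF M(2)[OF t]]) (simp add: B_def)
    show "B-lipschitz_on {0..1} (dt T u t)"
      using sm' bc t Bb by (intro dt_Lipschitz_from_second_derivative[OF T]) auto
  qed
  have "L-lipschitz_on {0..1} (dt T \<eta> t)" if t: "t \<in> {0..T}" for t
  proof -
    have p: "(B * B + B * B)-lipschitz_on {0..1} (\<lambda>x. dx \<eta> t x * u t x)"
      "(B * B + B * B)-lipschitz_on {0..1} (\<lambda>x. \<eta> t x * dx u t x)"
      using lip[OF t] Bb t B0 by (intro lipschitz_on_mult; simp)+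
    have "(\<bar>- 1\<bar> * (B + \<bar>\<alpha>\<bar> * ((B * B + B * B) + (B * B + B * B))))-lipschitz_on {0..1}
        (\<lambda>x. - 1 *\<^sub>R (dx u t x + \<alpha> *\<^sub>R (dx \<eta> t x * u t x + \<eta> t x * dx u t x)))"
      by (intro lipschitz_on_cmult lipschitz_on_add p lip t)
    then have "L-lipschitz_on {0..1} (\<lambda>x. - 1 *\<^sub>R (dx u t x + \<alpha> *\<^sub>R (dx \<eta> t x * u t x + \<eta> t x * dx u t x)))"
      by (rule lipschitz_on_le) (use B0 in \<open>simp add: L_def power2_eq_square\<close>)
    moreover have "dt T \<eta> t x = - 1 *\<^sub>R (dx u t x + \<alpha> *\<^sub>R (dx \<eta> t x * u t x + \<eta> t x * dx u t x))" if "x \<in> {0..1}" for x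
      using pde[OF t that] by simp
    ultimately show ?thesis unfolding lipschitz_on_def by simp
  qed
  moreover have "L-lipschitz_on {0..1} f" if "B-lipschitz_on {0..1} f" for f :: "real \<Rightarrow> real"
    using that LB by (rule lipschitz_on_le)
  moreover have "\<bar>v t x\<bar> \<le> L" if "v \<in> {\<eta>, dx \<eta>, u, dx u, dx (dx u), dt T (dx (dx u))}" "t \<in> {0..T}" "x \<in> {0..1}" for v t x
    using Bb[OF that] LB by linarith
  ultimately have "regularity_bound T L \<eta> u"
    unfolding regularity_bound_def using lip by (intro ballI conjI; elim insertE emptyE; simp)
  then show ?thesis using B0 LB by (intro exI[of _ L]) auto
qed

lemma abs_mult_le:
  fixes x y :: real assumes "\<bar>x\<bar> \<le> A" "\<bar>y\<bar> \<le> B" shows "\<bar>x * y\<bar> \<le> A * B"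
  unfolding abs_mult using assms by (intro mult_mono) auto

text \<open>
  Here and in the next lemma \<open>a\<close> stands for errors of \<open>\<eta>\<close>, \<open>b\<close> for errors of \<open>u\<close>, with the index counting
  derivatives, \<open>e2\<close> for the error of a derivative, \<open>e1\<close> for the error of a time derivative, and
  \<open>H = L h\<close>.
\<close>

lemma consistency_bound1:
  fixes H L \<alpha> e1 e2 a0 a1 b0 U Ux \<eta> \<eta>x :: real
  assumes "0 \<le> H" "0 \<le> L" "\<bar>e1\<bar> \<le> 2 * H" "\<bar>e2\<bar> \<le> H" "\<bar>a1\<bar> \<le> H" "\<bar>U\<bar> \<le> 3 * L" "\<bar>\<eta>x\<bar> \<le> L" "\<bar>b0\<bar> \<le> 2 * H"
    "\<bar>a0\<bar> \<le> 2 * H" "\<bar>Ux\<bar> \<le> L" "\<bar>\<eta>\<bar> \<le> L"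
  shows "\<bar>e1 + e2 + \<alpha> * (a1 * U + \<eta>x * b0 + a0 * Ux + \<eta> * e2)\<bar> \<le> (3 + 8 * \<bar>\<alpha>\<bar> * L) * H"
proof -
  have 1: "p + q + r + s \<le> 8 * (L * H)" if "p \<le> H * (3 * L)" "q \<le> L * (2 * H)" "r \<le> 2 * H * L" "s \<le> L * H"
    for p q r s :: real using that by (simp add: mult_ac)
  have "\<bar>a1 * U + \<eta>x * b0 + a0 * Ux + \<eta> * e2\<bar> \<le> \<bar>a1 * U\<bar> + \<bar>\<eta>x * b0\<bar> + \<bar>a0 * Ux\<bar> + \<bar>\<eta> * e2\<bar>"
    by linarith
  also have "\<dots> \<le> 8 * (L * H)"
    by (rule 1[OF abs_mult_le[OF assms(5,6)] abs_mult_le[OF assms(7,8)] abs_mult_le[OF assms(9,10)] abs_mult_le[OF assms(11,4)]])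
  finally have "\<bar>\<alpha>\<bar> * \<bar>a1 * U + \<eta>x * b0 + a0 * Ux + \<eta> * e2\<bar> \<le> \<bar>\<alpha>\<bar> * (8 * (L * H))" by (intro mult_left_mono) auto
  then have "\<bar>\<alpha> * (a1 * U + \<eta>x * b0 + a0 * Ux + \<eta> * e2)\<bar> \<le> 8 * \<bar>\<alpha>\<bar> * L * H" by (simp add: abs_mult)
  then show ?thesis using assms(3,4) by (simp add: distrib_right)
qed

lemma consistency_bound2:
  fixes H L \<beta> \<gamma> e1 e2 a0 b0 b1 Zx Ux \<eta> u :: real
  assumes "0 \<le> H" "0 \<le> L" "\<bar>e1\<bar> \<le> 2 * H" "\<bar>e2\<bar> \<le> H" "\<bar>a0\<bar> \<le> 2 * H" "\<bar>b0\<bar> \<le> 2 * H" "\<bar>b1\<bar> \<le> H"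
    "\<bar>Zx\<bar> \<le> L" "\<bar>Ux\<bar> \<le> L" "\<bar>\<eta>\<bar> \<le> L" "\<bar>u\<bar> \<le> L"
  shows "\<bar>e1 + e2 + \<beta> * (b0 * Ux + u * b1) + \<gamma> * (a0 * Zx + \<eta> * e2)\<bar> \<le> (3 + 3 * (\<bar>\<beta>\<bar> + \<bar>\<gamma>\<bar>) * L) * H"
proof -
  have 1: "\<bar>p + q\<bar> \<le> 3 * (L * H)" if "\<bar>p\<bar> \<le> 2 * H * L" "\<bar>q\<bar> \<le> L * H" for p q :: real
    using abs_triangle_ineq[of p q] that by (simp add: mult_ac)
  have "\<bar>b0 * Ux + u * b1\<bar> \<le> 3 * (L * H)" "\<bar>a0 * Zx + \<eta> * e2\<bar> \<le> 3 * (L * H)"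
    by (rule 1[OF abs_mult_le[OF assms(6,9)] abs_mult_le[OF assms(11,7)]])
      (rule 1[OF abs_mult_le[OF assms(5,8)] abs_mult_le[OF assms(10,4)]])
  then have "\<bar>\<beta>\<bar> * \<bar>b0 * Ux + u * b1\<bar> \<le> \<bar>\<beta>\<bar> * (3 * (L * H))" "\<bar>\<gamma>\<bar> * \<bar>a0 * Zx + \<eta> * e2\<bar> \<le> \<bar>\<gamma>\<bar> * (3 * (L * H))"
    by (auto intro!: mult_left_mono)
  then have "\<bar>\<beta> * (b0 * Ux + u * b1)\<bar> \<le> 3 * \<bar>\<beta>\<bar> * L * H" "\<bar>\<gamma> * (a0 * Zx + \<eta> * e2)\<bar> \<le> 3 * \<bar>\<gamma>\<bar> * L * H"
    by (simp_all add: abs_mult)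
  then show ?thesis using assms(3,4) by (simp add: distrib_right distrib_left)
qed

lemma interp_W1inf:
  assumes m: "is_mesh m" and L: "L-lipschitz_on {0..1} v" and b: "\<And>x. x \<in> {0..1} \<Longrightarrow> \<bar>v x\<bar> \<le> L"
  shows "x \<in> {0..1} \<Longrightarrow> \<bar>interp m v x\<bar> \<le> 3 * L" and "W1inf_bound (3 * L) (interp m v)"
proof -
  have L0: "0 \<le> L" by (rule lipschitz_on_nonneg[OF L])
  show 1: "\<bar>interp m v x\<bar> \<le> 3 * L" if x: "x \<in> {0..1}" for x
  proof -
    have "2 * L * mesh_size m \<le> 2 * L * 1" using L0 mesh_size_le_1[OF m] by (intro mult_left_mono) auto
    then show ?thesis using interp_error_Lipschitz[OF m L x] b[OF x] by linarith
  qed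
  have "\<bar>interp_deriv m v x\<bar> \<le> 3 * L" for x using interp_deriv_bound[OF m L, of x] L0 by linarith
  then have "AE x in unit_measure. \<bar>Dx (interp m v) x\<bar> \<le> 3 * L"
    using Dx_AE_piecewise_deriv[OF interp_piecewise_deriv[OF m, of v]] by (auto elim: eventually_mono)
  then show "W1inf_bound (3 * L) (interp m v)"
    unfolding W1inf_bound_def using 1 by (auto intro!: AE_unit_measureI)
qed

text \<open>
  Subtracting the differential equations from the definitions of \<open>r1\<close> and \<open>r2\<close> leaves interpolation errors
  of \<open>\<eta>\<close>, \<open>u\<close>, their \<open>x\<close>-derivatives and their \<open>t\<close>-derivatives, each of them \<open>O(h)\<close>.
\<close>

lemma interp_consistency:
  assumes m: "is_mesh m" and T: "0 < T" and sol: "Boussinesq_solution T \<alpha> \<beta> \<gamma> \<eta> u"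
    and reg: "regularity_bound T L \<eta> u" and t: "t \<in> {0..T}"
  defines "Z \<equiv> \<lambda>t. interp m (\<eta> t)" and "U \<equiv> \<lambda>t. interp m (u t)"
  defines "r1 \<equiv> \<lambda>x. dt T Z t x + Dx (flux1 \<alpha> (Z t) (U t)) x"
    and "r2 \<equiv> \<lambda>x. dt T U t x - 1 / 3 * dt T (dx (dx u)) t x + Dx (flux2 \<beta> \<gamma> (Z t) (U t)) x"
    and "c \<equiv> (3 + 8 * (\<bar>\<alpha>\<bar> + \<bar>\<beta>\<bar> + \<bar>\<gamma>\<bar>) * L) * (L * mesh_size m)"
  shows "galerkin T m \<alpha> \<beta> \<gamma> r1 r2 Z U t" "ess_bounded r1 \<and> ess_bounded r2"
    "(AE x in unit_measure. \<bar>r1 x\<bar> \<le> c) \<and> (AE x in unit_measure. \<bar>r2 x\<bar> \<le> c)"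
proof -
  have sm: "classically_smooth T \<eta> u"
    and pde: "\<And>x. x \<in> {0..1} \<Longrightarrow> dt T \<eta> t x + (dx u t x + \<alpha> * (dx \<eta> t x * u t x + \<eta> t x * dx u t x)) = 0"
      "\<And>x. x \<in> {0..1} \<Longrightarrow> dt T u t x - 1 / 3 * dt T (dx (dx u)) t x +
        (dx \<eta> t x + \<beta> * (u t x * dx u t x) + \<gamma> * (\<eta> t x * dx \<eta> t x)) = 0"
    using sol t by (auto simp: Boussinesq_solution_def)
  note sm' = sm[unfolded classically_smooth_def]
  have R: "L-lipschitz_on {0..1} (\<eta> t)" "L-lipschitz_on {0..1} (dx \<eta> t)" "L-lipschitz_on {0..1} (dt T \<eta> t)"
    "L-lipschitz_on {0..1} (u t)" "L-lipschitz_on {0..1} (dx u t)" "L-lipschitz_on {0..1} (dt T u t)"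
    "\<And>x. x \<in> {0..1} \<Longrightarrow> \<bar>\<eta> t x\<bar> \<le> L" "\<And>x. x \<in> {0..1} \<Longrightarrow> \<bar>u t x\<bar> \<le> L"
    "\<And>x. x \<in> {0..1} \<Longrightarrow> \<bar>dx \<eta> t x\<bar> \<le> L" "\<And>x. x \<in> {0..1} \<Longrightarrow> \<bar>dx u t x\<bar> \<le> L"
    using reg t by (auto simp: regularity_bound_def)
  have L0: "0 \<le> L" by (rule lipschitz_on_nonneg[OF R(1)])
  define H where "H = L * mesh_size m"
  have H0: "0 \<le> H" using L0 mesh_size_pos[OF m] by (simp add: H_def)
  have dtZ: "dt T Z t = interp m (dt T \<eta> t)" "dt T U t = interp m (dt T u t)"
    unfolding Z_def U_def using interp_curve(2)[OF m T _ t] sm' by auto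
  have pwZ: "piecewise_C1 (Z t)" "piecewise_C1 (U t)"
    unfolding Z_def U_def by (intro S_h_piecewise_C1[OF m] interp_in_S_h[OF m])+
  note F1 = Dx_flux1[OF pwZ, of \<alpha>] and F2 = Dx_flux2[OF pwZ, of \<beta> \<gamma>]
  have eb: "ess_bounded (dt T Z t)" "ess_bounded (dt T U t)" "ess_bounded (dt T (dx (dx u)) t)"
    "ess_bounded (Dx (flux1 \<alpha> (Z t) (U t)))" "ess_bounded (Dx (flux2 \<beta> \<gamma> (Z t) (U t)))"
  proof -
    show "ess_bounded (dt T Z t)" "ess_bounded (dt T U t)"
      unfolding dtZ by (intro piecewise_C1_ess_bounded(1) S_h_piecewise_C1[OF m] interp_in_S_h[OF m])+
    show "ess_bounded (dt T (dx (dx u)) t)"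
      using sm' t by (intro ess_bounded_continuous jointly_continuous_slice) auto
    show "ess_bounded (Dx (flux1 \<alpha> (Z t) (U t)))" "ess_bounded (Dx (flux2 \<beta> \<gamma> (Z t) (U t)))"
      by (intro piecewise_C1_ess_bounded(2) F1(1) F2(1))+
  qed
  show "ess_bounded r1 \<and> ess_bounded r2"
    unfolding r1_def r2_def by (intro conjI ess_bounded_intros eb)
  show "galerkin T m \<alpha> \<beta> \<gamma> r1 r2 Z U t"
    unfolding galerkin_def
  proof (intro conjI ballI)
    fix \<phi> assume "\<phi> \<in> S_h m"
    then have "ess_bounded \<phi>" using piecewise_C1_ess_bounded(1) S_h_piecewise_C1[OF m] by blast
    then show "L2_inner (dt T Z t) \<phi> + L2_inner (Dx (flux1 \<alpha> (Z t) (U t))) \<phi> = L2_inner r1 \<phi>"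
      unfolding r1_def by (simp add: L2_inner_add_left eb)
  next
    fix \<psi> assume \<psi>: "\<psi> \<in> S_h0 m"
    then have b: "ess_bounded \<psi>" using piecewise_C1_ess_bounded(1) S_h_piecewise_C1[OF m S_h0_subset] by blast
    have "a_form (dt T U t) \<psi> = L2_inner (dt T U t) \<psi> - 1 / 3 * L2_inner (dt T (dx (dx u)) t) \<psi>"
      unfolding dtZ using sm' by (intro a_form_interp_dt[OF m T _ _ _ _ _ _ _ \<psi> t]) auto
    moreover have "L2_inner r2 \<psi> = (L2_inner (dt T U t) \<psi> - 1 / 3 * L2_inner (dt T (dx (dx u)) t) \<psi>) +
        L2_inner (Dx (flux2 \<beta> \<gamma> (Z t) (U t))) \<psi>"
      unfolding r2_def
      by (simp only: L2_inner_add_left L2_inner_diff_left L2_inner_cmult_left ess_bounded_diff ess_bounded_cmult eb b)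
    ultimately show "a_form (dt T U t) \<psi> + L2_inner (Dx (flux2 \<beta> \<gamma> (Z t) (U t))) \<psi> = L2_inner r2 \<psi>" by simp
  qed
  have off: "AE x in unit_measure. x \<in> {0<..<1} - nodes m"
    by (rule AE_unit_measure_finite_exception[OF finite_nodes]) auto
  have DZ: "AE x in unit_measure. Dx (Z t) x = interp_deriv m (\<eta> t) x"
    and DU: "AE x in unit_measure. Dx (U t) x = interp_deriv m (u t) x"
    unfolding Z_def U_def by (intro Dx_AE_piecewise_deriv interp_piecewise_deriv m)+
  have le1: "(3 + 8 * \<bar>\<alpha>\<bar> * L) * H \<le> c" and le2: "(3 + 3 * (\<bar>\<beta>\<bar> + \<bar>\<gamma>\<bar>) * L) * H \<le> c"
    unfolding c_def H_def[symmetric] using L0 H0 by (intro mult_right_mono add_mono; simp add: mult_right_mono)+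
  have facts: "\<bar>interp m (dt T \<eta> t) x - dt T \<eta> t x\<bar> \<le> 2 * H" "\<bar>interp m (dt T u t) x - dt T u t x\<bar> \<le> 2 * H"
    "\<bar>Z t x - \<eta> t x\<bar> \<le> 2 * H" "\<bar>U t x - u t x\<bar> \<le> 2 * H" "\<bar>U t x\<bar> \<le> 3 * L"
    "\<bar>interp_deriv m (\<eta> t) x - dx \<eta> t x\<bar> \<le> H" "\<bar>interp_deriv m (u t) x - dx u t x\<bar> \<le> H"
    "\<bar>interp_deriv m (\<eta> t) x\<bar> \<le> L" "\<bar>interp_deriv m (u t) x\<bar> \<le> L" if x: "x \<in> {0<..<1} - nodes m" for x
  proof -
    have x': "x \<in> {0..1}" using x by auto
    show "\<bar>interp m (dt T \<eta> t) x - dt T \<eta> t x\<bar> \<le> 2 * H" "\<bar>interp m (dt T u t) x - dt T u t x\<bar> \<le> 2 * H"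
      "\<bar>Z t x - \<eta> t x\<bar> \<le> 2 * H" "\<bar>U t x - u t x\<bar> \<le> 2 * H"
      using interp_error_Lipschitz[OF m R(3) x'] interp_error_Lipschitz[OF m R(6) x']
        interp_error_Lipschitz[OF m R(1) x'] interp_error_Lipschitz[OF m R(4) x']
      by (simp_all add: H_def Z_def U_def abs_minus_commute)
    show "\<bar>U t x\<bar> \<le> 3 * L" unfolding U_def by (rule interp_W1inf(1)[OF m R(4,8) x'])
    show "\<bar>interp_deriv m (\<eta> t) x - dx \<eta> t x\<bar> \<le> H" "\<bar>interp_deriv m (u t) x - dx u t x\<bar> \<le> H"
      using interp_deriv_error[OF m x_differentiable_has_derivative[OF _ t] R(2) x]
        interp_deriv_error[OF m x_differentiable_has_derivative[OF _ t] R(5) x] sm'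
      by (simp_all add: H_def abs_minus_commute)
    show "\<bar>interp_deriv m (\<eta> t) x\<bar> \<le> L" "\<bar>interp_deriv m (u t) x\<bar> \<le> L"
      using interp_deriv_bound[OF m R(1)] interp_deriv_bound[OF m R(4)] by auto
  qed
  show "(AE x in unit_measure. \<bar>r1 x\<bar> \<le> c) \<and> (AE x in unit_measure. \<bar>r2 x\<bar> \<le> c)"
  proof
    show "AE x in unit_measure. \<bar>r1 x\<bar> \<le> c"
      using off DZ DU F1(2)
    proof eventually_elim
      case (elim x)
      then have x': "x \<in> {0..1}" by auto
      have "r1 x = (interp m (dt T \<eta> t) x - dt T \<eta> t x) + (interp_deriv m (u t) x - dx u t x) +
          \<alpha> * ((interp_deriv m (\<eta> t) x - dx \<eta> t x) * U t x + dx \<eta> t x * (U t x - u t x) +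
            (Z t x - \<eta> t x) * interp_deriv m (u t) x + \<eta> t x * (interp_deriv m (u t) x - dx u t x))"
        unfolding r1_def dtZ elim(4) elim(2,3) using pde(1)[OF x'] by (simp add: algebra_simps)
      also have "\<bar>\<dots>\<bar> \<le> (3 + 8 * \<bar>\<alpha>\<bar> * L) * H"
        using facts[OF elim(1)] R(7,9)[OF x'] by (intro consistency_bound1 H0 L0)
      finally show ?case using le1 by linarith
    qed
    show "AE x in unit_measure. \<bar>r2 x\<bar> \<le> c"
      using off DZ DU F2(2)
    proof eventually_elim
      case (elim x)
      then have x': "x \<in> {0..1}" by auto
      have "r2 x = (interp m (dt T u t) x - dt T u t x) + (interp_deriv m (\<eta> t) x - dx \<eta> t x) +
          \<beta> * ((U t x - u t x) * interp_deriv m (u t) x + u t x * (interp_deriv m (u t) x - dx u t x)) +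
          \<gamma> * ((Z t x - \<eta> t x) * interp_deriv m (\<eta> t) x + \<eta> t x * (interp_deriv m (\<eta> t) x - dx \<eta> t x))"
        unfolding r2_def dtZ elim(4) elim(2,3) using pde(2)[OF x'] by (simp add: algebra_simps)
      also have "\<bar>\<dots>\<bar> \<le> (3 + 3 * (\<bar>\<beta>\<bar> + \<bar>\<gamma>\<bar>) * L) * H"
        using facts[OF elim(1)] R(7,8)[OF x'] by (intro consistency_bound2 H0 L0)
      finally show ?case using le2 by linarith
    qed
  qed
qed

section \<open>Projections and initial errors\<close>

lemma L2_proj_exists:
  assumes m: "is_mesh m" and v: "ess_bounded v"
  shows "L2_proj m v \<in> S_h m \<and> (\<forall>\<phi>\<in>S_h m. L2_inner (L2_proj m v) \<phi> = L2_inner v \<phi>)"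
proof -
  obtain n e where e: "\<And>i. i < n \<Longrightarrow> e i \<in> S_h m" and "orthonormal L2_inner e n"
    and sp: "\<And>\<phi> x. \<phi> \<in> S_h m \<Longrightarrow> x \<in> {0..1} \<Longrightarrow> \<phi> x = (\<Sum>k<n. L2_inner \<phi> (e k) * e k x)"
    using S_h_orthonormal_basis[OF m] by blast
  note eb = piecewise_C1_ess_bounded(1)[OF S_h_piecewise_C1[OF m]]
  define p where "p x = (\<Sum>k<n. L2_inner v (e k) * e k x)" for x
  have "p \<in> S_h m" unfolding p_def[abs_def] using e by (intro S_h_sum[OF m]) auto
  moreover have "L2_inner p \<phi> = L2_inner v \<phi>" if \<phi>: "\<phi> \<in> S_h m" for \<phi>
  proof -
    have "L2_inner p \<phi> = (\<Sum>k<n. L2_inner v (e k) * L2_inner (e k) \<phi>)"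
      unfolding p_def[abs_def] by (rule L2_inner_sum_left(1)) (auto intro!: eb e \<phi>)
    moreover have "L2_inner v \<phi> = L2_inner (\<lambda>x. \<Sum>k<n. L2_inner \<phi> (e k) * e k x) v"
      unfolding L2_inner_commute[of v] using sp[OF \<phi>] by (intro L2_inner_cong) auto
    moreover have "\<dots> = (\<Sum>k<n. L2_inner \<phi> (e k) * L2_inner (e k) v)"
      by (rule L2_inner_sum_left(1)) (auto intro!: eb e v)
    moreover have "\<dots> = (\<Sum>k<n. L2_inner v (e k) * L2_inner (e k) \<phi>)"
      by (intro sum.cong refl) (simp add: L2_inner_commute[where g = "e k" for k] mult.commute)
    ultimately show ?thesis by simp
  qed
  ultimately have "\<exists>p. p \<in> S_h m \<and> (\<forall>\<phi>\<in>S_h m. L2_inner p \<phi> = L2_inner v \<phi>)" by blast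
  then show ?thesis unfolding L2_proj_def by (rule someI_ex)
qed

lemma a_form_inner_form_piecewise_C1: "inner_form_on {f. piecewise_C1 f} a_form"
  unfolding inner_form_on_def
  by (auto simp: piecewise_C1_const a_form_lincomb a_form_nonneg intro!: Dx_add(1) Dx_cmult(1) intro: a_form_commute)

lemma R_h_exists:
  assumes m: "is_mesh m" and w: "piecewise_C1 w"
  shows "R_h m w \<in> S_h0 m \<and> (\<forall>\<psi>\<in>S_h0 m. a_form (R_h m w) \<psi> = a_form w \<psi>)"
proof -
  obtain n f where f: "\<And>i. i < n \<Longrightarrow> f i \<in> S_h0 m" and "orthonormal a_form f n"
    and sp: "\<And>\<psi> x. \<psi> \<in> S_h0 m \<Longrightarrow> x \<in> {0..1} \<Longrightarrow> \<psi> x = (\<Sum>k<n. a_form \<psi> (f k) * f k x)"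
    using S_h0_orthonormal_basis[OF m] by blast
  note pw = S_h_piecewise_C1[OF m S_h0_subset]
  note B = a_form_inner_form_piecewise_C1
  define p where "p x = (\<Sum>k<n. a_form w (f k) * f k x)" for x
  have zS: "(\<lambda>_. 0) \<in> S_h0 m" using a_form_inner_form_S_h0[OF m] by (simp add: inner_form_on_def)
  have "p \<in> S_h0 m" unfolding p_def[abs_def]
    using inner_form_sum(1)[OF a_form_inner_form_S_h0[OF m] _ _ zS, of "{..<n}" f] f by simp
  moreover have "a_form p \<psi> = a_form w \<psi>" if \<psi>: "\<psi> \<in> S_h0 m" for \<psi>
  proof -
    have "a_form p \<psi> = (\<Sum>k<n. a_form w (f k) * a_form (f k) \<psi>)"
      unfolding p_def[abs_def] by (rule inner_form_sum(2)[OF B]) (auto intro!: pw f \<psi>)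
    moreover have "a_form w \<psi> = a_form (\<lambda>x. \<Sum>k<n. a_form \<psi> (f k) * f k x) w"
      unfolding a_form_commute[of w]
    proof (rule a_form_cong[OF _ w])
      show "piecewise_C1 (\<lambda>x. \<Sum>k<n. a_form \<psi> (f k) * f k x)" by (intro Dx_sum(1) pw f) auto
      show "\<psi> x = (\<Sum>k<n. a_form \<psi> (f k) * f k x)" if "x \<in> {0..1}" for x by (rule sp[OF \<psi> that])
    qed auto
    moreover have "\<dots> = (\<Sum>k<n. a_form \<psi> (f k) * a_form (f k) w)"
      by (rule inner_form_sum(2)[OF B]) (auto intro!: pw f w)
    moreover have "\<dots> = (\<Sum>k<n. a_form w (f k) * a_form (f k) \<psi>)"
      by (intro sum.cong refl) (simp add: a_form_commute[where g = "f k" for k] mult.commute)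
    ultimately show ?thesis by simp
  qed
  ultimately have "\<exists>r. r \<in> S_h0 m \<and> (\<forall>\<psi>\<in>S_h0 m. a_form r \<psi> = a_form w \<psi>)" by blast
  then show ?thesis unfolding R_h_def by (rule someI_ex)
qed

text \<open>
  The hypothesis says that \<open>d\<close> is the orthogonal projection of \<open>w\<close> onto the line through \<open>d\<close>.
\<close>

lemma projection_norm_le:
  assumes B: "inner_form_on V B" and w: "w \<in> V" and d: "d \<in> V" and eq: "B w d = B d d"
  shows "B d d \<le> B w w"
proof -
  let ?f = "\<lambda>x. 1 * w x + (- 1) * d x"
  have f: "?f \<in> V" by (rule inner_form_onD(1)[OF B w d])
  have "0 \<le> B ?f ?f" by (rule inner_form_onD(3)[OF B f f])
  also have "B ?f ?f = B w ?f - B d ?f" using inner_form_onD(4)[OF B w d f, of 1 "-1"] by simp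
  also have "B w ?f = B w w - B d w"
    using inner_form_onD(2)[OF B w f] inner_form_onD(4)[OF B w d w, of 1 "-1"] by simp
  also have "B d ?f = B w d - B d d"
    using inner_form_onD(2)[OF B d f] inner_form_onD(4)[OF B w d d, of 1 "-1"] by simp
  finally show ?thesis using eq inner_form_onD(2)[OF B w d] by simp
qed

lemma interp_error_norms:
  assumes m: "is_mesh m"
    and d: "\<And>x. x \<in> {0..1} \<Longrightarrow> (v has_real_derivative g x) (at x within {0..1})"
    and L: "L-lipschitz_on {0..1} v" "L-lipschitz_on {0..1} g"
  shows "L2_inner (\<lambda>x. v x - interp m v x) (\<lambda>x. v x - interp m v x) \<le> 4 * L\<^sup>2 * (mesh_size m)\<^sup>2"
    and "a_form (\<lambda>x. v x - interp m v x) (\<lambda>x. v x - interp m v x) \<le> 5 * L\<^sup>2 * (mesh_size m)\<^sup>2"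
    and "piecewise_C1 v"
proof -
  have vd: "has_piecewise_deriv v g"
    by (rule has_piecewise_deriv_C1[OF d lipschitz_on_continuous_on[OF L(2)]])
  then show pwv: "piecewise_C1 v" unfolding piecewise_C1_def by blast
  have pwI: "piecewise_C1 (interp m v)" by (rule S_h_piecewise_C1[OF m interp_in_S_h[OF m]])
  note D = Dx_diff[OF pwv pwI]
  note e = piecewise_C1_ess_bounded[OF D(1)]
  have L0: "0 \<le> L" by (rule lipschitz_on_nonneg[OF L(1)])
  have "L2_inner (\<lambda>x. v x - interp m v x) (\<lambda>x. v x - interp m v x) \<le> (2 * L * mesh_size m)\<^sup>2"
    using interp_error_Lipschitz[OF m L(1)] by (intro L2_inner_le_bound e AE_unit_measureI) auto
  then show 1: "L2_inner (\<lambda>x. v x - interp m v x) (\<lambda>x. v x - interp m v x) \<le> 4 * L\<^sup>2 * (mesh_size m)\<^sup>2"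
    by (simp add: power_mult_distrib)
  have off: "AE x in unit_measure. x \<in> {0<..<1} - nodes m"
    by (rule AE_unit_measure_finite_exception[OF finite_nodes]) auto
  have "AE x in unit_measure. \<bar>Dx (\<lambda>x. v x - interp m v x) x\<bar> \<le> L * mesh_size m"
    using off D(2) Dx_AE_piecewise_deriv[OF vd] Dx_AE_piecewise_deriv[OF interp_piecewise_deriv[OF m, of v]]
  proof eventually_elim
    case (elim x)
    then show ?case using interp_deriv_error[OF m d L(2) elim(1)] by simp
  qed
  then have "L2_inner (Dx (\<lambda>x. v x - interp m v x)) (Dx (\<lambda>x. v x - interp m v x)) \<le> (L * mesh_size m)\<^sup>2"
    by (intro L2_inner_le_bound e)
  then have 2: "L2_inner (Dx (\<lambda>x. v x - interp m v x)) (Dx (\<lambda>x. v x - interp m v x)) \<le> L\<^sup>2 * (mesh_size m)\<^sup>2"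
    by (simp add: power_mult_distrib)
  have "0 \<le> L\<^sup>2 * (mesh_size m)\<^sup>2" by simp
  with 1 2 show "a_form (\<lambda>x. v x - interp m v x) (\<lambda>x. v x - interp m v x) \<le> 5 * L\<^sup>2 * (mesh_size m)\<^sup>2"
    unfolding a_form_def by linarith
qed

text \<open>
  The difference \<open>I v - P v\<close> is the projection of \<open>I v - v\<close>, hence not longer than it.
\<close>

lemma L2_proj_interp_error:
  assumes m: "is_mesh m"
    and d: "\<And>x. x \<in> {0..1} \<Longrightarrow> (v has_real_derivative g x) (at x within {0..1})"
    and L: "L-lipschitz_on {0..1} v" "L-lipschitz_on {0..1} g"
    and v0: "\<And>x. x \<in> {0..1} \<Longrightarrow> v0 x = v x"
  shows "L2_inner (\<lambda>x. interp m v x - L2_proj m v0 x) (\<lambda>x. interp m v x - L2_proj m v0 x)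
      \<le> 4 * L\<^sup>2 * (mesh_size m)\<^sup>2"
    and "L2_proj m v0 \<in> S_h m"
proof -
  note N = interp_error_norms[OF m d L]
  have v0b: "ess_bounded v0" using piecewise_C1_ess_bounded(1)[OF Dx_cong(1)[OF N(3) v0]] by blast
  note P = L2_proj_exists[OF m v0b]
  then show PS: "L2_proj m v0 \<in> S_h m" by blast
  note eb = piecewise_C1_ess_bounded(1)[OF S_h_piecewise_C1[OF m]]
  let ?d = "\<lambda>x. interp m v x - L2_proj m v0 x" and ?w = "\<lambda>x. interp m v x - v x"
  have dS: "?d \<in> S_h m"
    using S_h_lincomb[OF m interp_in_S_h[OF m] PS, of 1 v "-1"] by simp
  have vb: "ess_bounded v" using piecewise_C1_ess_bounded(1)[OF N(3)] .
  note ib = eb[OF interp_in_S_h[OF m]]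
  have "L2_inner ?w ?d = L2_inner (interp m v) ?d - L2_inner v ?d"
    by (intro L2_inner_diff_left ib vb eb dS)
  also have "L2_inner v ?d = L2_inner v0 ?d" using v0 by (intro L2_inner_cong) auto
  also have "\<dots> = L2_inner (L2_proj m v0) ?d" using P dS by simp
  also have "L2_inner (interp m v) ?d - \<dots> = L2_inner ?d ?d"
    by (intro L2_inner_diff_left[symmetric] ib eb PS dS)
  finally have "L2_inner ?d ?d \<le> L2_inner ?w ?w"
    by (intro projection_norm_le[OF L2_inner_form_ess_bounded]) (auto intro!: ess_bounded_diff ib vb eb[OF PS])
  also have "L2_inner ?w ?w = L2_inner (\<lambda>x. v x - interp m v x) (\<lambda>x. v x - interp m v x)"
    unfolding L2_inner_def by (intro Bochner_Integration.integral_cong) (auto simp: algebra_simps)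
  finally show "L2_inner ?d ?d \<le> 4 * L\<^sup>2 * (mesh_size m)\<^sup>2" using N(1) by linarith
qed

lemma a_form_minus: "piecewise_C1 f \<Longrightarrow> a_form (\<lambda>x. - f x) (\<lambda>x. - f x) = a_form f f"
proof -
  assume f: "piecewise_C1 f"
  have n: "piecewise_C1 (\<lambda>x. - f x)" using Dx_cmult(1)[OF f, of "- 1"] by simp
  have "a_form (\<lambda>x. - f x) h = - a_form f h" if "piecewise_C1 h" for h
    using a_form_lincomb[OF f f that, of "- 1" 0] by simp
  then show ?thesis using f n a_form_commute[of f "\<lambda>x. - f x"] by simp
qed

text \<open>
  As for the \<open>L\<^sup>2\<close>-projection, with the form \<open>a\<close>; the boundary conditions put \<open>I v\<close> into the space onto
  which \<open>R_h\<close> projects.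
\<close>

lemma R_h_interp_error:
  assumes m: "is_mesh m"
    and d: "\<And>x. x \<in> {0..1} \<Longrightarrow> (v has_real_derivative g x) (at x within {0..1})"
    and L: "L-lipschitz_on {0..1} v" "L-lipschitz_on {0..1} g"
    and bc: "v 0 = 0" "v 1 = 0"
    and v0: "\<And>x. x \<in> {0..1} \<Longrightarrow> v0 x = v x"
  shows "a_form (\<lambda>x. interp m v x - R_h m v0 x) (\<lambda>x. interp m v x - R_h m v0 x)
      \<le> 5 * L\<^sup>2 * (mesh_size m)\<^sup>2"
    and "R_h m v0 \<in> S_h0 m"
proof -
  note N = interp_error_norms[OF m d L]
  have v0p: "piecewise_C1 v0" by (rule Dx_cong(1)[OF N(3) v0])
  note P = R_h_exists[OF m v0p]
  then show PS: "R_h m v0 \<in> S_h0 m" by blast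
  note pw = S_h_piecewise_C1[OF m]
  let ?d = "\<lambda>x. interp m v x - R_h m v0 x" and ?w = "\<lambda>x. interp m v x - v x"
  have dS: "?d \<in> S_h0 m"
    using S_h0_lincomb[OF m interp_in_S_h0[OF m bc] PS, of 1 "-1"] by simp
  note pI = pw[OF interp_in_S_h[OF m]] and pd = pw[OF S_h0_subset[OF dS]] and pR = pw[OF S_h0_subset[OF PS]]
  have diff: "a_form (\<lambda>x. f x - h x) k = a_form f k - a_form h k"
    if "piecewise_C1 f" "piecewise_C1 h" "piecewise_C1 k" for f h k
    using a_form_lincomb[OF that, of 1 "-1"] by simp
  have "a_form ?w ?d = a_form (interp m v) ?d - a_form v ?d" by (intro diff pI N(3) pd)
  also have "a_form v ?d = a_form v0 ?d" using v0 by (intro a_form_cong v0p pd) auto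
  also have "\<dots> = a_form (R_h m v0) ?d" using P dS by simp
  also have "a_form (interp m v) ?d - \<dots> = a_form ?d ?d" by (intro diff[symmetric] pI pR pd)
  finally have "a_form ?d ?d \<le> a_form ?w ?w"
    by (intro projection_norm_le[OF a_form_inner_form_piecewise_C1]) (auto intro!: Dx_diff(1) pI N(3) pd)
  also have "a_form ?w ?w = a_form (\<lambda>x. v x - interp m v x) (\<lambda>x. v x - interp m v x)"
    using a_form_minus[OF Dx_diff(1)[OF N(3) pI]] by simp
  finally show "a_form ?d ?d \<le> 5 * L\<^sup>2 * (mesh_size m)\<^sup>2" using N(2) by linarith
qed

section \<open>The error estimate\<close>

definition discrete_solution ::
  "real \<Rightarrow> mesh \<Rightarrow> real \<Rightarrow> real \<Rightarrow> real \<Rightarrow> (real \<Rightarrow> real) \<Rightarrow> (real \<Rightarrow> real) \<Rightarrow>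
    (real \<Rightarrow> real \<Rightarrow> real) \<Rightarrow> (real \<Rightarrow> real \<Rightarrow> real) \<Rightarrow> bool" where
  "discrete_solution T m \<alpha> \<beta> \<gamma> \<eta>0 u0 \<eta>h uh \<longleftrightarrow>
    semidiscrete_functions T m \<eta>0 u0 \<eta>h uh \<and>
    (\<forall>t\<in>{0..T}. galerkin T m \<alpha> \<beta> \<gamma> (\<lambda>_. 0) (\<lambda>_. 0) \<eta>h uh t)"

lemma semidiscrete_functions_iff:
  "semidiscrete_functions T m \<eta>0 u0 \<eta>h uh \<longleftrightarrow> fe_curves T m \<eta>h uh \<and>
    (\<forall>x\<in>{0..1}. \<eta>h 0 x = L2_proj m \<eta>0 x \<and> uh 0 x = R_h m u0 x)"
  by (auto simp: semidiscrete_functions_def fe_curves_def)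

text \<open>
  The nonconservative terms of the Galerkin equations come from \<open>(u\<^sup>2/2)\<^sub>x = u u\<^sub>x\<close>.
\<close>

lemma galerkin_zero_iff:
  assumes m: "is_mesh m" and S: "\<eta> t \<in> S_h m" "u t \<in> S_h0 m"
  shows "galerkin T m \<alpha> \<beta> \<gamma> (\<lambda>_. 0) (\<lambda>_. 0) \<eta> u t \<longleftrightarrow>
    (\<forall>\<phi>\<in>S_h m. L2_inner (dt T \<eta> t) \<phi> + L2_inner (Dx (u t)) \<phi>
        + \<alpha> * L2_inner (Dx (\<lambda>x. \<eta> t x * u t x)) \<phi> = 0) \<and>
    (\<forall>\<psi>\<in>S_h0 m. a_form (dt T u t) \<psi> + L2_inner (Dx (\<eta> t)) \<psi>
        + \<beta> * L2_inner (\<lambda>x. u t x * Dx (u t) x) \<psi> + \<gamma> * L2_inner (\<lambda>x. \<eta> t x * Dx (\<eta> t) x) \<psi> = 0)"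
proof -
  have pw: "piecewise_C1 (\<eta> t)" "piecewise_C1 (u t)" using S S_h_piecewise_C1[OF m] S_h0_subset by blast+
  note e = piecewise_C1_ess_bounded
  have 1: "L2_inner (Dx (flux1 \<alpha> (\<eta> t) (u t))) \<phi> = L2_inner (Dx (u t)) \<phi> + \<alpha> * L2_inner (Dx (\<lambda>x. \<eta> t x * u t x)) \<phi>"
    if "\<phi> \<in> S_h m" for \<phi>
    by (rule L2_inner_Dx_flux1[OF pw e(1)[OF S_h_piecewise_C1[OF m that]]])
  have 2: "L2_inner (Dx (flux2 \<beta> \<gamma> (\<eta> t) (u t))) \<psi> = L2_inner (Dx (\<eta> t)) \<psi>
        + \<beta> * L2_inner (\<lambda>x. u t x * Dx (u t) x) \<psi> + \<gamma> * L2_inner (\<lambda>x. \<eta> t x * Dx (\<eta> t) x) \<psi>"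
    if "\<psi> \<in> S_h0 m" for \<psi>
  proof -
    have b: "ess_bounded \<psi>" by (rule e(1)[OF S_h_piecewise_C1[OF m S_h0_subset[OF that]]])
    have "L2_inner (Dx (flux2 \<beta> \<gamma> (\<eta> t) (u t))) \<psi> =
        L2_inner (\<lambda>x. Dx (\<eta> t) x + \<beta> * (u t x * Dx (u t) x) + \<gamma> * (\<eta> t x * Dx (\<eta> t) x)) \<psi>"
      using Dx_flux2(2)[OF pw, of \<beta> \<gamma>]
      by (intro L2_inner_cong_AE ess_bounded_add ess_bounded_cmult ess_bounded_mult e pw b) auto
    then show ?thesis
      by (simp only: L2_inner_add_left L2_inner_cmult_left ess_bounded_add ess_bounded_cmult ess_bounded_mult e pw b)
  qed
  show ?thesis unfolding galerkin_def using 1 2 by (auto simp: L2_inner_zero_left add.assoc)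
qed

lemma CB_h_solution_iff:
  assumes "is_mesh m"
  shows "CB_h_solution T m \<eta>0 u0 = discrete_solution T m 1 1 0 \<eta>0 u0"
proof (intro ext)
  fix \<eta>h uh
  show "CB_h_solution T m \<eta>0 u0 \<eta>h uh = discrete_solution T m 1 1 0 \<eta>0 u0 \<eta>h uh"
    unfolding CB_h_solution_def discrete_solution_def
  proof (intro conj_cong refl ball_cong)
    fix t assume "semidiscrete_functions T m \<eta>0 u0 \<eta>h uh" "t \<in> {0..T}"
    then have "\<eta>h t \<in> S_h m" "uh t \<in> S_h0 m" by (auto simp: semidiscrete_functions_def)
    note g = galerkin_zero_iff[of m \<eta>h t uh T 1 1 0, OF assms this]
    show "((\<forall>\<phi>\<in>S_h m. L2_inner (dt T \<eta>h t) \<phi> + L2_inner (Dx (uh t)) \<phi> + L2_inner (Dx (\<lambda>x. \<eta>h t x * uh t x)) \<phi> = 0) \<and>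
        (\<forall>\<psi>\<in>S_h0 m. a_form (dt T uh t) \<psi> + L2_inner (Dx (\<eta>h t)) \<psi> + L2_inner (\<lambda>x. uh t x * Dx (uh t) x) \<psi> = 0)) =
      galerkin T m 1 1 0 (\<lambda>_. 0) (\<lambda>_. 0) \<eta>h uh t"
      unfolding g by simp
  qed
qed

lemma SCB_h_solution_iff:
  assumes "is_mesh m"
  shows "SCB_h_solution T m \<eta>0 u0 = discrete_solution T m (1 / 2) (3 / 2) (1 / 2) \<eta>0 u0"
proof (intro ext)
  fix \<eta>h uh
  show "SCB_h_solution T m \<eta>0 u0 \<eta>h uh = discrete_solution T m (1 / 2) (3 / 2) (1 / 2) \<eta>0 u0 \<eta>h uh"
    unfolding SCB_h_solution_def discrete_solution_def
  proof (intro conj_cong refl ball_cong)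
    fix t assume "semidiscrete_functions T m \<eta>0 u0 \<eta>h uh" "t \<in> {0..T}"
    then have "\<eta>h t \<in> S_h m" "uh t \<in> S_h0 m" by (auto simp: semidiscrete_functions_def)
    note g = galerkin_zero_iff[of m \<eta>h t uh T "1 / 2" "3 / 2" "1 / 2", OF assms this]
    show "((\<forall>\<phi>\<in>S_h m. L2_inner (dt T \<eta>h t) \<phi> + L2_inner (Dx (uh t)) \<phi> + 1/2 * L2_inner (Dx (\<lambda>x. \<eta>h t x * uh t x)) \<phi> = 0) \<and>
        (\<forall>\<psi>\<in>S_h0 m. a_form (dt T uh t) \<psi> + L2_inner (Dx (\<eta>h t)) \<psi> + 3/2 * L2_inner (\<lambda>x. uh t x * Dx (uh t) x) \<psi>
          + 1/2 * L2_inner (\<lambda>x. \<eta>h t x * Dx (\<eta>h t) x) \<psi> = 0)) =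
      galerkin T m (1 / 2) (3 / 2) (1 / 2) (\<lambda>_. 0) (\<lambda>_. 0) \<eta>h uh t"
      by (rule g[symmetric])
  qed
qed

text \<open>
  With initial energy and squared residual both \<open>O(h\<^sup>2)\<close>, the stability estimate yields energy
  \<open>O(h\<^sup>2)\<close>; the interpolation errors are of the same order.
\<close>

lemma error_estimate:
  fixes T :: real and F :: "mesh set"
  assumes T: "0 < T" and F: "quasiuniform_family F"
    and sol: "Boussinesq_solution T \<alpha> \<beta> \<gamma> \<eta> u"
    and W: "\<eta> \<in> C_time T (Winf 2) (Winf_norm 2)"
    and init: "\<And>x. x \<in> {0..1} \<Longrightarrow> \<eta> 0 x = \<eta>0 x \<and> u 0 x = u0 x"
  shows "\<exists>h0>0. \<exists>C. \<forall>m\<in>F. mesh_size m \<le> h0 \<longrightarrow>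
    (\<exists>\<eta>h uh. unique_solution_on T (discrete_solution T m \<alpha> \<beta> \<gamma> \<eta>0 u0) \<eta>h uh \<and>
      (\<forall>t\<in>{0..T}. L2_norm (\<lambda>x. \<eta> t x - \<eta>h t x) \<le> C * mesh_size m) \<and>
      (\<forall>t\<in>{0..T}. norm_1 (\<lambda>x. u t x - uh t x) \<le> C * mesh_size m))"
proof -
  obtain L where L0: "0 \<le> L" and reg: "regularity_bound T L \<eta> u"
    using regularity_bound_exists[OF T sol W] by blast
  obtain \<sigma> where \<sigma>: "\<And>m. m \<in> F \<Longrightarrow> mesh_size m / min_mesh_size m \<le> \<sigma>" and mesh: "\<And>m. m \<in> F \<Longrightarrow> is_mesh m"
    using F by (auto simp: quasiuniform_family_def)
  have sm: "classically_smooth T \<eta> u" and bc: "\<And>t. t \<in> {0..T} \<Longrightarrow> u t 0 = 0 \<and> u t 1 = 0"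
    using sol by (auto simp: Boussinesq_solution_def)
  note sm' = sm[unfolded classically_smooth_def]
  have d: "(\<eta> t has_real_derivative dx \<eta> t x) (at x within {0..1})" "(u t has_real_derivative dx u t x) (at x within {0..1})"
    if "t \<in> {0..T}" "x \<in> {0..1}" for t x
    using sm' that by (auto intro: x_differentiable_has_derivative)
  have lip: "L-lipschitz_on {0..1} (\<eta> t)" "L-lipschitz_on {0..1} (dx \<eta> t)"
    "L-lipschitz_on {0..1} (u t)" "L-lipschitz_on {0..1} (dx u t)"
    "\<And>x. x \<in> {0..1} \<Longrightarrow> \<bar>\<eta> t x\<bar> \<le> L" "\<And>x. x \<in> {0..1} \<Longrightarrow> \<bar>u t x\<bar> \<le> L" if "t \<in> {0..T}" for t
    using reg that by (auto simp: regularity_bound_def)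
  \<comment> \<open>The residuals are at most \<open>C1 h\<close>, the initial energy is at most \<open>9 L\<^sup>2 h\<^sup>2\<close>, and the error energy at most
    \<open>C2 h\<^sup>2\<close>. Quasiuniformity bounds \<open>h\<close> by \<open>\<tau>\<close> times the smallest mesh width, and \<open>h0\<close> is chosen such that
    \<open>C2 h\<^sup>2\<close> is then below a third of that width.\<close>
  define C1 where "C1 = (3 + 8 * (\<bar>\<alpha>\<bar> + \<bar>\<beta>\<bar> + \<bar>\<gamma>\<bar>) * L) * L"
  define K where "K = 2 * energy_rate \<alpha> \<beta> \<gamma> (3 * L)"
  define C2 where "C2 = (9 * L\<^sup>2 + C1\<^sup>2) * exp (K * T)"
  have C2: "0 \<le> C2" by (simp add: C2_def)
  define \<tau> where "\<tau> = max \<sigma> 1"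
  define h0 where "h0 = 1 / (4 * \<tau> * (C2 + 1))"
  define C where "C = sqrt (10 * L\<^sup>2 + 2 * C2)"
  have CC: "C\<^sup>2 = 10 * L\<^sup>2 + 2 * C2" "0 \<le> C" using C2 by (auto simp: C_def)
  have h0: "0 < h0" using C2 by (simp add: h0_def \<tau>_def max_def)
  have K0: "0 \<le> K" using energy_rate_ge_1[of "3 * L" \<alpha> \<beta> \<gamma>] L0 by (simp add: K_def)
  have T0: "0 \<in> {0..T}" using T by simp
  have "\<exists>\<eta>h uh. unique_solution_on T (discrete_solution T m \<alpha> \<beta> \<gamma> \<eta>0 u0) \<eta>h uh \<and>
      (\<forall>t\<in>{0..T}. L2_norm (\<lambda>x. \<eta> t x - \<eta>h t x) \<le> C * mesh_size m) \<and>
      (\<forall>t\<in>{0..T}. norm_1 (\<lambda>x. u t x - uh t x) \<le> C * mesh_size m)"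
    if mF: "m \<in> F" and small: "mesh_size m \<le> h0" for m
  proof -
    have m: "is_mesh m" by (rule mesh[OF mF])
    define h where "h = mesh_size m"
    have h: "0 < h" "h \<le> h0" using mesh_size_pos[OF m] small by (auto simp: h_def)
    have mn: "0 < min_mesh_size m" by (rule min_mesh_size_pos[OF m])
    define Z where "Z = (\<lambda>t. interp m (\<eta> t))"
    define U where "U = (\<lambda>t. interp m (u t))"
    define r1 where "r1 = (\<lambda>t x. dt T Z t x + Dx (flux1 \<alpha> (Z t) (U t)) x)"
    define r2 where "r2 = (\<lambda>t x. dt T U t x - 1 / 3 * dt T (dx (dx u)) t x + Dx (flux2 \<beta> \<gamma> (Z t) (U t)) x)"
    define c where "c = C1 * h"
    have c_eq: "c = (3 + 8 * (\<bar>\<alpha>\<bar> + \<bar>\<beta>\<bar> + \<bar>\<gamma>\<bar>) * L) * (L * mesh_size m)" by (simp add: c_def C1_def h_def)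
    have cons: "galerkin T m \<alpha> \<beta> \<gamma> (r1 t) (r2 t) Z U t" "ess_bounded (r1 t) \<and> ess_bounded (r2 t)"
      "(AE x in unit_measure. \<bar>r1 t x\<bar> \<le> c) \<and> (AE x in unit_measure. \<bar>r2 t x\<bar> \<le> c)" if "t \<in> {0..T}" for t
      unfolding c_eq r1_def r2_def Z_def U_def by (rule interp_consistency[OF m T sol reg that])+
    have ZU: "fe_curves T m Z U"
      unfolding fe_curves_def Z_def U_def
      using interp_in_S_h[OF m] interp_in_S_h0[OF m] bc interp_curve(1)[OF m T] sm' by auto
    have ZS: "Z t \<in> S_h m" "U t \<in> S_h0 m" if "t \<in> {0..T}" for t using ZU that by (auto simp: fe_curves_def)
    have Mb: "W1inf_bound (3 * L) (Z t) \<and> W1inf_bound (3 * L) (U t)" if "t \<in> {0..T}" for t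
      unfolding Z_def U_def using interp_W1inf(2)[OF m] lip[OF that] by blast
    note P = L2_proj_interp_error[OF m d(1)[OF T0] lip(1,2)[OF T0], of \<eta>0]
    note Rh = R_h_interp_error[OF m d(2)[OF T0] lip(3,4)[OF T0], of u0]
    have PS: "L2_proj m \<eta>0 \<in> S_h m" "R_h m u0 \<in> S_h0 m" using P(2) Rh(2) init bc[OF T0] by auto
    define E0 where "E0 = energy (\<lambda>x. Z 0 x - L2_proj m \<eta>0 x) (\<lambda>x. U 0 x - R_h m u0 x)"
    have E0le: "E0 \<le> 9 * L\<^sup>2 * h\<^sup>2"
      using P(1) Rh(1) init bc[OF T0] unfolding E0_def energy_def Z_def U_def h_def by fastforce
    have E0c: "(E0 + c\<^sup>2) * exp (K * t) \<le> C2 * h\<^sup>2" if "t \<in> {0..T}" for t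
    proof -
      have "(E0 + c\<^sup>2) * exp (K * t) \<le> (9 * L\<^sup>2 * h\<^sup>2 + c\<^sup>2) * exp (K * T)"
        using E0le K0 that energy_nonneg by (intro mult_mono add_mono) (auto simp: E0_def intro!: mult_left_mono)
      also have "\<dots> = C2 * h\<^sup>2" by (simp add: C2_def c_def power_mult_distrib algebra_simps)
      finally show ?thesis .
    qed
    have "h / min_mesh_size m \<le> \<tau>" using \<sigma>[OF mF] by (simp add: h_def \<tau>_def)
    then have hmin: "h \<le> \<tau> * min_mesh_size m" using mn by (simp add: divide_le_eq)
    have "C2 * h\<^sup>2 < min_mesh_size m / 3"
    proof -
      have \<tau>1: "1 \<le> \<tau>" by (simp add: \<tau>_def)
      have "C2 * h * \<tau> \<le> C2 * h0 * \<tau>" using h C2 \<tau>1 by (intro mult_right_mono mult_left_mono) auto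
      also have "\<dots> = C2 / (4 * (C2 + 1))" using C2 \<tau>1 by (simp add: h0_def)
      also have "\<dots> \<le> 1 / 4" using C2 by (simp add: field_simps)
      finally have "C2 * h * \<tau> \<le> 1 / 4" .
      then have "(C2 * h * \<tau>) * min_mesh_size m \<le> 1 / 4 * min_mesh_size m" using mn by (intro mult_right_mono) auto
      moreover have "C2 * h\<^sup>2 \<le> (C2 * h) * (\<tau> * min_mesh_size m)"
        using mult_left_mono[OF hmin, of "C2 * h"] C2 h by (simp add: power2_eq_square mult.assoc)
      moreover have "(C2 * h) * (\<tau> * min_mesh_size m) = (C2 * h * \<tau>) * min_mesh_size m" by simp
      ultimately show ?thesis using mn by linarith
    qed
    then have smallE: "(E0 + c\<^sup>2) * exp (2 * energy_rate \<alpha> \<beta> \<gamma> (3 * L) * T) < min_mesh_size m / 3"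
      using E0c[of T] T by (simp add: K_def)
    obtain \<eta>h uh where hu: "fe_curves T m \<eta>h uh"
      and ini: "\<And>x. x \<in> {0..1} \<Longrightarrow> \<eta>h 0 x = L2_proj m \<eta>0 x \<and> uh 0 x = R_h m u0 x"
      and gal: "\<And>t. t \<in> {0..T} \<Longrightarrow> galerkin T m \<alpha> \<beta> \<gamma> (\<lambda>_. 0) (\<lambda>_. 0) \<eta>h uh t"
      and err: "\<And>t. t \<in> {0..T} \<Longrightarrow> error_energy Z U \<eta>h uh t + c\<^sup>2 \<le> (E0 + c\<^sup>2) * exp (K * t)"
      using galerkin_solution_exists[OF m T ZU Mb _ cons(1) cons(2) cons(3) PS E0_def smallE] L0
      unfolding K_def by auto
    have ds: "discrete_solution T m \<alpha> \<beta> \<gamma> \<eta>0 u0 \<eta>h uh"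
      unfolding discrete_solution_def semidiscrete_functions_iff using hu ini gal by blast
    have "unique_solution_on T (discrete_solution T m \<alpha> \<beta> \<gamma> \<eta>0 u0) \<eta>h uh"
      unfolding unique_solution_on_def
    proof (intro conjI ds allI impI ballI)
      fix \<eta>' u' :: "real \<Rightarrow> real \<Rightarrow> real" and t x :: real
      assume s: "discrete_solution T m \<alpha> \<beta> \<gamma> \<eta>0 u0 \<eta>' u'" and tx: "t \<in> {0..T}" "x \<in> {0..1}"
      have "\<eta>' t x = \<eta>h t x \<and> u' t x = uh t x"
        using s ds ini unfolding discrete_solution_def semidiscrete_functions_iff
        by (intro galerkin_solution_unique[OF m T _ hu _ gal _ tx]) auto
      then show "\<eta>' t x = \<eta>h t x" "u' t x = uh t x" by auto
    qed
    moreover have "L2_norm (\<lambda>x. \<eta> t x - \<eta>h t x) \<le> C * h \<and> norm_1 (\<lambda>x. u t x - uh t x) \<le> C * h"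
      if t: "t \<in> {0..T}" for t
    proof -
      have hS: "\<eta>h t \<in> S_h m" "uh t \<in> S_h0 m" using hu t by (auto simp: fe_curves_def)
      note pw = S_h_piecewise_C1[OF m]
      note N1 = interp_error_norms[OF m d(1)[OF t] lip(1,2)[OF t]] and N2 = interp_error_norms[OF m d(2)[OF t] lip(3,4)[OF t]]
      have E: "error_energy Z U \<eta>h uh t \<le> C2 * h\<^sup>2" using err[OF t] E0c[OF t] zero_le_power2[of c] by linarith
      have El: "L2_inner (\<lambda>x. Z t x - \<eta>h t x) (\<lambda>x. Z t x - \<eta>h t x) \<le> C2 * h\<^sup>2"
        "a_form (\<lambda>x. U t x - uh t x) (\<lambda>x. U t x - uh t x) \<le> C2 * h\<^sup>2"
        using E L2_inner_nonneg[of "\<lambda>x. Z t x - \<eta>h t x"] a_form_nonneg[of "\<lambda>x. U t x - uh t x"]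
        unfolding error_energy_def energy_def by linarith+
      have "L2_inner (\<lambda>x. \<eta> t x - \<eta>h t x) (\<lambda>x. \<eta> t x - \<eta>h t x) \<le>
          2 * L2_inner (\<lambda>x. \<eta> t x - Z t x) (\<lambda>x. \<eta> t x - Z t x) +
          2 * L2_inner (\<lambda>x. (\<eta> t x - Z t x) - (\<eta> t x - \<eta>h t x)) (\<lambda>x. (\<eta> t x - Z t x) - (\<eta> t x - \<eta>h t x))"
        by (rule inner_form_parallelogram[OF L2_inner_form_ess_bounded])
          (auto intro!: ess_bounded_diff piecewise_C1_ess_bounded(1)[OF N1(3)]
            piecewise_C1_ess_bounded(1)[OF pw[OF ZS(1)[OF t]]] piecewise_C1_ess_bounded(1)[OF pw[OF hS(1)]])
      also have "L2_inner (\<lambda>x. (\<eta> t x - Z t x) - (\<eta> t x - \<eta>h t x)) (\<lambda>x. (\<eta> t x - Z t x) - (\<eta> t x - \<eta>h t x)) =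
          L2_inner (\<lambda>x. Z t x - \<eta>h t x) (\<lambda>x. Z t x - \<eta>h t x)"
        unfolding L2_inner_def by (intro Bochner_Integration.integral_cong) (auto simp: algebra_simps)
      finally have "L2_inner (\<lambda>x. \<eta> t x - \<eta>h t x) (\<lambda>x. \<eta> t x - \<eta>h t x) \<le> 10 * L\<^sup>2 * h\<^sup>2 + 2 * (C2 * h\<^sup>2)"
        using N1(1) El(1) zero_le_power2[of "L * h"] unfolding Z_def h_def power_mult_distrib by linarith
      also have "\<dots> = (C * h)\<^sup>2" by (simp add: power_mult_distrib CC algebra_simps)
      finally have 1: "L2_norm (\<lambda>x. \<eta> t x - \<eta>h t x) \<le> C * h"
        unfolding L2_norm_def using CC(2) h by (intro real_le_lsqrt L2_inner_nonneg) auto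
      have "a_form (\<lambda>x. u t x - uh t x) (\<lambda>x. u t x - uh t x) \<le>
          2 * a_form (\<lambda>x. u t x - U t x) (\<lambda>x. u t x - U t x) +
          2 * a_form (\<lambda>x. (u t x - U t x) - (u t x - uh t x)) (\<lambda>x. (u t x - U t x) - (u t x - uh t x))"
        by (rule inner_form_parallelogram[OF a_form_inner_form_piecewise_C1])
          (auto intro!: Dx_diff(1) N2(3) pw[OF S_h0_subset[OF ZS(2)[OF t]]] pw[OF S_h0_subset[OF hS(2)]])
      also have "(\<lambda>x. (u t x - U t x) - (u t x - uh t x)) = (\<lambda>x. - (U t x - uh t x))" by auto
      also have "a_form (\<lambda>x. - (U t x - uh t x)) (\<lambda>x. - (U t x - uh t x)) = a_form (\<lambda>x. U t x - uh t x) (\<lambda>x. U t x - uh t x)"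
        by (intro a_form_minus Dx_diff(1) pw S_h0_subset ZS hS t)
      finally have "a_form (\<lambda>x. u t x - uh t x) (\<lambda>x. u t x - uh t x) \<le> 10 * L\<^sup>2 * h\<^sup>2 + 2 * (C2 * h\<^sup>2)"
        using N2(2) El(2) unfolding U_def h_def by linarith
      also have "\<dots> = (C * h)\<^sup>2" by (simp add: power_mult_distrib CC algebra_simps)
      finally have 2: "norm_1 (\<lambda>x. u t x - uh t x) \<le> C * h"
        unfolding norm_1_def L2_norm_def real_sqrt_pow2[OF L2_inner_nonneg] a_form_def[symmetric]
        using CC(2) h by (intro real_le_lsqrt a_form_nonneg) auto
      show ?thesis using 1 2 by blast
    qed
    ultimately show ?thesis unfolding h_def by blast
  qed
  then show ?thesis using h0 by blast
qed

lemma dx_product: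
  assumes "x_differentiable T \<eta>" "x_differentiable T u" "t \<in> {0..T}" "x \<in> {0..1}"
  shows "dx (\<lambda>s y. \<eta> s y * u s y) t x = dx \<eta> t x * u t x + \<eta> t x * dx u t x"
proof (rule has_derivative_imp_dx[OF assms(4)])
  show "((\<lambda>y. \<eta> t y * u t y) has_real_derivative dx \<eta> t x * u t x + \<eta> t x * dx u t x) (at x within {0..1})"
    using DERIV_mult[OF x_differentiable_has_derivative[OF assms(1,3,4)] x_differentiable_has_derivative[OF assms(2,3,4)]]
    by (simp add: algebra_simps)
qed

lemma CB_solution_imp:
  assumes "CB_solution T \<eta>0 u0 \<eta> u"
  shows "Boussinesq_solution T 1 1 0 \<eta> u" "\<And>x. x \<in> {0..1} \<Longrightarrow> \<eta> 0 x = \<eta>0 x \<and> u 0 x = u0 x"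
proof -
  have xd: "x_differentiable T \<eta>" "x_differentiable T u"
    using assms by (auto simp: CB_solution_def classically_smooth_def)
  show "Boussinesq_solution T 1 1 0 \<eta> u"
    using assms dx_product[OF xd]
    unfolding CB_solution_def Boussinesq_solution_def initial_boundary_conditions_def by (simp add: algebra_simps)
  show "\<eta> 0 x = \<eta>0 x \<and> u 0 x = u0 x" if "x \<in> {0..1}" for x
    using assms that by (simp add: CB_solution_def initial_boundary_conditions_def)
qed

lemma SCB_solution_imp:
  assumes "SCB_solution T \<eta>0 u0 \<eta> u"
  shows "Boussinesq_solution T (1 / 2) (3 / 2) (1 / 2) \<eta> u" "\<And>x. x \<in> {0..1} \<Longrightarrow> \<eta> 0 x = \<eta>0 x \<and> u 0 x = u0 x"
proof -
  have xd: "x_differentiable T \<eta>" "x_differentiable T u"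
    using assms by (auto simp: SCB_solution_def classically_smooth_def)
  show "Boussinesq_solution T (1 / 2) (3 / 2) (1 / 2) \<eta> u"
    using assms dx_product[OF xd]
    unfolding SCB_solution_def Boussinesq_solution_def initial_boundary_conditions_def by (simp add: algebra_simps)
  show "\<eta> 0 x = \<eta>0 x \<and> u 0 x = u0 x" if "x \<in> {0..1}" for x
    using assms that by (simp add: SCB_solution_def initial_boundary_conditions_def)
qed

theorem proposition2p1:
  fixes T :: real and \<eta>0 u0 :: "real \<Rightarrow> real" and F :: "mesh set"
  assumes "0 < T" and "quasiuniform_family F"
  shows
    "(\<forall>\<eta> u. CB_solution T \<eta>0 u0 \<eta> u \<and>
        \<eta> \<in> C_time T (Winf 2) (Winf_norm 2) \<and>
        u \<in> C_time T (Winf 2 \<inter> H1_0) (Winf_norm 2) \<longrightarrow>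
        (\<exists>h0>0. \<exists>C. \<forall>m\<in>F. mesh_size m \<le> h0 \<longrightarrow>
          (\<exists>\<eta>h uh. unique_solution_on T (CB_h_solution T m \<eta>0 u0) \<eta>h uh \<and>
            (\<forall>t\<in>{0..T}. L2_norm (\<lambda>x. \<eta> t x - \<eta>h t x) \<le> C * mesh_size m) \<and>
            (\<forall>t\<in>{0..T}. norm_1 (\<lambda>x. u t x - uh t x) \<le> C * mesh_size m)))) \<and>
     (\<forall>\<eta> u. SCB_solution T \<eta>0 u0 \<eta> u \<and>
        \<eta> \<in> C_time T (Winf 2) (Winf_norm 2) \<and>
        u \<in> C_time T (Winf 2 \<inter> H1_0) (Winf_norm 2) \<longrightarrow>
        (\<exists>h0>0. \<exists>C. \<forall>m\<in>F. mesh_size m \<le> h0 \<longrightarrow>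
          (\<exists>\<eta>h uh. unique_solution_on T (SCB_h_solution T m \<eta>0 u0) \<eta>h uh \<and>
            (\<forall>t\<in>{0..T}. L2_norm (\<lambda>x. \<eta> t x - \<eta>h t x) \<le> C * mesh_size m) \<and>
            (\<forall>t\<in>{0..T}. norm_1 (\<lambda>x. u t x - uh t x) \<le> C * mesh_size m))))"
proof (intro conjI allI impI)
  have mesh: "is_mesh m" if "m \<in> F" for m using assms(2) that by (simp add: quasiuniform_family_def)
  {
    fix \<eta> u
    assume a: "CB_solution T \<eta>0 u0 \<eta> u \<and> \<eta> \<in> C_time T (Winf 2) (Winf_norm 2) \<and>
      u \<in> C_time T (Winf 2 \<inter> H1_0) (Winf_norm 2)"
    then have s: "CB_solution T \<eta>0 u0 \<eta> u" and W: "\<eta> \<in> C_time T (Winf 2) (Winf_norm 2)" by auto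
    show "\<exists>h0>0. \<exists>C. \<forall>m\<in>F. mesh_size m \<le> h0 \<longrightarrow>
          (\<exists>\<eta>h uh. unique_solution_on T (CB_h_solution T m \<eta>0 u0) \<eta>h uh \<and>
            (\<forall>t\<in>{0..T}. L2_norm (\<lambda>x. \<eta> t x - \<eta>h t x) \<le> C * mesh_size m) \<and>
            (\<forall>t\<in>{0..T}. norm_1 (\<lambda>x. u t x - uh t x) \<le> C * mesh_size m))"
      using error_estimate[OF assms CB_solution_imp(1)[OF s] W CB_solution_imp(2)[OF s]]
      by (simp add: CB_h_solution_iff[OF mesh] cong: ball_cong)
  }
  {
    fix \<eta> u
    assume a: "SCB_solution T \<eta>0 u0 \<eta> u \<and> \<eta> \<in> C_time T (Winf 2) (Winf_norm 2) \<and>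
      u \<in> C_time T (Winf 2 \<inter> H1_0) (Winf_norm 2)"
    then have s: "SCB_solution T \<eta>0 u0 \<eta> u" and W: "\<eta> \<in> C_time T (Winf 2) (Winf_norm 2)" by auto
    show "\<exists>h0>0. \<exists>C. \<forall>m\<in>F. mesh_size m \<le> h0 \<longrightarrow>
          (\<exists>\<eta>h uh. unique_solution_on T (SCB_h_solution T m \<eta>0 u0) \<eta>h uh \<and>
            (\<forall>t\<in>{0..T}. L2_norm (\<lambda>x. \<eta> t x - \<eta>h t x) \<le> C * mesh_size m) \<and>
            (\<forall>t\<in>{0..T}. norm_1 (\<lambda>x. u t x - uh t x) \<le> C * mesh_size m))"
      using error_estimate[OF assms SCB_solution_imp(1)[OF s] W SCB_solution_imp(2)[OF s]]
      by (simp add: SCB_h_solution_iff[OF mesh] cong: ball_cong)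
  }
qed

end
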